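(* Let $w(x)=w_0(|x|)$ be a radial weight. The following statements are equivalent: (a) There exists $N>0$ such that at least one of the three families of constants $[w]_{A_1(\mathbb R^n)}$, $[w]^{\ast}_{A_1(\mathbb R^n)}$, $(w)_{A_1(\mathbb R^n)}$ is bounded uniformly in $n$ for all $n>N$. (b) There exist $N>0$ and a constant $C>0$ such that for all $n>N$, all radial $f\in L^1(\mathbb R^n,w)$ and all $\lambda>0$, $$w\big(\{x\in\mathbb R^n:\mathcal A f(x)>\lambda\}\big)\le\frac C\lambda\int_{\mathbb R^n}|f(x)|\,w(x)\,dx.$$ (c) $w_0$ is essentially constant over dyadic intervals and decreasing up to a constant, i.e. there exist positive constants $\beta$ and $\eta$ such that $$\operatorname*{ess\,sup}_{r\in[R,2R]}w_0(r)\le\beta\operatorname*{ess\,inf}_{r\in[R,2R]}w_0(r)\quad\text{for all }R>0,$$ and $$w_0(s)\le\eta\,w_0(t)\quad\text{for almost all } s\ge t\ge0.$$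
   Context: A weight on $\mathbb R^n$ is an a.e. nonnegative, locally integrable function; for a measurable set $E$, $w(E)=\int_E w$, and $L^1(\mathbb R^n,w)$ is the space of $f$ with $\int_{\mathbb R^n}|f|w<\infty$. A radial weight is given by a measurable $w_0:[0,\infty)\to[0,\infty]$ through $w(x)=w_0(|x|)$, considered simultaneously in all dimensions; it is assumed that $w$ is locally integrable on $\mathbb R^n$ for all sufficiently large $n$. $B_R(x)$ denotes the Euclidean ball of radius $R$ centered at $x$, and $Mg(x)=\sup_{R>0}\frac1{|B_R(x)|}\int_{B_R(x)}|g(y)|\,dy$. Define $[w]_{A_1(\mathbb R^n)}$ as the smallest $C$ such that $\frac{w(B_R(x))}{|B_R(x)|}\le C\operatorname*{ess\,inf}_{y\in B_R(x)}w(y)$ for a.e. $x\in\mathbb R^n$ and all $R>0$, and $[w]^{\ast}_{A_1(\mathbb R^n)}$ as the smallest $C$ such that $Mw(x)\le C\,w(x)$ for a.e. $x\in\mathbb R^n$. With $v_n(t)=t^{n-1}$, define $(w)_{A_1(\mathbb R^n)}$ as the smallest $C$ such that $$\frac{\int_I w_0(t)t^{n-1}\,dt}{\int_I t^{n-1}\,dt}\le C\operatorname*{ess\,inf}_{t\in I}w_0(t)$$ for all bounded intervals $I\subset[0,\infty)$ of positive length. (These constants are $\infty$ if no such $C$ exists.) The maximal operator over centered rings on $\mathbb R^n$ is $$\mathcal A u(x)=\sup_{0\le a\le|x|\le b,\ a<b}\ \frac{1}{|\{a\le|y|\le b\}|}\int_{a\le|y|\le b}|u(y)|\,dy.$$ 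*)

theory Defs
  imports "HOL-Probability.Essential_Supremum"
begin

text \<open>
  The dimension \<open>n\<close> is quantified inside the statements, so it cannot be a type. Points of
  \<open>n\<close>-dimensional space are the extensional functions on \<open>{..<n}\<close>, i.e. the elements of
  \<open>{..<n} \<rightarrow>\<^sub>E UNIV\<close>, and \<open>leb n\<close> is Lebesgue measure there (the completed product measure).
  Weights and averages take values in \<^typ>\<open>ennreal\<close>, where integrals and suprema always exist.
\<close>

definition leb :: "nat \<Rightarrow> (nat \<Rightarrow> real) measure" where
  "leb n = completion (Pi\<^sub>M {..<n} (\<lambda>_. lborel))"

abbreviation Rn :: "nat \<Rightarrow> (nat \<Rightarrow> real) set" where
  "Rn n \<equiv> space (leb n)"

definition nrm :: "nat \<Rightarrow> (nat \<Rightarrow> real) \<Rightarrow> real" where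
  "nrm n x = L2_set x {..<n}"

definition nball :: "nat \<Rightarrow> (nat \<Rightarrow> real) \<Rightarrow> real \<Rightarrow> (nat \<Rightarrow> real) set" where
  "nball n x R = {y \<in> Rn n. nrm n (\<lambda>i. y i - x i) < R}"

definition centered_ring :: "nat \<Rightarrow> real \<Rightarrow> real \<Rightarrow> (nat \<Rightarrow> real) set" where
  "centered_ring n a b = {y \<in> Rn n. a \<le> nrm n y \<and> nrm n y \<le> b}"

text \<open>The order dual of \<^const>\<open>esssup\<close> (which additionally is \<open>top\<close> on non-measurable functions).\<close>

definition essinf :: "'a measure \<Rightarrow> ('a \<Rightarrow> ennreal) \<Rightarrow> ennreal" where
  "essinf M f = Liminf (ae_filter M) f"

definition weighted :: "nat \<Rightarrow> ((nat \<Rightarrow> real) \<Rightarrow> ennreal) \<Rightarrow> (nat \<Rightarrow> real) set \<Rightarrow> ennreal" where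
  "weighted n w E = (\<integral>\<^sup>+y\<in>E. w y \<partial>leb n)"

definition average :: "nat \<Rightarrow> ((nat \<Rightarrow> real) \<Rightarrow> ennreal) \<Rightarrow> (nat \<Rightarrow> real) set \<Rightarrow> ennreal" where
  "average n g E = weighted n g E / emeasure (leb n) E"

definition locally_integrable :: "nat \<Rightarrow> ((nat \<Rightarrow> real) \<Rightarrow> ennreal) \<Rightarrow> bool" where
  "locally_integrable n w \<longleftrightarrow> w \<in> borel_measurable (leb n) \<and>
     (\<forall>x\<in>Rn n. \<forall>R>0. weighted n w (nball n x R) < \<infinity>)"

text \<open>Only the values of the profile \<open>w0\<close> on \<open>{0..}\<close> matter, here and below.\<close>

definition radial_weight :: "(real \<Rightarrow> ennreal) \<Rightarrow> bool" where
  "radial_weight w0 \<longleftrightarrow> w0 \<in> borel_measurable (lebesgue_on {0..}) \<and>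
     (\<exists>n0. \<forall>n\<ge>n0. locally_integrable n (\<lambda>x. w0 (nrm n x)))"

definition maximal :: "nat \<Rightarrow> ((nat \<Rightarrow> real) \<Rightarrow> ennreal) \<Rightarrow> (nat \<Rightarrow> real) \<Rightarrow> ennreal" where
  "maximal n g x = (SUP R\<in>{0<..}. average n g (nball n x R))"

definition ring_maximal :: "nat \<Rightarrow> ((nat \<Rightarrow> real) \<Rightarrow> real) \<Rightarrow> (nat \<Rightarrow> real) \<Rightarrow> ennreal" where
  "ring_maximal n u x =
     (SUP (a, b)\<in>{(a, b). 0 \<le> a \<and> a \<le> nrm n x \<and> nrm n x \<le> b \<and> a < b}.
        average n (\<lambda>y. ennreal \<bar>u y\<bar>) (centered_ring n a b))"

text \<open>
  In the three constants below \<open>C\<close> ranges over the nonnegative reals; the infimum is \<open>\<infinity>\<close> if no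
  real \<open>C\<close> is admissible.
\<close>

definition A1_const :: "nat \<Rightarrow> ((nat \<Rightarrow> real) \<Rightarrow> ennreal) \<Rightarrow> ennreal" where
  "A1_const n w = (INF C\<in>{C::real. 0 \<le> C \<and>
     (AE x in leb n. \<forall>R>0. average n w (nball n x R)
        \<le> ennreal C * essinf (restrict_space (leb n) (nball n x R)) w)}. ennreal C)"

definition A1_star_const :: "nat \<Rightarrow> ((nat \<Rightarrow> real) \<Rightarrow> ennreal) \<Rightarrow> ennreal" where
  "A1_star_const n w = (INF C\<in>{C::real. 0 \<le> C \<and>
     (AE x in leb n. maximal n w x \<le> ennreal C * w x)}. ennreal C)"

definition A1_radial_const :: "nat \<Rightarrow> (real \<Rightarrow> ennreal) \<Rightarrow> ennreal" where
  "A1_radial_const n w0 = (INF C\<in>{C::real. 0 \<le> C \<and>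
     (\<forall>I. is_interval I \<and> bounded I \<and> I \<subseteq> {0..} \<and> emeasure lebesgue I > 0 \<longrightarrow>
        (\<integral>\<^sup>+t\<in>I. w0 t * ennreal (t ^ (n - 1)) \<partial>lebesgue) / (\<integral>\<^sup>+t\<in>I. ennreal (t ^ (n - 1)) \<partial>lebesgue)
        \<le> ennreal C * essinf (lebesgue_on I) w0)}. ennreal C)"

definition bounded_beyond :: "nat \<Rightarrow> (nat \<Rightarrow> ennreal) \<Rightarrow> bool" where
  "bounded_beyond N c \<longleftrightarrow> (\<exists>K::real. \<forall>n>N. c n \<le> ennreal K)"

definition radial_fun :: "nat \<Rightarrow> ((nat \<Rightarrow> real) \<Rightarrow> real) \<Rightarrow> bool" where
  "radial_fun n f \<longleftrightarrow> (\<forall>x\<in>Rn n. \<forall>y\<in>Rn n. nrm n x = nrm n y \<longrightarrow> f x = f y)"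

definition in_L1 :: "nat \<Rightarrow> ((nat \<Rightarrow> real) \<Rightarrow> ennreal) \<Rightarrow> ((nat \<Rightarrow> real) \<Rightarrow> real) \<Rightarrow> bool" where
  "in_L1 n w f \<longleftrightarrow> f \<in> borel_measurable (leb n) \<and> (\<integral>\<^sup>+x. ennreal \<bar>f x\<bar> * w x \<partial>leb n) < \<infinity>"

end

theory Submission
  imports Defs
begin

text \<open>
  All three statements are equivalent to a single condition on a Borel representative \<open>W\<close> of
  the profile, called \<open>almost_decreasing\<close> below: \<open>W s \<le> K W r\<close> for almost all \<open>r > 0\<close> and almost all
  \<open>s \<ge> r / 2\<close>. Since \<open>s\<close> may lie below \<open>r\<close> by a factor of two, this one inequality expresses both halves
  of (c): it is the monotonicity up to a constant for \<open>s \<ge> r\<close> and the essential constancy on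
  dyadic intervals for \<open>r / 2 \<le> s \<le> r\<close>.

  From the condition to (a) and (b). The essential supremum \<open>V r\<close> of \<open>W\<close> over \<open>[r, \<infinity>)\<close> is a genuinely
  decreasing function with \<open>V t \<le> K\<^sup>2 V (2t)\<close>, and \<open>W\<close> is comparable to it (\<open>decreasing_majorant\<close>).
  Hence, for a power \<open>p\<close> that depends on \<open>K\<close> only, \<open>W t\<close> is at most a constant times \<open>(b/t)\<^sup>p V b\<close>
  on \<open>(0, b)\<close>, while \<open>V b\<close> is at most a constant times \<open>W t\<close>. As soon as \<open>n > 2p\<close>, the weight
  \<open>(b/t)\<^sup>p t\<^bsup>n-1\<^esup>\<close> has at most twice the integral of \<open>t\<^bsup>n-1\<^esup>\<close> over any interval ending at \<open>b\<close>, so the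
  one-dimensional \<open>A\<^sub>1\<close> inequality holds with a constant independent of \<open>n\<close>
  (\<open>interval_A1_if_almost_decreasing\<close>). In polar coordinates it is an \<open>A\<^sub>1\<close> inequality for shells around
  the origin. A finite family of intervals can be thinned out so that no point lies in more than two of
  them, and the weak type bound (b) follows as for the one-dimensional maximal function
  (\<open>weak_type_if_interval_A1\<close>). Conversely, (b) tested on the indicator of the part of a ring where the
  weight is small gives the interval inequality back (\<open>interval_A1_if_weak_type\<close>).

  From (a) to the condition. It suffices to know \<open>W s \<le> K W r\<close> for \<open>s \<ge> 2r\<close>, together with a bound
  by \<open>W r\<close> for the average of the weight over the ball of radius \<open>r\<close> around the origin in one single
  dimension (\<open>almost_decreasingI\<close>). The bound on the average is a case of the interval inequality, and for the
  maximal function it comes from the inclusion of that ball in a ball centred at a point of norm \<open>r\<close>. The comparison of values at \<open>s\<close> and \<open>r\<close> is where the uniformity in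
  \<open>n\<close> enters: in high dimension the averages concentrate so much that they control \<open>W\<close> near a single
  radius \<open>s\<close>, and Lebesgue's differentiation theorem then gives \<open>W s\<close> itself.

  For intervals the concentration is elementary: \<open>t\<^bsup>n-1\<^esup> dt\<close> on \<open>[0, b]\<close> gives a fixed proportion of its mass
  to \<open>[b - b/n, b]\<close>. For the maximal function on \<open>\<real>\<^sup>n\<close>, most \<open>u\<close> in the unit ball have norm close
  to \<open>1\<close> and are almost orthogonal to \<open>x\<close> (\<open>emeasure_equator_ge\<close>), so that \<open>|x + R u|\<close> is close
  to \<open>sqrt (|x|\<^sup>2 + R\<^sup>2)\<close>. Instead of estimating the density of \<open>|x + R u|\<close> for a fixed radius \<open>R\<close>, the proof
  keeps the centre \<open>x\<close> and averages over a range of radii. For each typical \<open>u\<close> the map \<open>R \<mapsto> |x + R u|\<close>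
  is increasing with slope at most one and runs through the whole of a prescribed interval
  \<open>[s, s']\<close>, so a change of variables bounds \<open>\<integral> W\<close> over \<open>[s, s']\<close> by \<open>W |x|\<close> times the length of the
  range of radii, which is comparable to \<open>s' - s\<close> (\<open>sweep_integral\<close>).

  Finally, \<open>[w]\<close> of \<open>A\<^sub>1\<close> controls \<open>[w]\<^sup>*\<close> of \<open>A\<^sub>1\<close>: a countable dense set of good centres supplies balls that
  approximate every ball from outside (\<open>centred_A1_if_ball_A1\<close>).
\<close>

section \<open>Lebesgue measure in several dimensions\<close>

abbreviation prodleb :: "nat \<Rightarrow> (nat \<Rightarrow> real) measure" where
  "prodleb n \<equiv> Pi\<^sub>M {..<n} (\<lambda>_. lborel)"

interpretation lborel_product: product_sigma_finite "\<lambda>_::nat. lborel :: real measure" ..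

lemma sigma_finite_prodleb: "sigma_finite_measure (prodleb n)"
  by (rule lborel_product.sigma_finite) simp

lemma space_leb: "space (leb n) = space (prodleb n)"
  by (simp add: leb_def)

lemma Rn_eq: "Rn n = {..<n} \<rightarrow>\<^sub>E UNIV"
  by (simp add: space_leb space_PiM)

lemma AE_leb: "(AE x in leb n. P x) \<longleftrightarrow> (AE x in prodleb n. P x)"
  unfolding leb_def by (rule AE_completion_iff)

lemma nn_integral_leb: "nn_integral (leb n) f = nn_integral (prodleb n) f"
  by (simp add: leb_def nn_integral_completion)

lemma sets_leb: "A \<in> sets (prodleb n) \<Longrightarrow> A \<in> sets (leb n)"
  by (simp add: leb_def)

lemma emeasure_leb: "A \<in> sets (prodleb n) \<Longrightarrow> emeasure (leb n) A = emeasure (prodleb n) A"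
  by (simp add: leb_def)

lemma weighted_eq: "weighted n w E = (\<integral>\<^sup>+y. w y * indicator E y \<partial>prodleb n)"
  by (simp add: weighted_def nn_integral_leb)

lemma borel_measurable_nrm [measurable]: "nrm n \<in> borel_measurable (prodleb n)"
  unfolding nrm_def L2_set_def by measurable

lemma nrm_nonneg [simp]: "0 \<le> nrm n x"
  by (simp add: nrm_def)

lemma borel_measurable_nrm_diff [measurable]:
  "(\<lambda>y. nrm n (\<lambda>i. y i - x i)) \<in> borel_measurable (prodleb n)"
  unfolding nrm_def L2_set_def by measurable

lemma nball_sets [measurable]: "nball n x R \<in> sets (prodleb n)"
  unfolding nball_def space_leb by measurable

lemma shell_sets [measurable]: "B \<in> sets borel \<Longrightarrow> {y \<in> space (prodleb n). nrm n y \<in> B} \<in> sets (prodleb n)"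
  using measurable_sets[OF borel_measurable_nrm, of B n]
  by (simp add: vimage_def Int_def conj_commute)

definition dilation :: "nat \<Rightarrow> (nat \<Rightarrow> real) \<Rightarrow> real \<Rightarrow> (nat \<Rightarrow> real) \<Rightarrow> nat \<Rightarrow> real" where
  "dilation n x R u = (\<lambda>i\<in>{..<n}. x i + R * u i)"

lemma measurable_dilation [measurable]: "dilation n x R \<in> prodleb n \<rightarrow>\<^sub>M prodleb n"
  unfolding dilation_def by (rule measurable_restrict) simp

lemma nrm_dilation: "nrm n (dilation n x R u) = nrm n (\<lambda>i. x i + R * u i)"
  unfolding nrm_def dilation_def by (rule L2_set_cong) auto

lemma prodleb_dilation:
  assumes "R > 0"
  shows "density (distr (prodleb n) (prodleb n) (dilation n x R)) (\<lambda>_. ennreal (R ^ n)) = prodleb n"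
proof (rule lborel_product.PiM_eqI)
  fix A :: "nat \<Rightarrow> real set"
  assume A: "\<And>i. i \<in> {..<n} \<Longrightarrow> A i \<in> sets lborel"
  have AE: "Pi\<^sub>E {..<n} A \<in> sets (prodleb n)"
    using A by (intro sets_PiM_I_finite) auto
  have vim: "dilation n x R -` Pi\<^sub>E {..<n} A \<inter> space (prodleb n)
      = Pi\<^sub>E {..<n} (\<lambda>i. (\<lambda>t. x i + R * t) -` A i)"
    by (auto simp: dilation_def space_PiM PiE_iff)
  have one: "emeasure lborel (A i) = ennreal R * emeasure lborel ((\<lambda>t. x i + R * t) -` A i)"
    if "i < n" for i
  proof -
    have [measurable]: "A i \<in> sets borel" using A that by simp
    have [measurable]: "(\<lambda>t. x i + R * t) -` A i \<in> sets borel"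
      by (rule measurable_sets_borel[where M=borel]) auto
    have "emeasure lborel (A i) = (\<integral>\<^sup>+t. indicator (A i) t \<partial>lborel)" by simp
    also have "\<dots> = ennreal R * (\<integral>\<^sup>+t. indicator (A i) (x i + R * t) \<partial>lborel)"
      using \<open>R > 0\<close> by (subst nn_integral_real_affine[of _ R "x i"]) auto
    also have "(\<integral>\<^sup>+t. indicator (A i) (x i + R * t) \<partial>lborel)
        = (\<integral>\<^sup>+t. indicator ((\<lambda>t. x i + R * t) -` A i) t \<partial>lborel)"
      by (intro nn_integral_cong) (simp split: split_indicator)
    also have "\<dots> = emeasure lborel ((\<lambda>t. x i + R * t) -` A i)"
      by (subst nn_integral_indicator) simp_all
    finally show ?thesis .
  qed
  have "emeasure (density (distr (prodleb n) (prodleb n) (dilation n x R)) (\<lambda>_. ennreal (R ^ n))) (Pi\<^sub>E {..<n} A)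
      = ennreal (R ^ n) * emeasure (prodleb n) (dilation n x R -` Pi\<^sub>E {..<n} A \<inter> space (prodleb n))"
    using AE by (simp add: emeasure_density nn_integral_cmult_indicator emeasure_distr)
  also have "\<dots> = ennreal (R ^ n) * (\<Prod>i<n. emeasure lborel ((\<lambda>t. x i + R * t) -` A i))"
    unfolding vim by (subst lborel_product.emeasure_PiM)
      (use A in \<open>auto intro!: measurable_sets_borel[where M=borel]\<close>)
  also have "\<dots> = (\<Prod>i<n. ennreal R * emeasure lborel ((\<lambda>t. x i + R * t) -` A i))"
    using \<open>R > 0\<close> by (simp add: prod.distrib ennreal_power)
  also have "\<dots> = (\<Prod>i<n. emeasure lborel (A i))"
    using one by (intro prod.cong) auto
  finally show "emeasure (density (distr (prodleb n) (prodleb n) (dilation n x R)) (\<lambda>_. ennreal (R ^ n))) (Pi\<^sub>E {..<n} A)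
      = (\<Prod>i<n. emeasure lborel (A i))" .
qed auto

lemma nn_integral_dilation:
  assumes "R > 0" and [measurable]: "g \<in> borel_measurable (prodleb n)"
  shows "(\<integral>\<^sup>+y. g y \<partial>prodleb n) = ennreal (R ^ n) * (\<integral>\<^sup>+u. g (dilation n x R u) \<partial>prodleb n)"
  by (subst prodleb_dilation[OF \<open>R > 0\<close>, of n x, symmetric])
     (simp add: nn_integral_density nn_integral_cmult nn_integral_distr)

abbreviation vol :: "nat \<Rightarrow> real" where
  "vol n \<equiv> unit_ball_vol (real n)"

lemma vol_neq_0 [simp]: "vol n \<noteq> 0"
  using unit_ball_vol_pos[of "real n"] by linarith

lemma emeasure_nrm_le:
  assumes "0 < R"
  shows "emeasure (prodleb n) {y \<in> space (prodleb n). nrm n y \<le> R} = ennreal (vol n * R ^ n)"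
proof -
  have "{y \<in> space (prodleb n). nrm n y \<le> R} =
     {f. sqrt (\<Sum>i\<in>{..<n}. (f i)\<^sup>2) \<le> R} \<inter> space (prodleb n)"
    by (auto simp: nrm_def L2_set_def)
  then show ?thesis
    using emeasure_cball_aux[of "{..<n}" R] assms by simp
qed

lemma nn_integral_power_Icc:
  assumes "0 \<le> a" "a \<le> b" "0 < n"
  shows "(\<integral>\<^sup>+t. ennreal (t ^ (n - 1)) * indicator {a..b} t \<partial>lborel) = ennreal ((b ^ n - a ^ n) / n)"
proof -
  have "(\<integral>\<^sup>+t. ennreal (t ^ (n - 1)) * indicator {a..b} t \<partial>lborel) = b ^ n / n - a ^ n / n"
  proof (rule nn_integral_FTC_Icc)
    show "((\<lambda>t. t ^ n / n) has_real_derivative x ^ (n - 1)) (at x)" for x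
      using \<open>0 < n\<close> by (auto intro!: derivative_eq_intros)
  qed (use assms in auto)
  then show ?thesis by (simp add: diff_divide_distrib)
qed

lemma nn_integral_power_Ioo:
  assumes "0 < n" "a < b" "0 < b"
  shows "(\<integral>\<^sup>+t. ennreal (t ^ (n - 1)) * indicator ({a<..<b} \<inter> {0..}) t \<partial>lborel)
    = ennreal ((b ^ n - (max a 0) ^ n) / n)"
proof -
  have "(\<integral>\<^sup>+t. ennreal (t ^ (n - 1)) * indicator ({a<..<b} \<inter> {0..}) t \<partial>lborel)
    = (\<integral>\<^sup>+t. ennreal (t ^ (n - 1)) * indicator {max a 0..b} t \<partial>lborel)"
    by (rule nn_integral_cong_AE, rule AE_I'[where N="{a, b}"])
      (auto simp: finite_imp_null_set_lborel split: split_indicator)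
  also have "\<dots> = ennreal ((b ^ n - (max a 0) ^ n) / n)"
    using assms by (intro nn_integral_power_Icc) auto
  finally show ?thesis .
qed

text \<open>
  Polar coordinates for radial functions. A measure on the line is determined by the half-lines
  \<open>{..R}\<close>, and on those the claim is the formula for the volume of a ball.
\<close>

lemma distr_nrm:
  assumes "0 < n"
  shows "distr (prodleb n) borel (nrm n)
    = density lborel (\<lambda>t. ennreal (n * vol n) * (ennreal (t ^ (n - 1)) * indicator {0..} t))"
    (is "?D = ?E")
proof -
  let ?h = "\<lambda>t::real. ennreal (n * vol n) * (ennreal (t ^ (n - 1)) * indicator {0..} t)"
  have D: "emeasure ?D {..R} = ennreal (vol n * max 0 R ^ n)" for R
  proof (cases "R > 0")
    case True
    then show ?thesis
      using emeasure_nrm_le[OF True, of n] by (simp add: emeasure_distr vimage_def Int_def conj_commute max_def)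
  next
    case False
    have D: "emeasure ?D {..R} = emeasure (prodleb n) {y \<in> space (prodleb n). nrm n y \<le> R}"
      by (simp add: emeasure_distr vimage_def Int_def conj_commute)
    have le: "emeasure (prodleb n) {y \<in> space (prodleb n). nrm n y \<le> R} \<le> ennreal e" if "e > 0" for e
    proof -
      \<comment> \<open>The set lies in balls of arbitrarily small volume \<open>e\<close>.\<close>
      have p: "(e / vol n) > 0" using that by simp
      define r where "r = root n (e / vol n)"
      have r: "r > 0" "r ^ n = e / vol n"
        using p assms by (simp_all add: r_def real_root_gt_zero)
      moreover have "vol n > 0" by simp
      ultimately have r: "r > 0" "vol n * r ^ n = e"
        by (simp_all only: r) (metis less_irrefl nonzero_mult_div_cancel_left times_divide_eq_right)
      have "emeasure (prodleb n) {y \<in> space (prodleb n). nrm n y \<le> R}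
          \<le> emeasure (prodleb n) {y \<in> space (prodleb n). nrm n y \<le> r}"
        using False r by (intro emeasure_mono) auto
      also have "\<dots> = ennreal e" using emeasure_nrm_le[OF r(1), of n] r by simp
      finally show ?thesis .
    qed
    have "emeasure (prodleb n) {y \<in> space (prodleb n). nrm n y \<le> R} \<le> 0"
    proof (rule ennreal_le_epsilon)
      fix e :: real assume "0 < e"
      from le[OF this] show "emeasure (prodleb n) {y \<in> space (prodleb n). nrm n y \<le> R} \<le> 0 + ennreal e"
        by (simp only: add_0)
    qed
    with D have "emeasure ?D {..R} \<le> 0" by (simp only:)
    then show ?thesis using False assms by (simp add: max_def)
  qed
  have E: "emeasure ?E {..R} = ennreal (vol n * max 0 R ^ n)" for R
  proof -
    have "emeasure ?E {..R} = (\<integral>\<^sup>+t. ennreal (n * vol n) * (ennreal (t ^ (n - 1)) * indicator {0..max 0 R} t) \<partial>lborel)"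
    proof (subst emeasure_density, simp, simp, rule nn_integral_cong_AE, rule AE_I[where N="{0}"])
      show "{x \<in> space lborel. ?h x * indicator {..R} x \<noteq>
         ennreal (n * vol n) * (ennreal (x ^ (n - 1)) * indicator {0..max 0 R} x)} \<subseteq> {0}"
        by (auto simp: max_def split: split_indicator)
    qed auto
    also have "\<dots> = ennreal (n * vol n) * ennreal ((max 0 R ^ n - 0 ^ n) / n)"
      using nn_integral_power_Icc[of 0 "max 0 R" n] assms by (simp add: nn_integral_cmult)
    also have "\<dots> = ennreal (vol n * max 0 R ^ n)"
      using assms by (simp add: ennreal_mult[symmetric])
    finally show ?thesis .
  qed
  show ?thesis
  proof (rule measure_eqI_generator_eq[where E="range (\<lambda>R::real. {..R})" and A="\<lambda>k. {..real k}" and \<Omega>=UNIV])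
    show "Int_stable (range (\<lambda>R::real. {..R}))"
      by (auto simp: Int_stable_def)
    show "emeasure ?D X = emeasure ?E X" if "X \<in> range (\<lambda>R::real. {..R})" for X
      using that D E by auto
    show "sets ?D = sigma_sets UNIV (range (\<lambda>R::real. {..R}))"
      by (simp add: borel_eq_atMost)
    show "sets ?E = sigma_sets UNIV (range (\<lambda>R::real. {..R}))"
      by (simp add: borel_eq_atMost)
    show "(\<Union>i. {..real i}) = UNIV"
      using real_arch_simple by auto
    show "emeasure ?D {..real k} \<noteq> \<infinity>" for k
      unfolding D by simp
  qed auto
qed

lemma nn_integral_radial:
  assumes "0 < n" and [measurable]: "g \<in> borel_measurable borel"
  shows "(\<integral>\<^sup>+y. g (nrm n y) \<partial>prodleb n)
    = ennreal (n * vol n) * (\<integral>\<^sup>+t. g t * ennreal (t ^ (n - 1)) * indicator {0..} t \<partial>lborel)"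
proof -
  have "(\<integral>\<^sup>+y. g (nrm n y) \<partial>prodleb n) = (\<integral>\<^sup>+t. g t \<partial>distr (prodleb n) borel (nrm n))"
    by (simp add: nn_integral_distr)
  then show ?thesis
    unfolding distr_nrm[OF assms(1)]
    by (subst nn_integral_cmult[symmetric], measurable)
       (simp add: nn_integral_density mult_ac)
qed

lemma AE_iff_cong:
  assumes "AE t in M. P t \<longleftrightarrow> Q t"
  shows "(AE t in M. P t) \<longleftrightarrow> (AE t in M. Q t)"
proof
  assume "AE t in M. P t"
  with assms show "AE t in M. Q t" by eventually_elim simp
next
  assume "AE t in M. Q t"
  with assms show "AE t in M. P t" by eventually_elim simp
qed

text \<open>
  Null sets of radii correspond to radial null sets in \<open>n\<close> dimensions. This is what turns a statement
  about almost every centre \<open>x\<close> that only involves \<open>|x|\<close> into one about almost every radius.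
\<close>

lemma AE_radial:
  assumes "0 < n" "{t. P t} \<in> sets borel"
  shows "(AE y in prodleb n. P (nrm n y)) \<longleftrightarrow> (AE t in lborel. 0 \<le> t \<longrightarrow> P t)"
proof -
  have vp: "vol n > 0" by simp
  have "(AE y in prodleb n. P (nrm n y)) \<longleftrightarrow> (AE t in distr (prodleb n) borel (nrm n). P t)"
    using assms by (subst AE_distr_iff) auto
  also have "\<dots> \<longleftrightarrow> (AE t in lborel. 0 < ennreal (n * vol n) * (ennreal (t ^ (n - 1)) * indicator {0..} t) \<longrightarrow> P t)"
    unfolding distr_nrm[OF assms(1)] by (rule AE_density) measurable
  also have "\<dots> \<longleftrightarrow> (AE t in lborel. 0 \<le> t \<longrightarrow> P t)"
  proof -
    have "(0 < ennreal (n * vol n) * (ennreal (t ^ (n - 1)) * indicator {0..} t) \<longrightarrow> P t) \<longleftrightarrow> (0 \<le> t \<longrightarrow> P t)"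
      if "t \<noteq> 0" for t
      using that assms(1) vp
      by (auto simp: ennreal_zero_less_mult_iff split: split_indicator)
    then have "AE t in lborel. (0 < ennreal (n * vol n) * (ennreal (t ^ (n - 1)) * indicator {0..} t) \<longrightarrow> P t) \<longleftrightarrow> (0 \<le> t \<longrightarrow> P t)"
      using AE_lborel_singleton[of "0::real"] by (rule eventually_mono[rotated])
    then show ?thesis by (rule AE_iff_cong)
  qed
  finally show ?thesis .
qed

lemma AE_radial_I:
  assumes "0 < n" "AE t in lborel. 0 \<le> t \<longrightarrow> P t"
  shows "AE y in prodleb n. P (nrm n y)"
proof -
  obtain N where N: "N \<in> null_sets lborel" "{t \<in> space lborel. \<not> (0 \<le> t \<longrightarrow> P t)} \<subseteq> N"
    using assms(2) unfolding eventually_ae_filter by auto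
  have Nb: "N \<in> sets borel" using N by auto
  have "AE t in lborel. 0 \<le> t \<longrightarrow> t \<notin> N"
    using AE_not_in[OF N(1)] by eventually_elim simp
  moreover have "{t. t \<notin> N} \<in> sets borel" using sets.compl_sets[OF Nb] by (simp add: Compl_eq_Diff_UNIV[symmetric] Compl_eq)
  ultimately have "AE y in prodleb n. nrm n y \<notin> N"
    using AE_radial[OF assms(1), of "\<lambda>t. t \<notin> N"] by blast
  then show ?thesis
  proof eventually_elim
    fix y :: "nat \<Rightarrow> real" assume "nrm n y \<notin> N"
    then show "P (nrm n y)" using subsetD[OF N(2), of "nrm n y"] by auto
  qed
qed

section \<open>Shells and balls\<close>

text \<open>Integration with respect to \<open>t\<^bsup>n-1\<^esup> dt\<close>, that is, over shells up to the factor \<open>n \<kappa>\<^sub>n\<close>.\<close>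

abbreviation radial_integral :: "nat \<Rightarrow> (real \<Rightarrow> ennreal) \<Rightarrow> real set \<Rightarrow> ennreal" where
  "radial_integral n g B \<equiv> \<integral>\<^sup>+t. g t * ennreal (t ^ (n - 1)) * indicator B t \<partial>lborel"

abbreviation radial_volume :: "nat \<Rightarrow> real set \<Rightarrow> ennreal" where
  "radial_volume n B \<equiv> \<integral>\<^sup>+t. ennreal (t ^ (n - 1)) * indicator B t \<partial>lborel"

lemma weighted_shell:
  assumes "0 < n" and [measurable]: "W \<in> borel_measurable borel" "B \<in> sets borel"
  shows "weighted n (\<lambda>y. W (nrm n y)) {y \<in> Rn n. nrm n y \<in> B}
    = ennreal (n * vol n) * (radial_integral n W (B \<inter> {0..}))"
proof -
  have "weighted n (\<lambda>y. W (nrm n y)) {y \<in> Rn n. nrm n y \<in> B}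
      = (\<integral>\<^sup>+y. (\<lambda>t. W t * indicator B t) (nrm n y) \<partial>prodleb n)"
    unfolding weighted_eq space_leb
    by (intro nn_integral_cong) (auto split: split_indicator)
  also have "\<dots> = ennreal (n * vol n) * (\<integral>\<^sup>+t. W t * indicator B t * ennreal (t ^ (n - 1)) * indicator {0..} t \<partial>lborel)"
    using assms(1) by (intro nn_integral_radial) measurable
  also have "(\<integral>\<^sup>+t. W t * indicator B t * ennreal (t ^ (n - 1)) * indicator {0..} t \<partial>lborel)
    = (radial_integral n W (B \<inter> {0..}))"
    by (intro nn_integral_cong) (auto split: split_indicator)
  finally show ?thesis .
qed

lemma emeasure_shell:
  assumes "0 < n" and [measurable]: "B \<in> sets borel"
  shows "emeasure (prodleb n) {y \<in> Rn n. nrm n y \<in> B}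
    = ennreal (n * vol n) * (radial_volume n (B \<inter> {0..}))"
proof -
  have [measurable]: "{y \<in> Rn n. nrm n y \<in> B} \<in> sets (prodleb n)"
    unfolding space_leb by (rule shell_sets) simp
  show ?thesis
    using weighted_shell[OF assms(1), of "\<lambda>_. 1" B] by (simp add: weighted_eq)
qed

lemma nball_centre0: "nball n (\<lambda>_. 0) R = {y \<in> Rn n. nrm n y \<in> {..<R}}"
  by (auto simp: nball_def)

lemma indicator_nball_dilation:
  assumes "R > 0" "u \<in> space (prodleb n)"
  shows "indicator (nball n x (R * S)) (dilation n x R u) = (indicator (nball n (\<lambda>_. 0) S) u :: ennreal)"
proof -
  have "nrm n (\<lambda>i. dilation n x R u i - x i) = nrm n (\<lambda>i. R * u i)"
    unfolding nrm_def by (rule L2_set_cong) (auto simp: dilation_def)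
  also have "\<dots> = R * nrm n u"
    using assms(1) by (simp add: nrm_def L2_set_right_distrib)
  finally have "nrm n (\<lambda>i. dilation n x R u i - x i) = R * nrm n u" .
  moreover have "dilation n x R u \<in> space (prodleb n)"
    using measurable_space[OF measurable_dilation assms(2)] .
  ultimately show ?thesis
    using assms by (simp add: nball_def space_leb indicator_def)
qed

lemma weighted_nball_dilation:
  assumes "R > 0" and [measurable]: "g \<in> borel_measurable (prodleb n)"
  shows "weighted n g (nball n x R)
    = ennreal (R ^ n) * (\<integral>\<^sup>+u. g (dilation n x R u) * indicator (nball n (\<lambda>_. 0) 1) u \<partial>prodleb n)"
  unfolding weighted_eq
  by (subst nn_integral_dilation[OF assms(1), of _ _ x], measurable)
     (intro arg_cong2[where f="(*)"] refl nn_integral_cong,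
      use indicator_nball_dilation[OF assms(1), of _ n x 1] in simp)

lemma emeasure_nball:
  assumes "0 < n" "0 \<le> R"
  shows "emeasure (prodleb n) (nball n x R) = ennreal (vol n * R ^ n)"
proof -
  have "emeasure (prodleb n) (nball n x R) = (\<integral>\<^sup>+y. indicator (nball n x R) y \<partial>prodleb n)"
    by simp
  also have "\<dots> = (\<integral>\<^sup>+u. indicator (nball n x (1 * R)) (dilation n x 1 u) \<partial>prodleb n)"
    by (subst nn_integral_dilation[of 1 _ _ x]) auto
  also have "\<dots> = (\<integral>\<^sup>+u. indicator (nball n (\<lambda>_. 0) R) u \<partial>prodleb n)"
    by (intro nn_integral_cong indicator_nball_dilation) auto
  also have "\<dots> = emeasure (prodleb n) {y \<in> Rn n. nrm n y \<in> {..<R}}"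
    by (subst nn_integral_indicator, simp, subst nball_centre0, rule refl)
  also have "\<dots> = ennreal (n * vol n) * (radial_volume n ({..<R} \<inter> {0..}))"
    using assms by (intro emeasure_shell) auto
  also have "(radial_volume n ({..<R} \<inter> {0..}))
      = (radial_volume n {0..R})"
    by (rule nn_integral_cong_AE, rule AE_I[where N="{R}"]) (auto split: split_indicator)
  also have "\<dots> = ennreal ((R ^ n - 0 ^ n) / n)"
    using assms by (intro nn_integral_power_Icc) auto
  also have "ennreal (n * vol n) * \<dots> = ennreal (vol n * R ^ n)"
    using assms by (simp add: ennreal_mult[symmetric])
  finally show ?thesis .
qed

lemma emeasure_leb_nball:
  "0 < n \<Longrightarrow> 0 \<le> R \<Longrightarrow> emeasure (leb n) (nball n x R) = ennreal (vol n * R ^ n)"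
  by (simp add: emeasure_leb emeasure_nball)

lemma nrm_triangle: "nrm n (\<lambda>i. a i + b i) \<le> nrm n a + nrm n b"
  unfolding nrm_def by (rule L2_set_triangle_ineq)

lemma nrm_minus_commute: "nrm n (\<lambda>i. a i - b i) = nrm n (\<lambda>i. b i - a i)"
  unfolding nrm_def L2_set_def by (simp add: power2_commute)

section \<open>Concentration of volume in the unit ball\<close>

definition iprod :: "nat \<Rightarrow> (nat \<Rightarrow> real) \<Rightarrow> (nat \<Rightarrow> real) \<Rightarrow> real" where
  "iprod n x u = (\<Sum>i<n. x i * u i)"

lemma borel_measurable_iprod [measurable]: "iprod n x \<in> borel_measurable (prodleb n)"
  unfolding iprod_def by measurable

lemma nrm_sq: "(nrm n x)\<^sup>2 = (\<Sum>i<n. (x i)\<^sup>2)"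
  by (simp add: nrm_def L2_set_def sum_nonneg)

lemma nrm_sq_add: "(nrm n (\<lambda>i. x i + R * u i))\<^sup>2 = (nrm n x)\<^sup>2 + 2 * R * iprod n x u + R\<^sup>2 * (nrm n u)\<^sup>2"
  unfolding nrm_sq iprod_def
  by (simp add: power2_sum power_mult_distrib sum.distrib sum_distrib_left algebra_simps)

text \<open>
  The typical points of the unit ball as seen from \<open>x\<close>: close to the unit sphere and close to the
  hyperplane orthogonal to \<open>x\<close>.
\<close>

definition equator :: "nat \<Rightarrow> (nat \<Rightarrow> real) \<Rightarrow> real \<Rightarrow> (nat \<Rightarrow> real) set" where
  "equator n x \<epsilon> = {u \<in> nball n (\<lambda>_. 0) 1. 1 - \<epsilon> \<le> nrm n u \<and> \<bar>iprod n x u\<bar> \<le> \<epsilon> * nrm n x}"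

lemma equator_sets [measurable]: "equator n x \<epsilon> \<in> sets (prodleb n)"
proof -
  have "equator n x \<epsilon> = nball n (\<lambda>_. 0) 1 \<inter>
     {u \<in> space (prodleb n). 1 - \<epsilon> \<le> nrm n u \<and> \<bar>iprod n x u\<bar> \<le> \<epsilon> * nrm n x}"
    by (auto simp: equator_def nball_def space_leb)
  then show ?thesis by simp
qed

text \<open>
  With \<open>e = s x / |x|\<close> for a sign \<open>s\<close>, a point \<open>u\<close> of the unit ball with \<open>u \<bullet> e > \<epsilon>\<close> satisfies
  \<open>|u - \<epsilon> e|\<^sup>2 = |u|\<^sup>2 - 2 \<epsilon> (u \<bullet> e) + \<epsilon>\<^sup>2 < 1 - \<epsilon>\<^sup>2\<close>. So each of the two caps cut off around \<open>x\<close> and \<open>-x\<close>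
  lies in a ball whose volume decays exponentially in \<open>n\<close>.
\<close>

lemma cap_subset_nball:
  assumes "0 < \<epsilon>" "\<epsilon> < 1" "0 < nrm n x" "\<bar>s\<bar> = 1"
  assumes u: "u \<in> nball n (\<lambda>_. 0) 1" "\<epsilon> * nrm n x < s * iprod n x u"
  shows "u \<in> nball n (\<lambda>i. s * \<epsilon> / nrm n x * x i) (sqrt (1 - \<epsilon>\<^sup>2))"
proof -
  let ?r = "nrm n x"
  have ss: "s\<^sup>2 = 1" using assms(4) by (metis power2_abs one_power2)
  have u1: "nrm n u < 1" using u by (simp add: nball_def)
  have *: "iprod n u x = iprod n x u" by (simp add: iprod_def mult.commute)
  have "(nrm n (\<lambda>i. u i - s * \<epsilon> / ?r * x i))\<^sup>2
      = (nrm n u)\<^sup>2 - 2 * (s * \<epsilon> / ?r) * iprod n x u + (s * \<epsilon> / ?r)\<^sup>2 * ?r\<^sup>2"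
    using nrm_sq_add[of n u "- (s * \<epsilon> / ?r)" x] * by simp
  also have "(s * \<epsilon> / ?r)\<^sup>2 * ?r\<^sup>2 = \<epsilon>\<^sup>2"
    using assms(3) ss by (simp add: power_mult_distrib power_divide)
  also have "2 * (s * \<epsilon> / ?r) * iprod n x u = 2 * \<epsilon> / ?r * (s * iprod n x u)"
    by simp
  also have "(nrm n u)\<^sup>2 - 2 * \<epsilon> / ?r * (s * iprod n x u) + \<epsilon>\<^sup>2 < 1 - 2 * \<epsilon> / ?r * (\<epsilon> * ?r) + \<epsilon>\<^sup>2"
  proof -
    have "(nrm n u)\<^sup>2 \<le> 1" using u1 by (simp add: power_le_one)
    moreover have "2 * \<epsilon> / ?r * (\<epsilon> * ?r) < 2 * \<epsilon> / ?r * (s * iprod n x u)"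
      using assms u by (intro mult_strict_left_mono) auto
    ultimately show ?thesis by linarith
  qed
  also have "\<dots> = 1 - \<epsilon>\<^sup>2" using assms(3) by (simp add: power2_eq_square)
  finally have "nrm n (\<lambda>i. u i - s * \<epsilon> / ?r * x i) < sqrt (1 - \<epsilon>\<^sup>2)"
    by (rule real_less_rsqrt)
  then show ?thesis using u by (simp add: nball_def)
qed

text \<open>
  The complement of the equator in the unit ball is covered by the two caps and the ball of radius
  \<open>1 - \<epsilon> \<le> sqrt (1 - \<epsilon>\<^sup>2)\<close>, that is, by three balls of radius at most \<open>sqrt (1 - \<epsilon>\<^sup>2)\<close>.
\<close>

lemma emeasure_equator_ge:
  assumes "0 < \<epsilon>" "\<epsilon> < 1" "0 < nrm n x" "0 < n" and small: "3 * sqrt (1 - \<epsilon>\<^sup>2) ^ n \<le> 1 / 2"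
  shows "ennreal (vol n / 2) \<le> emeasure (prodleb n) (equator n x \<epsilon>)"
proof -
  let ?q = "sqrt (1 - \<epsilon>\<^sup>2)" and ?m = "emeasure (prodleb n)"
  let ?c = "\<lambda>s. nball n (\<lambda>i. s * \<epsilon> / nrm n x * x i) ?q"
  have e2: "\<epsilon>\<^sup>2 \<le> 1" using assms(1,2) by (simp add: power_le_one)
  have q0: "0 \<le> ?q" using e2 by simp
  have q: "1 - \<epsilon> \<le> ?q"
  proof (rule real_le_rsqrt)
    have "\<epsilon> * \<epsilon> \<le> \<epsilon>" using assms(1,2) by (simp add: mult_left_le)
    then show "(1 - \<epsilon>)\<^sup>2 \<le> 1 - \<epsilon>\<^sup>2" by (simp add: power2_eq_square algebra_simps)
  qed
  have sub: "nball n (\<lambda>_. 0) 1 \<subseteq> equator n x \<epsilon> \<union> (nball n (\<lambda>_. 0) ?q \<union> (?c 1 \<union> ?c (-1)))"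
  proof
    fix u assume u: "u \<in> nball n (\<lambda>_. 0) 1"
    consider "u \<in> equator n x \<epsilon>" | "nrm n u < 1 - \<epsilon>" | "\<epsilon> * nrm n x < 1 * iprod n x u"
      | "\<epsilon> * nrm n x < (-1) * iprod n x u"
      using u by (fastforce simp: equator_def)
    then show "u \<in> equator n x \<epsilon> \<union> (nball n (\<lambda>_. 0) ?q \<union> (?c 1 \<union> ?c (-1)))"
    proof cases
      case 2
      then have "u \<in> nball n (\<lambda>_. 0) ?q" using u q by (auto simp: nball_def)
      then show ?thesis by blast
    next
      case 3
      with cap_subset_nball[OF assms(1-3) _ u, of 1] show ?thesis by simp
    next
      case 4
      with cap_subset_nball[OF assms(1-3) _ u, of "-1"] show ?thesis by simp
    qed auto
  qed
  have v: "vol n > 0" by simp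
  have mq: "?m (nball n z ?q) = ennreal (vol n * ?q ^ n)" for z
    using q0 assms(4) by (rule emeasure_nball[rotated])
  have "ennreal (vol n) = ?m (nball n (\<lambda>_. 0) 1)"
    using assms(4) by (simp add: emeasure_nball)
  also have "\<dots> \<le> ?m (equator n x \<epsilon> \<union> (nball n (\<lambda>_. 0) ?q \<union> (?c 1 \<union> ?c (-1))))"
    using sub by (intro emeasure_mono) auto
  also have "\<dots> \<le> ?m (equator n x \<epsilon>) + (?m (nball n (\<lambda>_. 0) ?q) + (?m (?c 1) + ?m (?c (-1))))"
    by (intro order_trans[OF emeasure_subadditive] add_left_mono) auto
  also have "\<dots> = ?m (equator n x \<epsilon>) + ennreal (vol n * (3 * ?q ^ n))"
    unfolding mq using q0 v by (simp add: ennreal_plus[symmetric] del: ennreal_plus)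
  also have "\<dots> \<le> ?m (equator n x \<epsilon>) + ennreal (vol n * (1 / 2))"
    using small v by (intro add_left_mono ennreal_leI mult_left_mono) auto
  finally have le: "ennreal (vol n) \<le> ?m (equator n x \<epsilon>) + ennreal (vol n / 2)" by simp
  have "?m (equator n x \<epsilon>) \<le> ?m (nball n (\<lambda>_. 0) 1)"
    by (intro emeasure_mono) (auto simp: equator_def)
  then have "?m (equator n x \<epsilon>) < top"
    using assms(4) by (simp add: emeasure_nball le_less_trans)
  then obtain m where m: "?m (equator n x \<epsilon>) = ennreal m" "0 \<le> m"
    by (cases "?m (equator n x \<epsilon>)") auto
  have "vol n \<le> m + vol n / 2"
    using le m v by (simp add: ennreal_plus[symmetric] ennreal_le_iff del: ennreal_plus)
  then show ?thesis unfolding m by (intro ennreal_leI) simp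
qed

section \<open>Essential infima\<close>

lemma essinf_greatest: "AE x in M. c \<le> f x \<Longrightarrow> c \<le> essinf M f"
  unfolding essinf_def by (rule Liminf_bounded)

text \<open>The essential infimum is the limit of a sequence of smaller values, and countably many null sets are null.\<close>

lemma AE_essinf: "AE x in M. essinf M f \<le> f x"
proof -
  define L where "L = essinf M f"
  have ev: "AE x in M. y < f x" if "y < L" for y
    using that le_Liminf_iff[of L "ae_filter M" f] by (auto simp: L_def essinf_def)
  show ?thesis
  proof (cases "L = 0")
    case True
    then show ?thesis by (simp add: L_def)
  next
    case False
    then have "0 < L" by (simp add: zero_less_iff_neq_zero)
    from approx_from_below_dense_linorder[OF this] obtain u :: "nat \<Rightarrow> ennreal"
      where u: "\<And>k. u k < L" "u \<longlonglongrightarrow> L" by auto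
    have "AE x in M. \<forall>k. u k < f x"
      using ev u by (simp add: AE_all_countable)
    then have "AE x in M. L \<le> f x"
    proof eventually_elim
      fix x assume "\<forall>k. u k < f x"
      then show "L \<le> f x" using u(2) by (intro LIMSEQ_le_const2[OF u(2)]) (auto intro: less_imp_le)
    qed
    then show ?thesis by (simp add: L_def)
  qed
qed

section \<open>Almost decreasing profiles\<close>

text \<open>
  The factor \<open>1/2\<close> makes the condition two-sided on dyadic intervals, so that it contains essential
  constancy there as well as monotonicity up to the factor \<open>K\<close>.
\<close>

definition almost_decreasing :: "real \<Rightarrow> (real \<Rightarrow> ennreal) \<Rightarrow> bool" where
  "almost_decreasing K W \<longleftrightarrow> (AE r in lborel. AE s in lborel. 0 < r \<and> r / 2 \<le> s \<longrightarrow> W s \<le> ennreal K * W r)"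

text \<open>
  Lebesgue's differentiation theorem, in the form used below: a bound for averages over arbitrarily short
  intervals to the right of \<open>s\<close> passes to \<open>W s\<close>. The exceptional set is independent of the bound \<open>K\<close>, which
  matters because \<open>K\<close> will depend on a second radius.
\<close>

lemma AE_le_of_right_averages:
  fixes W :: "real \<Rightarrow> ennreal"
  assumes [measurable]: "W \<in> borel_measurable borel"
    and fin: "\<And>t. W t < \<infinity>"
    and loc: "\<And>a b. 0 < a \<Longrightarrow> (\<integral>\<^sup>+t. W t * indicator {a..b} t \<partial>lborel) < \<infinity>"
  shows "AE s in lborel. 0 < s \<longrightarrow>
    (\<forall>K. (\<forall>\<delta>>0. \<exists>h\<in>{0<..<\<delta>}. (\<integral>\<^sup>+t. W t * indicator {s..s+h} t \<partial>lborel) \<le> K * ennreal h) \<longrightarrow> W s \<le> K)"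
proof -
  \<comment> \<open>\<open>W\<close> may fail to be integrable near \<open>0\<close> and at infinity, so the truncations to \<open>[1/(k+1), k+1]\<close> are differentiated.\<close>
  define f where "f k t = enn2real (W t) * indicator {1 / Suc k..Suc k} t" for k :: nat and t :: real
  have f_int: "integrable lborel (f k)" for k
  proof (rule integrableI_nonneg)
    show "f k \<in> borel_measurable lborel" unfolding f_def by measurable
    show "AE t in lborel. 0 \<le> f k t" by (simp add: f_def)
    have "(\<integral>\<^sup>+t. ennreal (f k t) \<partial>lborel) = (\<integral>\<^sup>+t. W t * indicator {1 / Suc k..Suc k} t \<partial>lborel)"
      using fin by (intro nn_integral_cong) (simp add: f_def split: split_indicator)
    then show "(\<integral>\<^sup>+t. ennreal (f k t) \<partial>lborel) < \<infinity>"
      using loc[of "1 / Suc k" "Suc k"] by simp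
  qed
  have f_leb: "f k integrable_on cbox a b" for k a b
    by (rule integrable_on_subcbox[OF integrable_on_lborel[OF f_int]]) simp
  have "\<exists>N. negligible N \<and> (\<forall>x e. x \<notin> N \<longrightarrow> 0 < e \<longrightarrow> (\<exists>d>0. \<forall>h. 0 < h \<and> h < d \<longrightarrow>
        norm (integral (cbox x (x + h *\<^sub>R One)) (f k) /\<^sub>R h ^ DIM(real) - f k x) < e))" for k
    by (rule integrable_ccontinuous_explicit[OF f_leb, of k]) blast
  then obtain N where N: "\<And>k. negligible (N k)"
    and diff: "\<And>k x e. x \<notin> N k \<Longrightarrow> 0 < e \<Longrightarrow> \<exists>d>0. \<forall>h. 0 < h \<and> h < d \<longrightarrow>
        norm (integral (cbox x (x + h *\<^sub>R One)) (f k) /\<^sub>R h ^ DIM(real) - f k x) < e"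
    by metis
  have "negligible (\<Union>k. N k)"
    using N by (intro negligible_countable_Union) auto
  then have "AE s in lebesgue. s \<notin> (\<Union>k. N k)"
    by (intro AE_not_in) (simp add: negligible_iff_null_sets)
  then have "AE s in lborel. s \<notin> (\<Union>k. N k)"
    by (simp add: AE_completion_iff)
  then show ?thesis
  proof eventually_elim
    fix s :: real assume s: "s \<notin> (\<Union>k. N k)"
    show "0 < s \<longrightarrow> (\<forall>K. (\<forall>\<delta>>0. \<exists>h\<in>{0<..<\<delta>}. (\<integral>\<^sup>+t. W t * indicator {s..s+h} t \<partial>lborel) \<le> K * ennreal h) \<longrightarrow> W s \<le> K)"
    proof (intro impI allI)
      fix K :: ennreal
      assume "0 < s" and av: "\<forall>\<delta>>0. \<exists>h\<in>{0<..<\<delta>}. (\<integral>\<^sup>+t. W t * indicator {s..s+h} t \<partial>lborel) \<le> K * ennreal h"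
      obtain k1 :: nat where k1: "s + 1 < k1" using reals_Archimedean2 by blast
      obtain k2 :: nat where k2: "1 / s < k2" using reals_Archimedean2 by blast
      define k where "k = max k1 k2"
      have kk: "real k1 \<le> real k" "real k2 \<le> real k" by (auto simp: k_def)
      have "1 / s < Suc k" using k2 kk by simp
      then have "1 / Suc k < s" using \<open>0 < s\<close> by (simp add: divide_less_eq mult.commute)
      moreover have "s + 1 < Suc k" using k1 kk by simp
      ultimately have k: "s + 1 < Suc k" "1 / Suc k < s" by auto
      show "W s \<le> K"
      proof (cases K)
        case (real c)
        have "enn2real (W s) \<le> c + e" if "e > 0" for e
        proof -
          from diff[of s k e] s that obtain d where d: "d > 0" and
            dd: "\<And>h. 0 < h \<Longrightarrow> h < d \<Longrightarrow> norm (integral (cbox s (s + h *\<^sub>R One)) (f k) /\<^sub>R h ^ DIM(real) - f k s) < e"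
            by blast
          from av d obtain h where h: "0 < h" "h < d" "h < 1"
            and hav: "(\<integral>\<^sup>+t. W t * indicator {s..s+h} t \<partial>lborel) \<le> K * ennreal h"
            by (metis greaterThanLessThan_iff min_less_iff_conj zero_less_one)
          have si: "set_integrable lborel {s..s+h} (f k)"
            using f_int[of k] unfolding set_integrable_def by (intro integrable_mult_indicator) auto
          have "ennreal (integral {s..s+h} (f k)) = ennreal (LINT t:{s..s+h}|lborel. f k t)"
            using set_borel_integral_eq_integral[OF si] by simp
          also have "\<dots> = (\<integral>\<^sup>+t. ennreal (indicator {s..s+h} t *\<^sub>R f k t) \<partial>lborel)"
            unfolding set_lebesgue_integral_def
            by (rule nn_integral_eq_integral[symmetric]) (use si in \<open>auto simp: set_integrable_def f_def\<close>)
          also have "\<dots> = (\<integral>\<^sup>+t. W t * indicator {s..s+h} t \<partial>lborel)"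
            using fin k h by (intro nn_integral_cong) (auto simp: f_def split: split_indicator)
          also have "\<dots> \<le> ennreal (c * h)"
            using hav real h by (simp add: ennreal_mult)
          finally have le: "integral {s..s+h} (f k) \<le> c * h"
            using real h by (simp add: ennreal_le_iff)
          have fks: "f k s = enn2real (W s)" using k by (simp add: f_def)
          have "\<bar>integral {s..s+h} (f k) / h - enn2real (W s)\<bar> < e"
            using dd[OF h(1,2)] fks by (simp add: divide_inverse mult.commute)
          then have "enn2real (W s) \<le> integral {s..s+h} (f k) / h + e" by linarith
          also have "integral {s..s+h} (f k) / h \<le> c"
            using le h by (simp add: divide_le_eq)
          finally show ?thesis by simp
        qed
        then have "enn2real (W s) \<le> c" by (rule field_le_epsilon)
        have "W s = ennreal (enn2real (W s))" using fin[of s] by simp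
        also have "\<dots> \<le> ennreal c" using \<open>enn2real (W s) \<le> c\<close> by (rule ennreal_leI)
        also have "ennreal c = K" using real by simp
        finally show ?thesis .
      qed simp
    qed
  qed
qed

lemma almost_decreasing_commute:
  fixes W :: "real \<Rightarrow> ennreal"
  assumes [measurable]: "W \<in> borel_measurable borel"
  shows "(AE r in lborel. AE s in lborel. 0 < r \<and> c * r \<le> s \<longrightarrow> W s \<le> K * W r)
    \<longleftrightarrow> (AE s in lborel. AE r in lborel. 0 < r \<and> c * r \<le> s \<longrightarrow> W s \<le> K * W r)"
  by (rule lborel_pair.AE_commute) measurable

text \<open>
  If \<open>s \<ge> r/2\<close> and \<open>t \<le> r/4\<close> then \<open>s \<ge> 2t\<close>, so for almost every such \<open>s\<close> the first hypothesis gives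
  \<open>W s \<le> K W t\<close> for almost every such \<open>t\<close>. Hence \<open>W s\<close> is bounded by the average of \<open>K W\<close> over the ball of radius \<open>r/4\<close>, and this by
  \<open>4\<^sup>n\<close> times the average over the ball of radius \<open>r\<close>.
\<close>

lemma almost_decreasingI:
  fixes W :: "real \<Rightarrow> ennreal"
  assumes [measurable]: "W \<in> borel_measurable borel" and n: "0 < n" and K: "0 \<le> K" and D: "0 \<le> D"
    and Q: "AE r in lborel. AE s in lborel. 0 < r \<and> 2 * r \<le> s \<longrightarrow> W s \<le> ennreal K * W r"
    and B: "AE r in lborel. 0 < r \<longrightarrow>
      (radial_integral n W {0..r}) \<le> ennreal D * W r * ennreal (r ^ n)"
  shows "almost_decreasing (K * D * (n * 4 ^ n)) W"
proof -
  from Q have Q': "AE s in lborel. AE r in lborel. 0 < r \<and> 2 * r \<le> s \<longrightarrow> W s \<le> ennreal K * W r"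
    by (subst (asm) almost_decreasing_commute) auto
  show ?thesis
    unfolding almost_decreasing_def using B
  proof eventually_elim
    fix r :: real
    assume B: "0 < r \<longrightarrow> (radial_integral n W {0..r}) \<le> ennreal D * W r * ennreal (r ^ n)"
    from Q' show "AE s in lborel. 0 < r \<and> r / 2 \<le> s \<longrightarrow> W s \<le> ennreal (K * D * (n * 4 ^ n)) * W r"
    proof eventually_elim
      fix s :: real
      assume s: "AE t in lborel. 0 < t \<and> 2 * t \<le> s \<longrightarrow> W s \<le> ennreal K * W t"
      show "0 < r \<and> r / 2 \<le> s \<longrightarrow> W s \<le> ennreal (K * D * (n * 4 ^ n)) * W r"
      proof
        assume rs: "0 < r \<and> r / 2 \<le> s"
        define p where "p = (r / 4) ^ n / n"
        have p: "p > 0" using rs n by (simp add: p_def)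
        have "(radial_volume n {0..r/4}) = ennreal p"
          using rs n by (subst nn_integral_power_Icc) (auto simp: p_def)
        then have "W s * ennreal p = W s * (radial_volume n {0..r/4})"
          by simp
        also have "\<dots> = (\<integral>\<^sup>+t. W s * (ennreal (t ^ (n - 1)) * indicator {0..r/4} t) \<partial>lborel)"
          by (rule nn_integral_cmult[symmetric]) measurable
        also have "\<dots> \<le> (\<integral>\<^sup>+t. ennreal K * (W t * ennreal (t ^ (n - 1)) * indicator {0..r} t) \<partial>lborel)"
        proof (rule nn_integral_mono_AE)
          show "AE t in lborel. W s * (ennreal (t ^ (n - 1)) * indicator {0..r/4} t)
              \<le> ennreal K * (W t * ennreal (t ^ (n - 1)) * indicator {0..r} t)"
            using s AE_lborel_singleton[of "0::real"]
          proof eventually_elim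
            fix t :: real
            assume "0 < t \<and> 2 * t \<le> s \<longrightarrow> W s \<le> ennreal K * W t" "t \<noteq> 0"
            then have "0 \<le> t \<Longrightarrow> t \<le> r / 4 \<Longrightarrow> W s * ennreal (t ^ (n - 1)) \<le> ennreal K * W t * ennreal (t ^ (n - 1))"
              using rs by (intro mult_right_mono) auto
            then show "W s * (ennreal (t ^ (n - 1)) * indicator {0..r/4} t)
              \<le> ennreal K * (W t * ennreal (t ^ (n - 1)) * indicator {0..r} t)"
              using rs by (auto simp: mult_ac split: split_indicator)
          qed
        qed
        also have "\<dots> = ennreal K * (radial_integral n W {0..r})"
          by (rule nn_integral_cmult) measurable
        also have "\<dots> \<le> ennreal K * (ennreal D * W r * ennreal (r ^ n))"
          using B rs by (intro mult_left_mono) auto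
        also have "\<dots> = ennreal (K * D * (n * 4 ^ n)) * W r * ennreal p"
        proof -
          have e: "r ^ n = n * 4 ^ n * p" using n by (simp add: p_def power_divide)
          show ?thesis
            unfolding e using K D p by (simp add: ennreal_mult mult_ac)
        qed
        finally have "ennreal p * W s \<le> ennreal p * (ennreal (K * D * (n * 4 ^ n)) * W r)"
          by (simp add: mult.commute)
        then show "W s \<le> ennreal (K * D * (n * 4 ^ n)) * W r"
          using p by (subst (asm) ennreal_mult_le_mult_iff) auto
      qed
    qed
  qed
qed

section \<open>The one-dimensional inequality forces the profile to be almost decreasing\<close>

text \<open>
  The \<open>A\<^sub>1\<close> inequality on intervals with respect to \<open>t\<^bsup>n-1\<^esup> dt\<close>. The essential infimum is replaced
  by some essential lower bound \<open>c\<close>, and \<open>a < 0\<close> is allowed so that \<open>[0, b)\<close> is among the intervals.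
\<close>

definition interval_A1 :: "real \<Rightarrow> nat \<Rightarrow> (real \<Rightarrow> ennreal) \<Rightarrow> bool" where
  "interval_A1 C n W \<longleftrightarrow> (\<forall>a b. a < b \<longrightarrow> 0 < b \<longrightarrow> (\<exists>c.
     (AE t in lborel. t \<in> {a<..<b} \<inter> {0..} \<longrightarrow> c \<le> W t) \<and>
     (radial_integral n W ({a<..<b} \<inter> {0..}))
       \<le> ennreal C * c * (radial_volume n ({a<..<b} \<inter> {0..}))))"

text \<open>Rational endpoints keep the exceptional set of radii null.\<close>

lemma initial_average_le:
  fixes W :: "real \<Rightarrow> ennreal"
  assumes W: "W \<in> borel_measurable borel" and n: "0 < n" and A: "interval_A1 C n W"
  shows "AE r in lborel. \<forall>q::rat. 0 \<le> r \<longrightarrow> r < of_rat q \<longrightarrow>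
    (radial_integral n W {0..<of_rat q})
      \<le> ennreal C * W r * ennreal (of_rat q ^ n / n)"
proof (subst AE_all_countable, intro allI)
  fix q :: rat
  show "AE r in lborel. 0 \<le> r \<longrightarrow> r < of_rat q \<longrightarrow>
    (radial_integral n W {0..<of_rat q})
      \<le> ennreal C * W r * ennreal (of_rat q ^ n / n)"
  proof (cases "0 < (of_rat q :: real)")
    case True
    have I: "{-1<..<of_rat q} \<inter> {0..} = {0..<of_rat q :: real}" by auto
    have "-1 < (of_rat q :: real)" using True by linarith
    from A[unfolded interval_A1_def, THEN spec, THEN spec, THEN mp, OF this, THEN mp, OF True]
    obtain c where cc: "(AE t in lborel. t \<in> {0..<of_rat q} \<longrightarrow> c \<le> W t) \<and>
      (radial_integral n W {0..<of_rat q})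
       \<le> ennreal C * c * (radial_volume n {0..<of_rat q})"
      unfolding I by (rule exE)
    note c = cc[THEN conjunct1] and le = cc[THEN conjunct2]
    note le
    also have "(radial_volume n {0..<of_rat q})
        \<le> (radial_volume n {0..of_rat q})"
      by (intro nn_integral_mono) (auto split: split_indicator)
    also have "\<dots> = ennreal (of_rat q ^ n / n)"
      using nn_integral_power_Icc[of 0 "of_rat q" n] True n by simp
    finally have le: "(radial_integral n W {0..<of_rat q})
       \<le> ennreal C * c * ennreal (of_rat q ^ n / n)" by (simp add: mult_left_mono)
    from c show ?thesis
    proof eventually_elim
      fix r :: real assume "r \<in> {0..<of_rat q} \<longrightarrow> c \<le> W r"
      then show "0 \<le> r \<longrightarrow> r < of_rat q \<longrightarrow>
        (radial_integral n W {0..<of_rat q})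
          \<le> ennreal C * W r * ennreal (of_rat q ^ n / n)"
        by (intro impI order_trans[OF le] mult_left_mono mult_right_mono) auto
    qed
  next
    case False
    have "\<not> (0 \<le> r \<and> r < (of_rat q :: real))" for r
      using False by linarith
    then show ?thesis by (intro AE_I2) blast
  qed
qed

text \<open>
  The average over \<open>[0, q)\<close> is at most \<open>C W r\<close> for every \<open>q > r\<close> and every large \<open>n\<close>. On
  \<open>[s, q)\<close> with \<open>q - s\<close> of order \<open>s/n\<close> the density \<open>t\<^bsup>n-1\<^esup>\<close> is constant up to the factor \<open>e\<close>, and
  this piece carries a fixed proportion of the mass of \<open>[0, q)\<close>. Letting \<open>n\<close> tend to infinity gives
  \<open>W s \<le> 6 C W r\<close> for \<open>s \<ge> 2r\<close>.
\<close>

lemma almost_decreasing_if_interval_A1: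
  fixes W :: "real \<Rightarrow> ennreal"
  assumes W [measurable]: "W \<in> borel_measurable borel"
    and fin: "\<And>t. W t < \<infinity>"
    and loc: "\<And>a b. 0 < a \<Longrightarrow> (\<integral>\<^sup>+t. W t * indicator {a..b} t \<partial>lborel) < \<infinity>"
    and C: "0 \<le> C" and A: "\<And>n. n > N \<Longrightarrow> interval_A1 C n W"
  shows "\<exists>K. almost_decreasing K W"
proof -
  let ?J = "\<lambda>(n::nat) (q::rat). \<integral>\<^sup>+t. W t * ennreal (t ^ (n - 1)) * indicator {0..<of_rat q} t \<partial>lborel"
  have "AE r in lborel. \<forall>k::nat. \<forall>q::rat. 0 \<le> r \<longrightarrow> r < of_rat q \<longrightarrow>
    ?J (Suc N + k) q
      \<le> ennreal C * W r * ennreal (of_rat q ^ (Suc N + k) / (Suc N + k))"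
    unfolding AE_all_countable[of _ lborel, where 'i=nat]
    by (intro allI initial_average_le A W) auto
  then have H: "AE r in lborel. \<forall>n>N. \<forall>q::rat. 0 \<le> r \<longrightarrow> r < of_rat q \<longrightarrow>
    ?J n q
      \<le> ennreal C * W r * ennreal (of_rat q ^ n / n)"
  proof eventually_elim
    fix r assume k: "\<forall>k::nat. \<forall>q::rat. 0 \<le> r \<longrightarrow> r < of_rat q \<longrightarrow>
    ?J (Suc N + k) q
      \<le> ennreal C * W r * ennreal (of_rat q ^ (Suc N + k) / (Suc N + k))"
    show "\<forall>n>N. \<forall>q::rat. 0 \<le> r \<longrightarrow> r < of_rat q \<longrightarrow>
    ?J n q
      \<le> ennreal C * W r * ennreal (of_rat q ^ n / n)"
    proof (intro allI impI)
      fix n q assume "N < n" "0 \<le> r" "r < of_rat q"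
      then show "?J n q
        \<le> ennreal C * W r * ennreal (of_rat q ^ n / n)"
        using k[rule_format, of q "n - Suc N"] by simp
    qed
  qed
  have Q: "AE r in lborel. AE s in lborel. 0 < r \<and> 2 * r \<le> s \<longrightarrow> W s \<le> ennreal (6 * C) * W r"
    using H
  proof eventually_elim
    fix r assume H: "\<forall>n>N. \<forall>q::rat. 0 \<le> r \<longrightarrow> r < of_rat q \<longrightarrow>
    ?J n q
      \<le> ennreal C * W r * ennreal (of_rat q ^ n / n)"
    from AE_le_of_right_averages[OF W fin loc, simplified]
    show "AE s in lborel. 0 < r \<and> 2 * r \<le> s \<longrightarrow> W s \<le> ennreal (6 * C) * W r"
    proof eventually_elim
      fix s :: real
      assume s: "0 < s \<longrightarrow> (\<forall>K. (\<forall>\<delta>>0. \<exists>h\<in>{0<..<\<delta>}. (\<integral>\<^sup>+t. W t * indicator {s..s+h} t \<partial>lborel) \<le> K * ennreal h) \<longrightarrow> W s \<le> K)"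
      show "0 < r \<and> 2 * r \<le> s \<longrightarrow> W s \<le> ennreal (6 * C) * W r"
      proof
        assume rs: "0 < r \<and> 2 * r \<le> s"
        then have "0 < s" by simp
        show "W s \<le> ennreal (6 * C) * W r"
        proof (rule s[rule_format, OF \<open>0 < s\<close>])
          fix \<delta> :: real assume "\<delta> > 0"
          obtain n0 :: nat where n0: "s / \<delta> < n0" using reals_Archimedean2 by blast
          define n where "n = max n0 (Suc N)"
          have n: "n > N" "n > 0" "s / \<delta> < n" using n0 by (auto simp: n_def)
          \<comment> \<open>\<open>[s, s+h]\<close> is about half of \<open>[s, s + s/n]\<close>, which leaves room for a rational endpoint.\<close>
          define h where "h = s / (2 * n)"
          have h: "0 < h" "h < \<delta>" "s + h < s + s / n"
            using n \<open>0 < s\<close> \<open>\<delta> > 0\<close> by (auto simp: h_def field_simps)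
          from h(3) obtain q where q: "s + h < of_rat q" "of_rat q < s + s / n"
            using of_rat_dense by blast
          have "ennreal (s ^ (n - 1)) * (\<integral>\<^sup>+t. W t * indicator {s..s+h} t \<partial>lborel)
              = (\<integral>\<^sup>+t. ennreal (s ^ (n - 1)) * (W t * indicator {s..s+h} t) \<partial>lborel)"
            by (rule nn_integral_cmult[symmetric]) measurable
          also have "\<dots> \<le> ?J n q"
          proof (rule nn_integral_mono)
            fix t :: real
            have "s \<le> t \<Longrightarrow> ennreal (s ^ (n - 1)) * W t \<le> ennreal (t ^ (n - 1)) * W t"
              using \<open>0 < s\<close> by (intro mult_right_mono ennreal_leI power_mono) auto
            then show "ennreal (s ^ (n - 1)) * (W t * indicator {s..s+h} t) \<le> W t * ennreal (t ^ (n - 1)) * indicator {0..<of_rat q} t"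
              using q \<open>0 < s\<close> by (auto simp: mult_ac split: split_indicator)
          qed
          also have "\<dots> \<le> ennreal C * W r * ennreal (of_rat q ^ n / n)"
            using H n rs q h by auto
          also have "\<dots> \<le> ennreal C * W r * ennreal (s ^ (n - 1) * (6 * h))"
          proof (intro mult_left_mono ennreal_leI)
            have q0: "0 \<le> (of_rat q :: real)" using q h \<open>0 < s\<close> by linarith
            have "of_rat q ^ n \<le> (s * (1 + 1 / n)) ^ n"
              by (rule power_mono[OF _ q0]) (use q in \<open>simp add: algebra_simps\<close>)
            also have "\<dots> = s ^ n * (1 + 1 / n) ^ n" by (rule power_mult_distrib)
            also have "\<dots> \<le> s ^ n * 3"
            proof (intro mult_left_mono)
              have "(1 + 1 / n) ^ n \<le> exp (1::real)"
                using exp_ge_one_plus_x_over_n_power_n[of n 1] n by simp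
              also have "\<dots> \<le> 3" by (rule exp_le)
              finally show "(1 + 1 / n) ^ n \<le> (3::real)" .
            qed (use \<open>0 < s\<close> in auto)
            also have "s ^ n = s * s ^ (n - 1)" using n by (simp add: power_eq_if)
            finally show "of_rat q ^ n / n \<le> s ^ (n - 1) * (6 * h)"
              using n by (simp add: h_def field_simps)
          qed auto
          also have "\<dots> = ennreal (s ^ (n - 1)) * (ennreal (6 * C) * W r * ennreal h)"
            using C h \<open>0 < s\<close> by (simp add: ennreal_mult mult_ac)
          finally have "(\<integral>\<^sup>+t. W t * indicator {s..s+h} t \<partial>lborel) \<le> ennreal (6 * C) * W r * ennreal h"
            using \<open>0 < s\<close> by (subst (asm) ennreal_mult_le_mult_iff) auto
          with h show "\<exists>h\<in>{0<..<\<delta>}. (\<integral>\<^sup>+t. W t * indicator {s..s+h} t \<partial>lborel) \<le> ennreal (6 * C) * W r * ennreal h"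
            by auto
        qed
      qed
    qed
  qed
  let ?n = "Suc N"
  have B: "AE r in lborel. 0 < r \<longrightarrow>
      (radial_integral ?n W {0..r}) \<le> ennreal (C * 2 ^ ?n) * W r * ennreal (r ^ ?n)"
    using H
  proof eventually_elim
    fix r assume H: "\<forall>n>N. \<forall>q::rat. 0 \<le> r \<longrightarrow> r < of_rat q \<longrightarrow>
    ?J n q
      \<le> ennreal C * W r * ennreal (of_rat q ^ n / n)"
    show "0 < r \<longrightarrow>
      (radial_integral ?n W {0..r}) \<le> ennreal (C * 2 ^ ?n) * W r * ennreal (r ^ ?n)"
    proof
      assume r: "0 < r"
      then obtain q where q: "r < of_rat q" "of_rat q < 2 * r"
        using of_rat_dense[of r "2 * r"] by auto
      have "(radial_integral ?n W {0..r})
          \<le> (radial_integral ?n W {0..<of_rat q})"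
        using q by (intro nn_integral_mono) (auto split: split_indicator)
      also have "\<dots> \<le> ennreal C * W r * ennreal (of_rat q ^ ?n / ?n)"
        using H q r by auto
      also have "\<dots> \<le> ennreal C * W r * ennreal ((2 * r) ^ ?n)"
      proof (intro mult_left_mono ennreal_leI)
        have q0: "0 \<le> (of_rat q :: real)" using q r by linarith
        have "of_rat q ^ ?n / ?n \<le> of_rat q ^ ?n / (1::real)"
          by (intro divide_left_mono zero_le_power[OF q0]) auto
        also have "\<dots> = of_rat q ^ ?n" by simp
        also have "\<dots> \<le> (2 * r) ^ ?n" by (rule power_mono[OF _ q0]) (use q in linarith)
        finally show "of_rat q ^ ?n / ?n \<le> (2 * r) ^ ?n" .
      qed auto
      also have "\<dots> = ennreal (C * 2 ^ ?n) * W r * ennreal (r ^ ?n)"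
        using C r by (simp add: power_mult_distrib ennreal_mult mult_ac del: power_Suc)
      finally show "(radial_integral ?n W {0..r}) \<le> ennreal (C * 2 ^ ?n) * W r * ennreal (r ^ ?n)" .
    qed
  qed
  from almost_decreasingI[OF W _ _ _ Q B] C show ?thesis by auto
qed

section \<open>The centred maximal inequality in high dimension\<close>

text \<open>
  Here \<open>r = |x|\<close>, \<open>p = x \<bullet> u\<close> and \<open>q = |u|\<^sup>2\<close>, so that \<open>|x + R u| = sqrt (r\<^sup>2 + 2 R p + R\<^sup>2 q)\<close>. For \<open>p = 0\<close>
  and \<open>q = 1\<close> the value \<open>s\<close> is taken at \<open>sqrt (s\<^sup>2 - r\<^sup>2)\<close>. The range \<open>[R0, R1]\<close> is enlarged
  by \<open>s' - s\<close> on either side, which absorbs the deviations of \<open>p\<close> and \<open>q\<close> from these values. The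
  slope is at most one because \<open>(p + R q)\<^sup>2 \<le> q (r\<^sup>2 + 2 R p + R\<^sup>2 q)\<close>, which amounts to \<open>p\<^sup>2 \<le> q r\<^sup>2\<close>.
\<close>

lemma norm_sweep:
  fixes r s s' p q :: real
  defines "\<epsilon> \<equiv> (s' - s) / (4 * s)"
    and "R0 \<equiv> sqrt (s\<^sup>2 - r\<^sup>2) - (s' - s)" and "R1 \<equiv> sqrt (s'\<^sup>2 - r\<^sup>2) + (s' - s)"
    and "g \<equiv> \<lambda>R. sqrt (r\<^sup>2 + 2 * R * p + R\<^sup>2 * q)"
  assumes r: "0 < r" "2 * r \<le> s" and s: "s < s'" "s' - s \<le> s / 4"
    and p: "\<bar>p\<bar> \<le> \<epsilon> * r" and q: "(1 - \<epsilon>)\<^sup>2 \<le> q" "q \<le> 1"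
  shows "0 < R0" "R0 < R1" "R1 - R0 \<le> 4 * (s' - s)"
    and "g R0 \<le> s" "s' \<le> g R1"
    and "\<And>R. R0 \<le> R \<Longrightarrow> (g has_real_derivative (p + R * q) / g R) (at R)"
    and "\<And>R. R0 \<le> R \<Longrightarrow> 0 < g R"
    and "\<And>R. R0 \<le> R \<Longrightarrow> 0 \<le> (p + R * q) / g R"
    and "\<And>R. R0 \<le> R \<Longrightarrow> (p + R * q) / g R \<le> 1"
proof -
  define \<eta> where "\<eta> = s' - s"
  define A where "A = sqrt (s\<^sup>2 - r\<^sup>2)"
  define B where "B = sqrt (s'\<^sup>2 - r\<^sup>2)"
  have s0: "0 < s" using r by simp
  have \<eta>: "0 < \<eta>" "\<eta> \<le> s / 4" using s by (auto simp: \<eta>_def)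
  have R0: "R0 = A - \<eta>" and R1: "R1 = B + \<eta>" by (simp_all add: R0_def R1_def A_def B_def \<eta>_def)
  have \<epsilon>: "\<epsilon> * s = \<eta> / 4" "0 < \<epsilon>" using \<eta> s0 by (auto simp: \<epsilon>_def \<eta>_def)
  have "\<epsilon> * s \<le> (1 / 16) * s" using \<epsilon>(1) \<eta> by linarith
  then have \<epsilon>16: "\<epsilon> \<le> 1 / 16" using s0 by (rule mult_right_le_imp_le)
  have \<epsilon>r: "\<epsilon> * r \<le> \<eta> / 8"
  proof -
    have "\<epsilon> * (2 * r) \<le> \<epsilon> * s" using r \<epsilon> by (intro mult_left_mono) auto
    then show ?thesis using \<epsilon> by simp
  qed
  have r2: "r\<^sup>2 \<le> s\<^sup>2 / 4"
  proof -
    have "(2 * r)\<^sup>2 \<le> s\<^sup>2" using r by (intro power_mono) auto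
    then show ?thesis by (simp add: power_mult_distrib)
  qed
  have ss': "s\<^sup>2 \<le> s'\<^sup>2" using s s0 by (intro power_mono) auto
  have nn: "0 \<le> s\<^sup>2 - r\<^sup>2" "0 \<le> s'\<^sup>2 - r\<^sup>2"
    using r2 ss' zero_le_power2[of s] by linarith+
  have A2: "A\<^sup>2 = s\<^sup>2 - r\<^sup>2" unfolding A_def using nn(1) by (rule real_sqrt_pow2)
  have B2: "B\<^sup>2 = s'\<^sup>2 - r\<^sup>2" unfolding B_def using nn(2) by (rule real_sqrt_pow2)
  have A_ge: "17 / 20 * s \<le> A"
    unfolding A_def
  proof (rule real_le_rsqrt)
    have "(17 / 20 * s)\<^sup>2 = 289 / 400 * s\<^sup>2" by (simp add: power_mult_distrib power_divide)
    then show "(17 / 20 * s)\<^sup>2 \<le> s\<^sup>2 - r\<^sup>2" using r2 zero_le_power2[of s] by linarith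
  qed
  have B_pos: "0 \<le> B" "A \<le> B" using nn ss' by (simp_all add: B_def A_def)
  have "B \<le> sqrt (s'\<^sup>2)" unfolding B_def by (intro real_sqrt_le_mono) simp
  then have B_le: "B \<le> s'" using s s0 by simp
  have R0_ge: "s / 2 \<le> R0" unfolding R0 using A_ge \<eta> s0 by linarith
  then show "0 < R0" using s0 by linarith
  show "R0 < R1" unfolding R0 R1 using B_pos \<eta> by linarith
  \<comment> \<open>\<open>B\<^sup>2 - A\<^sup>2 = s'\<^sup>2 - s\<^sup>2\<close>, and \<open>A\<close> is not much smaller than \<open>s\<close> because \<open>r \<le> s/2\<close>.\<close>
  have "B - A \<le> 2 * \<eta>"
  proof (rule ccontr)
    assume "\<not> B - A \<le> 2 * \<eta>"
    then have "2 * \<eta> * (17 / 10 * s) < (B - A) * (B + A)"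
      using A_ge B_pos \<eta> s0 by (intro mult_strict_mono' ) auto
    also have "(B - A) * (B + A) = \<eta> * (s + s')"
      using A2 B2 by (simp add: \<eta>_def power2_eq_square algebra_simps)
    also have "\<dots> \<le> \<eta> * (9 / 4 * s)" using \<eta> by (intro mult_left_mono) (auto simp: \<eta>_def)
    finally show False using \<eta> s0 by simp
  qed
  then show "R1 - R0 \<le> 4 * (s' - s)" unfolding R0 R1 by (simp add: \<eta>_def)
  have p': "\<bar>p\<bar> \<le> \<eta> / 8" using p \<epsilon>r by linarith
  have q': "1 - 2 * \<epsilon> \<le> q" "3 / 4 \<le> q"
  proof -
    have "1 - 2 * \<epsilon> \<le> (1 - \<epsilon>)\<^sup>2" by (simp add: power2_eq_square algebra_simps)
    then show "1 - 2 * \<epsilon> \<le> q" using q by linarith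
    then show "3 / 4 \<le> q" using \<epsilon>16 by linarith
  qed
  have pq: "p\<^sup>2 \<le> q * r\<^sup>2"
  proof -
    have "p\<^sup>2 \<le> (\<epsilon> * r)\<^sup>2" using p by (metis abs_ge_zero power2_abs power_mono)
    also have "\<dots> = \<epsilon>\<^sup>2 * r\<^sup>2" by (rule power_mult_distrib)
    also have "\<dots> \<le> q * r\<^sup>2"
    proof (intro mult_right_mono)
      have "\<epsilon>\<^sup>2 \<le> (1 - \<epsilon>)\<^sup>2" using \<epsilon> \<epsilon>16 by (intro power_mono) auto
      then show "\<epsilon>\<^sup>2 \<le> q" using q by linarith
    qed auto
    finally show ?thesis .
  qed
  have slope: "0 < p + R * q" if "R0 \<le> R" for R
  proof -
    have "s / 2 * (3 / 4) \<le> R * q" using that R0_ge q' s0 by (intro mult_mono) auto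
    then show ?thesis using p' \<eta> s0 by linarith
  qed
  have sq: "(p + R * q)\<^sup>2 \<le> q * (r\<^sup>2 + 2 * R * p + R\<^sup>2 * q)" for R
    using pq by (simp add: power2_eq_square algebra_simps)
  have pos: "0 < r\<^sup>2 + 2 * R * p + R\<^sup>2 * q" if "R0 \<le> R" for R
  proof -
    have "0 < (p + R * q)\<^sup>2" using slope[OF that] by simp
    then have "0 < q * (r\<^sup>2 + 2 * R * p + R\<^sup>2 * q)" using sq[of R] by linarith
    then show ?thesis using q' by (simp add: zero_less_mult_iff)
  qed
  then show gpos: "0 < g R" if "R0 \<le> R" for R using that by (simp add: g_def)
  show "(g has_real_derivative (p + R * q) / g R) (at R)" if "R0 \<le> R" for R
    unfolding g_def using pos[OF that]
    by (auto intro!: derivative_eq_intros simp: field_simps)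
  show "0 \<le> (p + R * q) / g R" if "R0 \<le> R" for R
    using gpos[OF that] slope[OF that] by simp
  show "(p + R * q) / g R \<le> 1" if "R0 \<le> R" for R
  proof -
    have "(p + R * q)\<^sup>2 \<le> 1 * (r\<^sup>2 + 2 * R * p + R\<^sup>2 * q)"
      using q pos[OF that] by (intro order_trans[OF sq] mult_right_mono) auto
    then have "p + R * q \<le> g R" unfolding g_def by (intro real_le_rsqrt) simp
    then show ?thesis using gpos[OF that] by simp
  qed
  show "g R0 \<le> s"
    unfolding g_def
  proof (intro real_le_lsqrt)
    have "R0 * p \<le> R0 * \<eta>" using R0_ge s0 p' \<eta> by (intro mult_left_mono) auto
    moreover have "R0\<^sup>2 * q \<le> R0\<^sup>2" using q by (simp add: mult_left_le)
    moreover have "R0\<^sup>2 + 2 * (R0 * \<eta>) + \<eta>\<^sup>2 = s\<^sup>2 - r\<^sup>2"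
      unfolding A2[symmetric] R0 by (simp add: power2_eq_square algebra_simps)
    moreover have "0 \<le> \<eta>\<^sup>2" by simp
    ultimately show "r\<^sup>2 + 2 * R0 * p + R0\<^sup>2 * q \<le> s\<^sup>2" by linarith
  qed (use s0 in simp)
  show "s' \<le> g R1"
    unfolding g_def
  proof (intro real_le_rsqrt)
    have R1p: "\<eta> \<le> R1" "R1 \<le> 3 / 2 * s" unfolding R1 using B_pos B_le \<eta> by (auto simp: \<eta>_def)
    have "R1 * (- (\<eta> / 8)) \<le> R1 * p" using R1p \<eta> p' by (intro mult_left_mono) auto
    then have "- (R1 * \<eta>) / 8 \<le> R1 * p" by simp
    moreover have "R1\<^sup>2 * (1 - 2 * \<epsilon>) \<le> R1\<^sup>2 * q" using q' by (intro mult_left_mono) auto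
    then have "R1\<^sup>2 - 2 * (R1 * (\<epsilon> * R1)) \<le> R1\<^sup>2 * q" by (simp add: power2_eq_square algebra_simps)
    moreover have "R1 * (\<epsilon> * R1) \<le> 3 / 8 * (R1 * \<eta>)"
    proof -
      have "R1 * (\<epsilon> * R1) \<le> R1 * (\<epsilon> * (3 / 2 * s))"
        using R1p \<eta> \<epsilon> by (intro mult_left_mono) auto
      also have "\<dots> = 3 / 2 * R1 * (\<epsilon> * s)" by (simp only: mult_ac)
      finally show ?thesis unfolding \<epsilon>(1) by simp
    qed
    moreover have "R1\<^sup>2 - 2 * (R1 * \<eta>) + \<eta>\<^sup>2 = s'\<^sup>2 - r\<^sup>2"
      unfolding B2[symmetric] R1 by (simp add: power2_eq_square algebra_simps)
    moreover have "\<eta> * \<eta> \<le> R1 * \<eta>" using R1p \<eta> by (intro mult_right_mono) auto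
    then have "\<eta>\<^sup>2 \<le> R1 * \<eta>" by (simp only: power2_eq_square)
    ultimately show "s'\<^sup>2 \<le> r\<^sup>2 + 2 * R1 * p + R1\<^sup>2 * q"
      by linarith
  qed
qed

text \<open>The inequality \<open>M w \<le> C w\<close> for \<open>w x = W |x|\<close>, with the averages multiplied out.\<close>

definition centred_A1 :: "real \<Rightarrow> nat \<Rightarrow> (real \<Rightarrow> ennreal) \<Rightarrow> bool" where
  "centred_A1 C n W \<longleftrightarrow> (AE x in prodleb n. \<forall>R>0.
     weighted n (\<lambda>y. W (nrm n y)) (nball n x R) \<le> ennreal C * W (nrm n x) * ennreal (vol n * R ^ n))"

text \<open>
  Fix a good centre \<open>x\<close> and integrate the inequality for the ball of radius \<open>R\<close> over the range of \<open>R\<close>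
  from \<open>norm_sweep\<close>. After the substitution \<open>y = x + R u\<close> the volumes \<open>R\<^sup>n\<close> cancel, and the order of
  integration can be exchanged. For every \<open>u\<close> in the equator the inner integral of
  \<open>W |x + R u|\<close> over \<open>R\<close> is at least the integral of \<open>W\<close> over \<open>[s, s']\<close>, and the equator has at
  least half the volume of the unit ball.
\<close>

lemma sweep_integral:
  fixes W :: "real \<Rightarrow> ennreal"
  defines "\<epsilon> \<equiv> \<lambda>s s'. (s' - s) / (4 * s)"
  assumes [measurable]: "W \<in> borel_measurable borel" and n: "0 < n" and C: "0 \<le> C"
    and r: "0 < nrm n x" "2 * nrm n x \<le> s" and s: "s < s'" "s' - s \<le> s / 4"
    and small: "3 * sqrt (1 - (\<epsilon> s s')\<^sup>2) ^ n \<le> 1 / 2"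
    and good: "\<And>R. 0 < R \<Longrightarrow> weighted n (\<lambda>y. W (nrm n y)) (nball n x R)
      \<le> ennreal C * W (nrm n x) * ennreal (vol n * R ^ n)"
  shows "(\<integral>\<^sup>+t. W t * indicator {s..s'} t \<partial>lborel) \<le> ennreal (8 * C) * W (nrm n x) * ennreal (s' - s)"
proof -
  define r where "r = nrm n x"
  define e where "e = \<epsilon> s s'"
  define R0 where "R0 = sqrt (s\<^sup>2 - r\<^sup>2) - (s' - s)"
  define R1 where "R1 = sqrt (s'\<^sup>2 - r\<^sup>2) + (s' - s)"
  define I where "I = (\<integral>\<^sup>+t. W t * indicator {s..s'} t \<partial>lborel)"
  let ?N = "\<lambda>R u. nrm n (\<lambda>i. x i + R * u i)"
  let ?B = "nball n (\<lambda>_. 0) 1"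
  have s0: "0 < s" using r by simp
  have e: "0 < e" "e < 1" using s s0 by (auto simp: e_def \<epsilon>_def divide_less_eq)
  have sweep_u: "0 < R0 \<and> R0 < R1 \<and> R1 - R0 \<le> 4 * (s' - s) \<and> ?N R0 u \<le> s \<and> s' \<le> ?N R1 u \<and>
    I \<le> (\<integral>\<^sup>+R. W (?N R u) * indicator {R0..R1} R \<partial>lborel)"
    if u: "u \<in> equator n x e" for u
  proof -
    define p where "p = iprod n x u"
    define q where "q = (nrm n u)\<^sup>2"
    define g where "g = (\<lambda>R. sqrt (r\<^sup>2 + 2 * R * p + R\<^sup>2 * q))"
    have p: "\<bar>p\<bar> \<le> (s' - s) / (4 * s) * r"
      using u by (simp add: equator_def p_def e_def \<epsilon>_def r_def)
    have u1: "nrm n u < 1" "1 - e \<le> nrm n u" using u by (auto simp: equator_def nball_def)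
    have q: "(1 - (s' - s) / (4 * s))\<^sup>2 \<le> q" "q \<le> 1"
      unfolding q_def using u1 e by (auto simp: e_def \<epsilon>_def intro!: power_mono power_le_one)
    have g: "?N R u = g R" for R
    proof -
      have "?N R u = sqrt ((?N R u)\<^sup>2)" by simp
      then show ?thesis unfolding nrm_sq_add g_def p_def q_def r_def .
    qed
    have sw: "0 < R0" "R0 < R1" "R1 - R0 \<le> 4 * (s' - s)" "g R0 \<le> s" "s' \<le> g R1"
      "\<And>R. R0 \<le> R \<Longrightarrow> (g has_real_derivative (p + R * q) / g R) (at R)"
      "\<And>R. R0 \<le> R \<Longrightarrow> 0 < g R"
      "\<And>R. R0 \<le> R \<Longrightarrow> 0 \<le> (p + R * q) / g R"
      "\<And>R. R0 \<le> R \<Longrightarrow> (p + R * q) / g R \<le> 1"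
      unfolding g_def R0_def R1_def
      by (fact norm_sweep[OF r[folded r_def] s p q])+
    have "I \<le> (\<integral>\<^sup>+t. W t * indicator {g R0..g R1} t \<partial>lborel)"
      unfolding I_def using sw(4,5) by (intro nn_integral_mono mult_left_mono) (auto split: split_indicator)
    also have "\<dots> = (\<integral>\<^sup>+R. W (g R) * ennreal ((p + R * q) / g R) * indicator {R0..R1} R \<partial>lborel)"
    proof (rule nn_integral_substitution_aux)
      have "continuous_on {R0..R1} g"
        by (rule has_real_derivative_imp_continuous_on, rule sw(6)) auto
      then show "continuous_on {R0..R1} (\<lambda>R. (p + R * q) / g R)"
        using sw(7) by (intro continuous_intros) fastforce+
    qed (use sw in auto)
    also have "\<dots> \<le> (\<integral>\<^sup>+R. W (g R) * indicator {R0..R1} R \<partial>lborel)"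
    proof (intro nn_integral_mono)
      fix R
      have "W (g R) * ennreal ((p + R * q) / g R) \<le> W (g R) * 1" if "R0 \<le> R"
        using sw(9)[OF that] by (intro mult_left_mono) auto
      then show "W (g R) * ennreal ((p + R * q) / g R) * indicator {R0..R1} R \<le> W (g R) * indicator {R0..R1} R"
        by (auto split: split_indicator)
    qed
    finally show ?thesis unfolding g using sw(1-5) by simp
  qed
  have eq_meas: "ennreal (vol n / 2) \<le> emeasure (prodleb n) (equator n x e)"
    using e r n small by (intro emeasure_equator_ge) (auto simp: e_def)
  have v: "vol n > 0" by simp
  have "equator n x e \<noteq> {}"
  proof
    assume "equator n x e = {}"
    with eq_meas have "ennreal (vol n / 2) = 0" by (simp only: emeasure_empty le_zero_eq)
    then have "vol n / 2 \<le> 0" by (simp only: ennreal_eq_0_iff)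
    with v show False by linarith
  qed
  then obtain u0 where u0: "u0 \<in> equator n x e" by blast
  have R: "0 < R0" "R0 < R1" "R1 - R0 \<le> 4 * (s' - s)" using sweep_u[OF u0] by auto
  have avg: "(\<integral>\<^sup>+u. W (?N R u) * indicator ?B u \<partial>prodleb n) \<le> ennreal C * W r * ennreal (vol n)"
    if "0 < R" for R
  proof -
    have "ennreal (R ^ n) * (\<integral>\<^sup>+u. W (?N R u) * indicator ?B u \<partial>prodleb n)
        = weighted n (\<lambda>y. W (nrm n y)) (nball n x R)"
      using that by (subst weighted_nball_dilation) (auto simp: nrm_dilation)
    also have "\<dots> \<le> ennreal C * W r * ennreal (vol n * R ^ n)"
      using good[OF that] by (simp add: r_def)
    also have "\<dots> = ennreal (R ^ n) * (ennreal C * W r * ennreal (vol n))"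
      using that v by (simp add: ennreal_mult mult_ac)
    finally show ?thesis
      using that by (subst (asm) ennreal_mult_le_mult_iff) auto
  qed
  interpret sigma_finite_measure "prodleb n" by (rule sigma_finite_prodleb)
  interpret P: pair_sigma_finite lborel "prodleb n" ..
  \<comment> \<open>Restricting \<open>u\<close> to the equator gives the lower bound, integrating over \<open>u\<close> first the upper bound.\<close>
  have "I * emeasure (prodleb n) (equator n x e) = (\<integral>\<^sup>+u. I * indicator (equator n x e) u \<partial>prodleb n)"
    by (simp add: nn_integral_cmult)
  also have "\<dots> \<le> (\<integral>\<^sup>+u. (\<integral>\<^sup>+R. W (?N R u) * indicator {R0..R1} R * indicator ?B u \<partial>lborel) \<partial>prodleb n)"
  proof (intro nn_integral_mono)
    fix u
    show "I * indicator (equator n x e) u \<le> (\<integral>\<^sup>+R. W (?N R u) * indicator {R0..R1} R * indicator ?B u \<partial>lborel)"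
    proof (cases "u \<in> equator n x e")
      case True
      then have "u \<in> ?B" by (simp add: equator_def)
      with True sweep_u[OF True] show ?thesis by simp
    qed simp
  qed
  also have "\<dots> = (\<integral>\<^sup>+R. (\<integral>\<^sup>+u. W (?N R u) * indicator {R0..R1} R * indicator ?B u \<partial>prodleb n) \<partial>lborel)"
  proof -
    have [measurable]: "(\<lambda>(R, u). W (?N R u)) \<in> borel_measurable (lborel \<Otimes>\<^sub>M prodleb n)"
      unfolding nrm_def L2_set_def by measurable
    show ?thesis
      by (rule P.Fubini'[of "\<lambda>R u. W (?N R u) * indicator {R0..R1} R * indicator ?B u"]) measurable
  qed
  also have "\<dots> \<le> (\<integral>\<^sup>+R. ennreal C * W r * ennreal (vol n) * indicator {R0..R1} R \<partial>lborel)"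
  proof (intro nn_integral_mono)
    fix R
    show "(\<integral>\<^sup>+u. W (?N R u) * indicator {R0..R1} R * indicator ?B u \<partial>prodleb n)
        \<le> ennreal C * W r * ennreal (vol n) * indicator {R0..R1} R"
      using avg[of R] R by (cases "R \<in> {R0..R1}") auto
  qed
  also have "\<dots> = ennreal C * W r * ennreal (vol n) * ennreal (R1 - R0)"
    using R by (simp add: nn_integral_cmult_indicator)
  also have "\<dots> \<le> ennreal C * W r * ennreal (vol n) * ennreal (4 * (s' - s))"
    using R by (intro mult_left_mono ennreal_leI) auto
  also have "\<dots> = ennreal (vol n / 2) * (ennreal (8 * C) * W r * ennreal (s' - s))"
  proof -
    have "ennreal C * ennreal (vol n) * ennreal (4 * (s' - s)) = ennreal (vol n / 2) * ennreal (8 * C) * ennreal (s' - s)"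
      using C v s by (simp add: ennreal_mult[symmetric])
    then have "ennreal C * ennreal (vol n) * ennreal (4 * (s' - s)) * W r
        = ennreal (vol n / 2) * ennreal (8 * C) * ennreal (s' - s) * W r" by (rule arg_cong)
    then show ?thesis by (simp only: mult_ac)
  qed
  finally have "I * emeasure (prodleb n) (equator n x e) \<le> ennreal (vol n / 2) * (ennreal (8 * C) * W r * ennreal (s' - s))" .
  moreover have "I * ennreal (vol n / 2) \<le> I * emeasure (prodleb n) (equator n x e)"
    using eq_meas by (intro mult_left_mono) auto
  ultimately have "ennreal (vol n / 2) * I \<le> ennreal (vol n / 2) * (ennreal (8 * C) * W r * ennreal (s' - s))"
    by (simp add: mult.commute)
  moreover have "ennreal (vol n / 2) \<noteq> 0"
    unfolding ennreal_eq_0_iff using v by linarith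
  ultimately have "I \<le> ennreal (8 * C) * W r * ennreal (s' - s)"
    using ennreal_mult_le_mult_iff[OF _ ennreal_neq_top] by blast
  then show ?thesis by (simp add: I_def r_def)
qed

text \<open>
  The dimension is chosen after \<open>s\<close> and \<open>s'\<close>, whereas the constant \<open>8 C\<close> does not depend on it. The
  resulting inequality no longer mentions \<open>n\<close>.
\<close>

lemma window_of_centred_A1:
  fixes W :: "real \<Rightarrow> ennreal"
  assumes [measurable]: "W \<in> borel_measurable borel" and C: "0 \<le> C"
    and A: "\<And>n. n > N \<Longrightarrow> centred_A1 C n W"
    and s: "0 < s" "s < s'" "s' - s \<le> s / 4"
  shows "AE r in lborel. 0 < r \<and> 2 * r \<le> s \<longrightarrow>
    (\<integral>\<^sup>+t. W t * indicator {s..s'} t \<partial>lborel) \<le> ennreal (8 * C) * W r * ennreal (s' - s)"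
proof -
  define e where "e = (s' - s) / (4 * s)"
  define q where "q = sqrt (1 - e\<^sup>2)"
  have e: "0 < e" "e < 1" using s by (auto simp: e_def divide_less_eq)
  have "e\<^sup>2 < 1" using e by (simp add: power_less_one_iff)
  then have q: "0 \<le> q" "q < 1" using e by (auto simp: q_def)
  obtain m where m: "q ^ m < 1 / 6" using real_arch_pow_inv[of "1 / 6" q] q by auto
  define n where "n = m + Suc N"
  have "q ^ n \<le> q ^ m" using q by (intro power_decreasing) (auto simp: n_def)
  with m have small: "3 * sqrt (1 - e\<^sup>2) ^ n \<le> 1 / 2" by (simp add: q_def)
  have n: "n > N" "n > 0" by (auto simp: n_def)
  let ?P = "\<lambda>r. 0 < r \<and> 2 * r \<le> s \<longrightarrow>
    (\<integral>\<^sup>+t. W t * indicator {s..s'} t \<partial>lborel) \<le> ennreal (8 * C) * W r * ennreal (s' - s)"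
  have "AE x in prodleb n. ?P (nrm n x)"
    using A[OF n(1)] unfolding centred_A1_def
  proof eventually_elim
    fix x
    assume good: "\<forall>R>0. weighted n (\<lambda>y. W (nrm n y)) (nball n x R) \<le> ennreal C * W (nrm n x) * ennreal (vol n * R ^ n)"
    then show "?P (nrm n x)"
      using sweep_integral[OF _ n(2) C _ _ s(2,3) small[unfolded e_def]] by auto
  qed
  moreover have "{r. ?P r} \<in> sets borel"
  proof -
    have "Measurable.pred borel ?P" by measurable
    then show ?thesis by (simp add: pred_def)
  qed
  ultimately have "AE r in lborel. 0 \<le> r \<longrightarrow> ?P r"
    using AE_radial[OF n(2), of ?P] by blast
  then show ?thesis by eventually_elim auto
qed

text \<open>The ball of radius \<open>|x|\<close> around the origin lies in the ball of radius \<open>2|x|\<close> around \<open>x\<close>.\<close>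

lemma centred_A1_doubling:
  fixes W :: "real \<Rightarrow> ennreal"
  assumes [measurable]: "W \<in> borel_measurable borel" and n: "0 < n" and C: "0 \<le> C"
    and A: "centred_A1 C n W"
  shows "AE r in lborel. 0 < r \<longrightarrow>
    (radial_integral n W {0..r}) \<le> ennreal (C * 2 ^ n) * W r * ennreal (r ^ n)"
proof -
  let ?J = "\<lambda>r. radial_integral n W {0..r}"
  let ?P = "\<lambda>r. 0 < r \<longrightarrow> ?J r \<le> ennreal (C * 2 ^ n) * W r * ennreal (r ^ n)"
  have J: "?J = (\<lambda>r. \<integral>\<^sup>+t. W t * ennreal (t ^ (n - 1)) * (if 0 \<le> t \<and> t \<le> r then 1 else 0) \<partial>lborel)"
    by (intro ext nn_integral_cong) (auto split: split_indicator)
  have [measurable]: "?J \<in> borel_measurable borel"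
    unfolding J by measurable
  have v: "vol n > 0" by simp
  have "AE x in prodleb n. ?P (nrm n x)"
    using A unfolding centred_A1_def
  proof eventually_elim
    fix x
    assume good: "\<forall>R>0. weighted n (\<lambda>y. W (nrm n y)) (nball n x R) \<le> ennreal C * W (nrm n x) * ennreal (vol n * R ^ n)"
    show "?P (nrm n x)"
    proof
      assume r: "0 < nrm n x"
      let ?r = "nrm n x"
      have sub: "{y \<in> Rn n. nrm n y \<in> {..<?r}} \<subseteq> nball n x (2 * ?r)"
      proof
        fix y assume y: "y \<in> {y \<in> Rn n. nrm n y \<in> {..<?r}}"
        have "nrm n (\<lambda>i. y i - x i) \<le> nrm n y + nrm n (\<lambda>i. - x i)"
          using nrm_triangle[of n y "\<lambda>i. - x i"] by simp
        also have "nrm n (\<lambda>i. - x i) = ?r" by (simp add: nrm_def L2_set_def)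
        finally show "y \<in> nball n x (2 * ?r)" using y by (auto simp: nball_def)
      qed
      have "?J ?r = (radial_integral n W ({..<?r} \<inter> {0..}))"
        by (rule nn_integral_cong_AE, rule AE_I[where N="{?r}"]) (auto split: split_indicator)
      then have "ennreal (n * vol n) * ?J ?r = weighted n (\<lambda>y. W (nrm n y)) {y \<in> Rn n. nrm n y \<in> {..<?r}}"
        using n by (subst weighted_shell) auto
      also have "\<dots> \<le> weighted n (\<lambda>y. W (nrm n y)) (nball n x (2 * ?r))"
        unfolding weighted_eq using sub by (intro nn_integral_mono mult_left_mono) (auto split: split_indicator)
      also have "\<dots> \<le> ennreal C * W ?r * ennreal (vol n * (2 * ?r) ^ n)"
        using good[rule_format, of "2 * ?r"] r by simp
      also have "\<dots> \<le> ennreal C * W ?r * ennreal (n * vol n * (2 * ?r) ^ n)"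
      proof (intro mult_left_mono ennreal_leI mult_right_mono)
        have "1 * vol n \<le> n * vol n" using n v by (intro mult_right_mono) auto
        then show "vol n \<le> n * vol n" by (simp only: mult_1)
      qed (use r in auto)
      also have "\<dots> = ennreal (n * vol n) * (ennreal (C * 2 ^ n) * W ?r * ennreal (?r ^ n))"
        using C v r by (simp add: ennreal_mult power_mult_distrib mult_ac)
      finally have "ennreal (n * vol n) * ?J ?r \<le> ennreal (n * vol n) * (ennreal (C * 2 ^ n) * W ?r * ennreal (?r ^ n))" .
      moreover have "ennreal (n * vol n) \<noteq> 0"
      proof -
        have "0 < n * vol n" using n v by (intro mult_pos_pos) auto
        then show ?thesis unfolding ennreal_eq_0_iff by linarith
      qed
      ultimately show "?J ?r \<le> ennreal (C * 2 ^ n) * W ?r * ennreal (?r ^ n)"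
        using ennreal_mult_le_mult_iff[OF _ ennreal_neq_top] by blast
    qed
  qed
  moreover have "{r. ?P r} \<in> sets borel"
  proof -
    have "Measurable.pred borel ?P" by measurable
    then show ?thesis by (simp add: pred_def)
  qed
  ultimately have "AE r in lborel. 0 \<le> r \<longrightarrow> ?P r"
    using AE_radial[OF n, of ?P] by blast
  then show ?thesis by eventually_elim auto
qed

lemma almost_decreasing_if_centred_A1:
  fixes W :: "real \<Rightarrow> ennreal"
  assumes W [measurable]: "W \<in> borel_measurable borel"
    and fin: "\<And>t. W t < \<infinity>"
    and loc: "\<And>a b. 0 < a \<Longrightarrow> (\<integral>\<^sup>+t. W t * indicator {a..b} t \<partial>lborel) < \<infinity>"
    and C: "0 \<le> C" and A: "\<And>n. n > N \<Longrightarrow> centred_A1 C n W"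
  shows "\<exists>K. almost_decreasing K W"
proof -
  let ?P = "\<lambda>(r::real) (q::rat) (q'::rat). 0 < (of_rat q :: real) \<longrightarrow> (of_rat q :: real) < of_rat q' \<longrightarrow>
      of_rat q' - of_rat q \<le> (of_rat q / 4 :: real) \<longrightarrow> 0 < r \<and> 2 * r \<le> of_rat q \<longrightarrow>
    (\<integral>\<^sup>+t. W t * indicator {of_rat q..of_rat q'} t \<partial>lborel) \<le> ennreal (8 * C) * W r * ennreal (of_rat q' - of_rat q)"
  have win: "AE r in lborel. \<forall>q q' :: rat. ?P r q q'"
    unfolding AE_all_countable
  proof (intro allI)
    fix q q' :: rat
    show "AE r in lborel. ?P r q q'"
    proof (cases "0 < (of_rat q :: real) \<and> (of_rat q :: real) < of_rat q' \<and> of_rat q' - of_rat q \<le> (of_rat q / 4 :: real)")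
      case True
      then have "AE r in lborel. 0 < r \<and> 2 * r \<le> of_rat q \<longrightarrow>
          (\<integral>\<^sup>+t. W t * indicator {of_rat q..of_rat q'} t \<partial>lborel) \<le> ennreal (8 * C) * W r * ennreal (of_rat q' - of_rat q)"
        by (intro window_of_centred_A1[OF W C A]) auto
      then show ?thesis by eventually_elim blast
    next
      case False
      then show ?thesis by (intro AE_I2) blast
    qed
  qed
  have Q: "AE r in lborel. AE s in lborel. 0 < r \<and> 2 * r \<le> s \<longrightarrow> W s \<le> ennreal (16 * C) * W r"
    using win
  proof eventually_elim
    fix r :: real
    assume win: "\<forall>q q' :: rat. ?P r q q'"
    from AE_le_of_right_averages[OF W fin loc, simplified] AE_lborel_singleton[of "2 * r"]
    show "AE s in lborel. 0 < r \<and> 2 * r \<le> s \<longrightarrow> W s \<le> ennreal (16 * C) * W r"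
    proof eventually_elim
      fix s :: real
      assume s: "0 < s \<longrightarrow> (\<forall>K. (\<forall>\<delta>>0. \<exists>h\<in>{0<..<\<delta>}. (\<integral>\<^sup>+t. W t * indicator {s..s+h} t \<partial>lborel) \<le> K * ennreal h) \<longrightarrow> W s \<le> K)"
        and "s \<noteq> 2 * r"
      show "0 < r \<and> 2 * r \<le> s \<longrightarrow> W s \<le> ennreal (16 * C) * W r"
      proof
        assume rs: "0 < r \<and> 2 * r \<le> s"
        then have rs: "0 < s" "0 < r" "2 * r < s" using \<open>s \<noteq> 2 * r\<close> by auto
        show "W s \<le> ennreal (16 * C) * W r"
        proof (rule s[rule_format, OF rs(1)])
          fix \<delta> :: real assume "\<delta> > 0"
          \<comment> \<open>A rational interval of length at most \<open>2h \<le> s/8\<close> around \<open>[s, s+h]\<close> then satisfies the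
            hypotheses of the window estimate.\<close>
          define h where "h = min (\<delta> / 2) (s / 16)"
          have h: "0 < h" "h < \<delta>" "h \<le> s / 16" using \<open>\<delta> > 0\<close> rs by (auto simp: h_def min_def)
          have "max (2 * r) (s - h / 2) < s" using rs h by auto
          from of_rat_dense[OF this] obtain q where q: "max (2 * r) (s - h / 2) < of_rat q" "of_rat q < s" by blast
          have "s + h < s + 3 / 2 * h" using h by simp
          from of_rat_dense[OF this] obtain q' where q': "s + h < of_rat q'" "of_rat q' < s + 3 / 2 * h" by blast
          have "(\<integral>\<^sup>+t. W t * indicator {s..s+h} t \<partial>lborel) \<le> (\<integral>\<^sup>+t. W t * indicator {of_rat q..of_rat q'} t \<partial>lborel)"
            using q q' by (intro nn_integral_mono) (auto split: split_indicator)
          also have "\<dots> \<le> ennreal (8 * C) * W r * ennreal (of_rat q' - of_rat q)"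
          proof (intro win[rule_format] conjI)
            show "0 < (of_rat q :: real)" using q rs by linarith
            show "(of_rat q :: real) < of_rat q'" using q q' h by linarith
            show "of_rat q' - of_rat q \<le> (of_rat q / 4 :: real)" using q q' h rs by linarith
            show "2 * r \<le> of_rat q" using q by linarith
          qed (use rs in simp)
          also have "\<dots> \<le> ennreal (8 * C) * W r * ennreal (2 * h)"
          proof -
            have "of_rat q' - of_rat q \<le> 2 * h" using q q' by linarith
            then show ?thesis by (intro mult_left_mono ennreal_leI) auto
          qed
          also have "\<dots> = ennreal (16 * C) * W r * ennreal h"
          proof -
            have "ennreal (8 * C) * ennreal (2 * h) = ennreal (16 * C) * ennreal h"
              using C h by (simp add: ennreal_mult[symmetric])
            then have "ennreal (8 * C) * ennreal (2 * h) * W r = ennreal (16 * C) * ennreal h * W r"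
              by (rule arg_cong)
            then show ?thesis by (simp only: mult_ac)
          qed
          finally show "\<exists>h\<in>{0<..<\<delta>}. (\<integral>\<^sup>+t. W t * indicator {s..s+h} t \<partial>lborel) \<le> ennreal (16 * C) * W r * ennreal h"
            using h by auto
        qed
      qed
    qed
  qed
  have B: "AE r in lborel. 0 < r \<longrightarrow>
    (radial_integral (Suc N) W {0..r}) \<le> ennreal (C * 2 ^ Suc N) * W r * ennreal (r ^ Suc N)"
    using C A by (intro centred_A1_doubling) auto
  from almost_decreasingI[OF W _ _ _ Q B] C show ?thesis by auto
qed

section \<open>The weak type bound for centred rings\<close>

text \<open>
  Among three intervals with a common point, the one that reaches furthest to the left and the one that
  reaches furthest to the right cover the third. A subfamily of minimal size with the same union
  therefore has no three members with a common point.
\<close>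

lemma thin_subcover:
  fixes F :: "(real \<times> real) set"
  assumes "finite F"
  obtains G where "G \<subseteq> F" "(\<Union>p\<in>G. {fst p<..<snd p}) = (\<Union>p\<in>F. {fst p<..<snd p})"
    "\<And>t. card {p \<in> G. t \<in> {fst p<..<snd p}} \<le> 2"
proof -
  let ?I = "\<lambda>p::real \<times> real. {fst p<..<snd p}"
  let ?P = "\<lambda>G. G \<subseteq> F \<and> (\<Union>p\<in>G. ?I p) = (\<Union>p\<in>F. ?I p)"
  obtain G where G: "?P G" and min: "\<And>G'. ?P G' \<Longrightarrow> card G \<le> card G'"
    using ex_has_least_nat[of ?P F card] by auto
  have finG: "finite G" using G assms by (auto intro: finite_subset)
  have "card {p \<in> G. t \<in> ?I p} \<le> 2" for t
  proof (rule ccontr)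
    define S where "S = {p \<in> G. t \<in> ?I p}"
    assume "\<not> card {p \<in> G. t \<in> ?I p} \<le> 2"
    then have c: "card S > 2" by (simp add: S_def)
    have "S \<noteq> {}" using c by auto
    then have finS: "finite S" "S \<noteq> {}" using finG by (auto simp: S_def)
    have "Min (fst ` S) \<in> fst ` S" "Max (snd ` S) \<in> snd ` S"
      using finS by (auto intro!: Min_in Max_in)
    then obtain p q where p: "p \<in> S" "fst p = Min (fst ` S)" and q: "q \<in> S" "snd q = Max (snd ` S)"
      by (metis imageE)
    have p: "p \<in> S" "\<And>z. z \<in> S \<Longrightarrow> fst p \<le> fst z" and q: "q \<in> S" "\<And>z. z \<in> S \<Longrightarrow> snd z \<le> snd q"
      using p q finS by simp_all
    have "card {p, q} \<le> 2" by (simp add: card_insert_if)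
    then have "\<not> S \<subseteq> {p, q}" using c card_mono[of "{p, q}" S] by auto
    then obtain z where z: "z \<in> S" "z \<noteq> p" "z \<noteq> q" by blast
    have zG: "z \<in> G" and pG: "p \<in> G" and qG: "q \<in> G" using z p q by (auto simp: S_def)
    have "?I z \<subseteq> ?I p \<union> ?I q"
    proof
      fix y assume y: "y \<in> ?I z"
      show "y \<in> ?I p \<union> ?I q"
        using y p(2)[OF z(1)] q(2)[OF z(1)] p(1) q(1) by (cases "y \<le> t") (auto simp: S_def)
    qed
    then have "(\<Union>p\<in>G - {z}. ?I p) = (\<Union>p\<in>G. ?I p)"
      using z pG qG by blast
    then have "?P (G - {z})" using G by auto
    from min[OF this] show False
      using zG finG by (simp add: card_Diff_singleton) (metis Suc_pred card_gt_0_iff empty_iff not_less_eq_eq order_refl)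
  qed
  with G that show ?thesis by blast
qed

lemma emeasure_countable_UN_le:
  assumes I: "countable I" and A: "\<And>i. i \<in> I \<Longrightarrow> A i \<in> sets M"
    and le: "\<And>F. finite F \<Longrightarrow> F \<subseteq> I \<Longrightarrow> emeasure M (\<Union>i\<in>F. A i) \<le> B"
  shows "emeasure M (\<Union>i\<in>I. A i) \<le> B"
proof (cases "I = {}")
  case False
  define e where "e = from_nat_into I"
  have e: "range e = I" using False I by (simp add: e_def range_from_nat_into)
  have "(\<Union>i\<in>I. A i) = (\<Union>k. \<Union>i\<in>e ` {..k}. A i)" unfolding e[symmetric] by blast
  also have "emeasure M \<dots> = (SUP k. emeasure M (\<Union>i\<in>e ` {..k}. A i))"
  proof (rule SUP_emeasure_incseq[symmetric])
    show "range (\<lambda>k. \<Union>i\<in>e ` {..k}. A i) \<subseteq> sets M"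
      using A e by (auto intro!: sets.finite_UN)
    show "incseq (\<lambda>k. \<Union>i\<in>e ` {..k}. A i)"
      by (intro monoI UN_mono image_mono) auto
  qed
  also have "\<dots> \<le> B" using e by (intro SUP_least le) auto
  finally show ?thesis .
qed (use le[of "{}"] in simp)

abbreviation shell :: "nat \<Rightarrow> real \<times> real \<Rightarrow> (nat \<Rightarrow> real) set" where
  "shell n p \<equiv> {y \<in> Rn n. nrm n y \<in> {fst p<..<snd p}}"

lemma measurable_radial_leb [measurable]:
  "W \<in> borel_measurable borel \<Longrightarrow> (\<lambda>y. W (nrm n y)) \<in> borel_measurable (leb n)"
  unfolding leb_def by (intro measurable_completion measurable_compose[OF borel_measurable_nrm])

lemma interval_A1_shell:
  fixes W :: "real \<Rightarrow> ennreal"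
  assumes [measurable]: "W \<in> borel_measurable borel" and n: "0 < n"
    and A: "interval_A1 C n W" and ab: "a < b" "0 < b"
  obtains c where "AE y in leb n. y \<in> shell n (a, b) \<longrightarrow> c \<le> W (nrm n y)"
    "weighted n (\<lambda>y. W (nrm n y)) (shell n (a, b)) \<le> ennreal C * c * emeasure (leb n) (shell n (a, b))"
proof -
  let ?I = "{a<..<b} \<inter> {0..}"
  from A[unfolded interval_A1_def, THEN spec, THEN spec, THEN mp, OF ab(1), THEN mp, OF ab(2)]
  obtain c where c: "AE t in lborel. t \<in> ?I \<longrightarrow> c \<le> W t"
    and le: "(radial_integral n W ?I)
       \<le> ennreal C * c * (radial_volume n ?I)"
    by (elim exE conjE) rule
  show ?thesis
  proof (rule that)
    have "{t. t \<in> {a<..<b} \<longrightarrow> c \<le> W t} \<in> sets borel"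
    proof -
      have "Measurable.pred borel (\<lambda>t. t \<in> {a<..<b} \<longrightarrow> c \<le> W t)" by measurable
      then show ?thesis by (simp add: pred_def)
    qed
    moreover have "AE t in lborel. 0 \<le> t \<longrightarrow> t \<in> {a<..<b} \<longrightarrow> c \<le> W t"
      using c by eventually_elim auto
    ultimately have "AE y in prodleb n. nrm n y \<in> {a<..<b} \<longrightarrow> c \<le> W (nrm n y)"
      using AE_radial[OF n, of "\<lambda>t. t \<in> {a<..<b} \<longrightarrow> c \<le> W t"] by blast
    then show "AE y in leb n. y \<in> shell n (a, b) \<longrightarrow> c \<le> W (nrm n y)"
      unfolding AE_leb by eventually_elim auto
    have "weighted n (\<lambda>y. W (nrm n y)) {y \<in> Rn n. nrm n y \<in> {a<..<b}}
       = ennreal (n * vol n) * (radial_integral n W ?I)"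
      using n by (intro weighted_shell) auto
    also have "\<dots> \<le> ennreal (n * vol n) * (ennreal C * c * (radial_volume n ?I))"
      using le by (rule mult_left_mono) simp
    also have "\<dots> = ennreal C * c * (ennreal (n * vol n) * (radial_volume n ?I))"
      by (simp only: mult_ac)
    also have "ennreal (n * vol n) * (radial_volume n ?I)
        = emeasure (prodleb n) {y \<in> Rn n. nrm n y \<in> {a<..<b}}"
      using n by (intro emeasure_shell[symmetric]) auto
    also have "\<dots> = emeasure (leb n) {y \<in> Rn n. nrm n y \<in> {a<..<b}}"
      unfolding space_leb by (intro emeasure_leb[symmetric] shell_sets) auto
    finally show "weighted n (\<lambda>y. W (nrm n y)) (shell n (a, b)) \<le> ennreal C * c * emeasure (leb n) (shell n (a, b))"
      by simp
  qed
qed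

lemma emeasure_ring_Icc:
  assumes "0 < n" "0 \<le> a" "a \<le> b"
  shows "emeasure (leb n) {y \<in> Rn n. nrm n y \<in> {a..b}} = ennreal (vol n * (b ^ n - a ^ n))"
proof -
  have "emeasure (leb n) {y \<in> Rn n. nrm n y \<in> {a..b}}
      = ennreal (n * vol n) * (radial_volume n ({a..b} \<inter> {0..}))"
    unfolding space_leb
    by (subst emeasure_leb, rule shell_sets, simp, rule emeasure_shell[unfolded space_leb]) (use assms in auto)
  also have "{a..b} \<inter> {0..} = {a..b}" using assms by auto
  also have "(radial_volume n {a..b}) = ennreal ((b ^ n - a ^ n) / n)"
    using assms by (intro nn_integral_power_Icc) auto
  finally show ?thesis
    using assms by (simp add: ennreal_mult'[symmetric])
qed

text \<open>
  A ring is slightly enlarged to an open shell with rational endpoints. The integral of \<open>g\<close> can only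
  grow, and the volume grows so little that the average stays large. Passing to rational endpoints makes the
  level sets of the ring maximal function contained in a countable union.
\<close>

lemma shell_of_large_average:
  assumes n: "0 < n" and l: "0 < l" and ab: "0 \<le> a" "a \<le> nrm n x" "nrm n x \<le> b" "a < b"
    and x: "x \<in> Rn n" and av: "ennreal l < average n g (centered_ring n a b)"
  obtains q q' :: rat where "of_rat q < nrm n x" "nrm n x < of_rat q'"
    "ennreal l * emeasure (leb n) (shell n (of_rat q, of_rat q')) \<le> weighted n g (shell n (of_rat q, of_rat q'))"
proof -
  define \<phi> where "\<phi> h = l * (vol n * ((b + h) ^ n - (max 0 (a - h)) ^ n))" for h
  have v: "vol n > 0" by simp
  have ring: "centered_ring n a b = {y \<in> Rn n. nrm n y \<in> {a..b}}"
    by (auto simp: centered_ring_def)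
  have em: "emeasure (leb n) (centered_ring n a b) = ennreal (vol n * (b ^ n - a ^ n))"
    unfolding ring using n ab by (intro emeasure_ring_Icc) auto
  have "a ^ n < b ^ n" using n ab by (intro power_strict_mono) auto
  then have pos: "0 < vol n * (b ^ n - a ^ n)" using v by (intro mult_pos_pos) auto
  let ?A = "weighted n g (centered_ring n a b)"
  have "ennreal l * ennreal (vol n * (b ^ n - a ^ n)) < ?A"
  proof (rule ccontr)
    assume "\<not> ?thesis"
    then have "?A / ennreal (vol n * (b ^ n - a ^ n)) \<le> ennreal l"
      using pos by (intro divide_le_posI_ennreal) (auto simp: mult.commute)
    with av show False by (simp add: average_def em)
  qed
  then have "ennreal (\<phi> 0) < ?A"
    using l ab pos by (simp add: \<phi>_def max_def ennreal_mult)
  moreover have "((\<lambda>h. ennreal (\<phi> h)) \<longlongrightarrow> ennreal (\<phi> 0)) (at_right 0)"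
    unfolding \<phi>_def by (intro tendsto_ennrealI) (auto intro!: tendsto_eq_intros)
  ultimately have "\<forall>\<^sub>F h in at_right 0. ennreal (\<phi> h) < ?A"
    by (intro order_tendstoD(2))
  then have "\<forall>\<^sub>F h in at_right 0. ennreal (\<phi> h) < ?A \<and> 0 < h"
    using eventually_at_right_less[of "0::real"] by eventually_elim auto
  then obtain h where h: "ennreal (\<phi> h) < ?A" "0 < h"
    using eventually_happens'[OF trivial_limit_at_right_real] by blast
  obtain q where q: "a - h < of_rat q" "of_rat q < a" using of_rat_dense[of "a - h" a] h by auto
  obtain q' where q': "b < of_rat q'" "of_rat q' < b + h" using of_rat_dense[of b "b + h"] h by auto
  show ?thesis
  proof (rule that)
    show "of_rat q < nrm n x" "nrm n x < of_rat q'" using q q' ab by linarith+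
    have "emeasure (leb n) (shell n (of_rat q, of_rat q')) \<le> emeasure (leb n) {y \<in> Rn n. nrm n y \<in> {max 0 (a - h)..b + h}}"
      using q q' by (intro emeasure_mono) auto
    also have "\<dots> = ennreal (vol n * ((b + h) ^ n - (max 0 (a - h)) ^ n))"
      using n ab h by (intro emeasure_ring_Icc) auto
    finally have "ennreal l * emeasure (leb n) (shell n (of_rat q, of_rat q'))
        \<le> ennreal l * ennreal (vol n * ((b + h) ^ n - (max 0 (a - h)) ^ n))"
      by (rule mult_left_mono) simp
    also have "\<dots> = ennreal (\<phi> h)"
      using l by (simp add: \<phi>_def ennreal_mult')
    also have "\<dots> \<le> ?A" using h by simp
    also have "\<dots> \<le> weighted n g (shell n (of_rat q, of_rat q'))"
      unfolding weighted_eq ring using q q'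
      by (intro nn_integral_mono mult_left_mono) (auto split: split_indicator)
    finally show "ennreal l * emeasure (leb n) (shell n (of_rat q, of_rat q')) \<le> weighted n g (shell n (of_rat q, of_rat q'))" .
  qed
qed

text \<open>
  On a shell \<open>S\<close> with \<open>l |S| \<le> \<integral>\<^sub>S |f|\<close> the \<open>A\<^sub>1\<close> inequality gives
  \<open>l w(S) \<le> C inf\<^sub>S w \<cdot> l |S| \<le> C \<integral>\<^sub>S |f| w\<close>. Finitely many such shells may be assumed to overlap at most
  twice, which yields the factor \<open>2\<close> in the constant.
\<close>

lemma weak_type_if_interval_A1:
  fixes W :: "real \<Rightarrow> ennreal"
  assumes [measurable]: "W \<in> borel_measurable borel" and n: "0 < n" and C: "0 \<le> C"
    and A: "interval_A1 C n W" and f [measurable]: "f \<in> borel_measurable (leb n)" and l: "0 < l"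
  shows "weighted n (\<lambda>y. W (nrm n y)) {x \<in> Rn n. ring_maximal n f x > ennreal l}
    \<le> ennreal (2 * C / l) * (\<integral>\<^sup>+x. ennreal \<bar>f x\<bar> * W (nrm n x) \<partial>leb n)"
proof -
  let ?w = "\<lambda>y. W (nrm n y)"
  let ?g = "\<lambda>y. ennreal \<bar>f y\<bar>"
  let ?sh = "\<lambda>p::rat \<times> rat. shell n (of_rat (fst p), of_rat (snd p))"
  define \<nu> where "\<nu> = density (leb n) ?w"
  have sets_\<nu>: "sets \<nu> = sets (leb n)" by (simp add: \<nu>_def)
  have \<nu>: "emeasure \<nu> E = weighted n ?w E" if "E \<in> sets (leb n)" for E
    unfolding \<nu>_def weighted_def using that by (subst emeasure_density) auto
  define Q where "Q = {p. of_rat (fst p) < (of_rat (snd p) :: real) \<and> 0 < (of_rat (snd p) :: real) \<and>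
    ennreal l * emeasure (leb n) (?sh p) \<le> weighted n ?g (?sh p)}"
  have single: "ennreal l * weighted n ?w (?sh p) \<le> ennreal C * (\<integral>\<^sup>+y. ?g y * ?w y * indicator (?sh p) y \<partial>leb n)"
    if p: "p \<in> Q" for p
  proof -
    from p obtain c where c: "AE y in leb n. y \<in> ?sh p \<longrightarrow> c \<le> ?w y"
      and le: "weighted n ?w (?sh p) \<le> ennreal C * c * emeasure (leb n) (?sh p)"
      using interval_A1_shell[OF _ n A, of "of_rat (fst p)" "of_rat (snd p)"] by (auto simp: Q_def)
    have "ennreal l * weighted n ?w (?sh p) \<le> ennreal l * (ennreal C * c * emeasure (leb n) (?sh p))"
      using le by (rule mult_left_mono) simp
    also have "\<dots> = ennreal C * c * (ennreal l * emeasure (leb n) (?sh p))" by (simp only: mult_ac)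
    also have "\<dots> \<le> ennreal C * c * weighted n ?g (?sh p)"
      using p by (intro mult_left_mono) (auto simp: Q_def)
    also have "\<dots> = ennreal C * (c * weighted n ?g (?sh p))" by (simp only: mult_ac)
    also have "c * weighted n ?g (?sh p) = (\<integral>\<^sup>+y. c * (?g y * indicator (?sh p) y) \<partial>leb n)"
      unfolding weighted_def by (rule nn_integral_cmult[symmetric]) measurable
    also have "\<dots> \<le> (\<integral>\<^sup>+y. ?g y * ?w y * indicator (?sh p) y \<partial>leb n)"
    proof (intro nn_integral_mono_AE, use c in eventually_elim)
      fix y assume "y \<in> ?sh p \<longrightarrow> c \<le> ?w y"
      then have "y \<in> ?sh p \<Longrightarrow> ?g y * c \<le> ?g y * ?w y" by (intro mult_left_mono) auto
      then show "c * (?g y * indicator (?sh p) y) \<le> ?g y * ?w y * indicator (?sh p) y"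
        by (cases "y \<in> ?sh p") (simp_all add: mult.commute[of c])
    qed
    finally show ?thesis by (simp add: mult_left_mono)
  qed
  have fin: "ennreal l * emeasure \<nu> (\<Union>p\<in>F. ?sh p) \<le> ennreal (2 * C) * (\<integral>\<^sup>+x. ?g x * ?w x \<partial>leb n)"
    if F: "finite F" "F \<subseteq> Q" for F
  proof -
    let ?r = "\<lambda>p::rat \<times> rat. (of_rat (fst p) :: real, of_rat (snd p) :: real)"
    have inj: "inj ?r" by (auto simp: inj_def prod_eq_iff)
    obtain G' where G': "G' \<subseteq> ?r ` F" "(\<Union>p\<in>G'. {fst p<..<snd p}) = (\<Union>p\<in>?r ` F. {fst p<..<snd p})"
      and thin': "\<And>t. card {p \<in> G'. t \<in> {fst p<..<snd p}} \<le> 2"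
      using thin_subcover[of "?r ` F"] F by auto
    from G'(1) obtain G where G: "G \<subseteq> F" "G' = ?r ` G" by (meson subset_image_iff)
    have finG: "finite G" using G F by (auto intro: finite_subset)
    have U: "(\<Union>p\<in>F. ?sh p) = (\<Union>p\<in>G. ?sh p)"
    proof -
      have "(\<Union>p\<in>F. ?sh p) = {y \<in> Rn n. nrm n y \<in> (\<Union>p\<in>?r ` F. {fst p<..<snd p})}" by auto
      also have "\<dots> = (\<Union>p\<in>G. ?sh p)" unfolding G'(2)[symmetric] G(2) by auto
      finally show ?thesis .
    qed
    have thin: "(\<Sum>p\<in>G. indicator (?sh p) y) \<le> (2 :: ennreal)" for y
    proof -
      have "card {p \<in> G. y \<in> ?sh p} \<le> card {p \<in> G'. nrm n y \<in> {fst p<..<snd p}}"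
      proof (rule card_inj_on_le[where f="?r"])
        show "inj_on ?r {p \<in> G. y \<in> ?sh p}" using inj by (rule inj_on_subset) simp
        show "?r ` {p \<in> G. y \<in> ?sh p} \<subseteq> {p \<in> G'. nrm n y \<in> {fst p<..<snd p}}" by (auto simp: G(2))
        show "finite {p \<in> G'. nrm n y \<in> {fst p<..<snd p}}" using finG by (simp add: G(2))
      qed
      also have "\<dots> \<le> 2" by (rule thin')
      finally have c2: "card {p \<in> G. y \<in> ?sh p} \<le> 2" .
      have "(\<Sum>p\<in>G. indicator (?sh p) y) = (of_nat (card {p \<in> G. y \<in> ?sh p}) :: ennreal)"
        using finG by (simp add: indicator_def sum.If_cases Int_def)
      also have "\<dots> \<le> of_nat 2" using c2 by (rule of_nat_mono)
      finally show ?thesis by simp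
    qed
    have "emeasure \<nu> (\<Union>p\<in>G. ?sh p) \<le> (\<Sum>p\<in>G. emeasure \<nu> (?sh p))"
      using finG by (intro emeasure_subadditive_finite) (auto simp: sets_\<nu>)
    also have "\<dots> = (\<Sum>p\<in>G. weighted n ?w (?sh p))"
      by (intro sum.cong refl \<nu>) simp
    finally have "ennreal l * emeasure \<nu> (\<Union>p\<in>G. ?sh p) \<le> (\<Sum>p\<in>G. ennreal l * weighted n ?w (?sh p))"
      by (simp add: sum_distrib_left[symmetric] mult_left_mono)
    also have "\<dots> \<le> (\<Sum>p\<in>G. ennreal C * (\<integral>\<^sup>+y. ?g y * ?w y * indicator (?sh p) y \<partial>leb n))"
      using G F by (intro sum_mono single) auto
    also have "\<dots> = ennreal C * (\<integral>\<^sup>+y. (\<Sum>p\<in>G. ?g y * ?w y * indicator (?sh p) y) \<partial>leb n)"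
      by (subst nn_integral_sum) (auto simp: sum_distrib_left)
    also have "\<dots> \<le> ennreal C * (\<integral>\<^sup>+y. 2 * (?g y * ?w y) \<partial>leb n)"
    proof (intro mult_left_mono nn_integral_mono)
      fix y
      have "(\<Sum>p\<in>G. ?g y * ?w y * indicator (?sh p) y) = ?g y * ?w y * (\<Sum>p\<in>G. indicator (?sh p) y)"
        by (simp add: sum_distrib_left)
      also have "\<dots> \<le> ?g y * ?w y * 2" using thin by (rule mult_left_mono) simp
      finally show "(\<Sum>p\<in>G. ?g y * ?w y * indicator (?sh p) y) \<le> 2 * (?g y * ?w y)" by (simp add: mult.commute)
    qed simp
    also have "\<dots> = ennreal C * (2 * (\<integral>\<^sup>+y. ?g y * ?w y \<partial>leb n))"
      by (subst nn_integral_cmult) auto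
    also have "\<dots> = ennreal (2 * C) * (\<integral>\<^sup>+x. ?g x * ?w x \<partial>leb n)"
      using C by (simp add: ennreal_mult mult_ac)
    finally show ?thesis unfolding U .
  qed
  have bound: "emeasure \<nu> (\<Union>p\<in>Q. ?sh p) \<le> ennreal (2 * C / l) * (\<integral>\<^sup>+x. ?g x * ?w x \<partial>leb n)"
  proof (rule emeasure_countable_UN_le)
    fix F assume F: "finite F" "F \<subseteq> Q"
    have "ennreal l * emeasure \<nu> (\<Union>p\<in>F. ?sh p) \<le> ennreal l * (ennreal (2 * C / l) * (\<integral>\<^sup>+x. ?g x * ?w x \<partial>leb n))"
      using fin[OF F] l C by (simp add: mult.assoc[symmetric] ennreal_mult[symmetric])
    then show "emeasure \<nu> (\<Union>p\<in>F. ?sh p) \<le> ennreal (2 * C / l) * (\<integral>\<^sup>+x. ?g x * ?w x \<partial>leb n)"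
      using l by (subst (asm) ennreal_mult_le_mult_iff) auto
  qed (auto simp: sets_\<nu>)
  have sub: "{x \<in> Rn n. ring_maximal n f x > ennreal l} \<subseteq> (\<Union>p\<in>Q. ?sh p)"
  proof
    fix x assume "x \<in> {x \<in> Rn n. ring_maximal n f x > ennreal l}"
    then have x: "x \<in> Rn n" and "ennreal l < ring_maximal n f x" by auto
    then obtain a b where ab: "0 \<le> a" "a \<le> nrm n x" "nrm n x \<le> b" "a < b"
      and av: "ennreal l < average n ?g (centered_ring n a b)"
      unfolding ring_maximal_def less_SUP_iff by auto
    obtain q q' where q: "of_rat q < nrm n x" "nrm n x < of_rat q'"
      "ennreal l * emeasure (leb n) (shell n (of_rat q, of_rat q')) \<le> weighted n ?g (shell n (of_rat q, of_rat q'))"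
      using shell_of_large_average[OF n l ab x av] .
    have "of_rat q < (of_rat q' :: real)" "0 < (of_rat q' :: real)" using q nrm_nonneg[of n x] by linarith+
    then have "(q, q') \<in> Q" using q(3) by (simp add: Q_def)
    moreover have "x \<in> ?sh (q, q')" using q x by simp
    ultimately show "x \<in> (\<Union>p\<in>Q. ?sh p)" by blast
  qed
  have Um: "(\<Union>p\<in>Q. ?sh p) \<in> sets (leb n)"
    by (rule sets.countable_UN') auto
  have "weighted n ?w {x \<in> Rn n. ring_maximal n f x > ennreal l} \<le> weighted n ?w (\<Union>p\<in>Q. ?sh p)"
    unfolding weighted_def using sub by (intro nn_integral_mono mult_left_mono) (auto split: split_indicator)
  also have "\<dots> = emeasure \<nu> (\<Union>p\<in>Q. ?sh p)" using \<nu>[OF Um] by simp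
  also note bound
  finally show ?thesis .
qed

section \<open>Recovering the interval inequality from the weak type bound\<close>

text \<open>
  For \<open>d\<close> above the essential infimum of \<open>W\<close> on the interval, let \<open>E\<close> be the part of the interval where
  \<open>W < d\<close>, and test on the indicator \<open>f\<close> of \<open>{y. |y| \<in> E}\<close>. On the whole ring over the interval
  the ring maximal function of \<open>f\<close> is at least the proportion \<open>z/Y\<close> of \<open>E\<close> in the interval. The weak type
  bound at half this level gives \<open>X \<le> (2 C Y / z) d z\<close>, and then \<open>d\<close> tends to the essential infimum.
\<close>

lemma interval_A1_if_weak_type:
  fixes W :: "real \<Rightarrow> ennreal"
  assumes [measurable]: "W \<in> borel_measurable borel" and n: "0 < n" and C: "0 < C"
    and weak: "\<And>f l. radial_fun n f \<Longrightarrow> in_L1 n (\<lambda>y. W (nrm n y)) f \<Longrightarrow> 0 < l \<Longrightarrow>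
      weighted n (\<lambda>y. W (nrm n y)) {x \<in> Rn n. ring_maximal n f x > ennreal l}
        \<le> ennreal (C / l) * (\<integral>\<^sup>+x. ennreal \<bar>f x\<bar> * W (nrm n x) \<partial>leb n)"
  shows "interval_A1 (2 * C) n W"
  unfolding interval_A1_def
proof (intro allI impI)
  fix a b :: real assume ab: "a < b" "0 < b"
  let ?I = "{a<..<b} \<inter> {0..}"
  let ?w = "\<lambda>y. W (nrm n y)"
  define c where "c = essinf (restrict_space lborel ?I) W"
  define Y where "Y = (b ^ n - (max a 0) ^ n) / n"
  define X where "X = (radial_integral n W ?I)"
  have Y: "(radial_volume n ?I) = ennreal Y"
    unfolding Y_def by (rule nn_integral_power_Ioo[OF n ab])
  have Ypos: "0 < Y"
    using n ab by (auto simp: Y_def intro!: divide_pos_pos power_strict_mono)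
  have v: "vol n > 0" by simp
  have nv: "0 < n * vol n" using v n by (intro mult_pos_pos) auto
  have c: "AE t in lborel. t \<in> ?I \<longrightarrow> c \<le> W t"
    using AE_essinf[of "restrict_space lborel ?I" W] by (simp add: AE_restrict_space_iff c_def)
  have k0: "ennreal (2 * C * Y) \<noteq> 0" "ennreal (2 * C * Y) \<noteq> top"
    using C Ypos by (auto simp: ennreal_eq_0_iff not_le)
  have "X / ennreal (2 * C * Y) \<le> c"
  proof (rule dense_ge)
    fix d assume "c < d"
    show "X / ennreal (2 * C * Y) \<le> d"
    proof (cases d)
      case (real d')
      define E where "E = {t. t \<in> ?I \<and> W t < d}"
      have E_eq: "E = ?I \<inter> {t \<in> space borel. W t < d}" by (auto simp: E_def)
      have [measurable]: "E \<in> sets borel" unfolding E_eq by measurable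
      have EI: "E \<subseteq> ?I" by (auto simp: E_def)
      define Z where "Z = (radial_volume n E)"
      have Zle: "Z \<le> ennreal Y"
        unfolding Z_def Y[symmetric] using EI by (intro nn_integral_mono mult_left_mono) (auto split: split_indicator)
      have "Z \<noteq> 0"
      proof
        assume "Z = 0"
        then have "AE t in lborel. ennreal (t ^ (n - 1)) * indicator E t = 0"
          unfolding Z_def by (subst (asm) nn_integral_0_iff_AE) auto
        with AE_lborel_singleton[of "0::real"]
        have "AE t in lborel. t \<in> ?I \<longrightarrow> d \<le> W t"
        proof eventually_elim
          fix t :: real assume "ennreal (t ^ (n - 1)) * indicator E t = 0" "t \<noteq> 0"
          show "t \<in> ?I \<longrightarrow> d \<le> W t"
          proof (intro impI, rule ccontr)
            assume "t \<in> ?I" "\<not> d \<le> W t"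
            then have "t \<in> E" "0 < t" using \<open>t \<noteq> 0\<close> by (auto simp: E_def)
            with \<open>ennreal (t ^ (n - 1)) * indicator E t = 0\<close> have "t ^ (n - 1) \<le> 0"
              by (simp add: ennreal_eq_0_iff)
            with zero_less_power[OF \<open>0 < t\<close>, of "n - 1"] show False by linarith
          qed
        qed
        then have "d \<le> c"
          unfolding c_def by (intro essinf_greatest) (simp add: AE_restrict_space_iff)
        with \<open>c < d\<close> show False by simp
      qed
      then obtain z where z: "Z = ennreal z" "0 < z" "z \<le> Y"
        using Zle Ypos by (cases Z) (auto simp: top_unique ennreal_le_iff)
      define f where "f y = (if nrm n y \<in> E then 1 else 0 :: real)" for y
      have f_shell: "ennreal \<bar>f y\<bar> * g = g * indicator {y \<in> Rn n. nrm n y \<in> E} y" if "y \<in> Rn n" for y g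
        using that by (simp add: f_def split: split_indicator)
      have wE: "(\<integral>\<^sup>+y. ennreal \<bar>f y\<bar> * ?w y \<partial>leb n) = ennreal (n * vol n) * (radial_integral n W E)"
      proof -
        have "(\<integral>\<^sup>+y. ennreal \<bar>f y\<bar> * ?w y \<partial>leb n) = weighted n ?w {y \<in> Rn n. nrm n y \<in> E}"
          unfolding weighted_def by (intro nn_integral_cong f_shell)
        also have "\<dots> = ennreal (n * vol n) * (radial_integral n W (E \<inter> {0..}))"
          using n by (intro weighted_shell) auto
        also have "E \<inter> {0..} = E" using EI by auto
        finally show ?thesis .
      qed
      have WE: "(radial_integral n W E) \<le> d * Z"
      proof -
        have "(radial_integral n W E)
          \<le> (\<integral>\<^sup>+t. d * (ennreal (t ^ (n - 1)) * indicator E t) \<partial>lborel)"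
          unfolding mult.assoc
          by (intro nn_integral_mono) (auto simp: E_def intro!: mult_right_mono split: split_indicator)
        also have "\<dots> = d * Z" unfolding Z_def by (rule nn_integral_cmult) measurable
        finally show ?thesis .
      qed
      have wfin: "(\<integral>\<^sup>+y. ennreal \<bar>f y\<bar> * ?w y \<partial>leb n) \<le> ennreal (n * vol n) * (d * Z)"
        unfolding wE using WE by (rule mult_left_mono) simp
      have f_m: "f \<in> borel_measurable (leb n)"
        unfolding f_def leb_def by (intro measurable_completion) measurable
      have f_rad: "radial_fun n f" by (simp add: radial_fun_def f_def)
      have f_L1: "in_L1 n ?w f"
        unfolding in_L1_def using f_m wfin real z
        by (auto intro!: le_less_trans[OF wfin] simp: ennreal_mult_less_top)
      \<comment> \<open>Half the proportion of \<open>E\<close>, since (b) speaks about strict super-level sets.\<close>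
      define l where "l = z / (2 * Y)"
      have l: "0 < l" "l < z / Y" using z Ypos by (auto simp: l_def field_simps)
      have sub: "{y \<in> Rn n. nrm n y \<in> {a<..<b}} \<subseteq> {x \<in> Rn n. ring_maximal n f x > ennreal l}"
      proof
        fix x assume x: "x \<in> {y \<in> Rn n. nrm n y \<in> {a<..<b}}"
        let ?R = "centered_ring n (max a 0) b"
        have Req: "?R = {y \<in> Rn n. nrm n y \<in> {max a 0..b}}" by (auto simp: centered_ring_def)
        have "emeasure (leb n) ?R = ennreal (vol n * (b ^ n - (max a 0) ^ n))"
          unfolding Req using n ab by (intro emeasure_ring_Icc) auto
        also have "vol n * (b ^ n - (max a 0) ^ n) = n * vol n * Y" using n by (simp add: Y_def)
        finally have em: "emeasure (leb n) ?R = ennreal (n * vol n * Y)" .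
        have "weighted n (\<lambda>y. ennreal \<bar>f y\<bar>) ?R = weighted n (\<lambda>y. 1) {y \<in> Rn n. nrm n y \<in> E}"
          unfolding weighted_def Req using EI by (intro nn_integral_cong) (auto simp: f_def split: split_indicator)
        also have "\<dots> = ennreal (n * vol n) * (\<integral>\<^sup>+t. 1 * ennreal (t ^ (n - 1)) * indicator (E \<inter> {0..}) t \<partial>lborel)"
          using n by (intro weighted_shell[where W="\<lambda>_. 1"]) auto
        also have "(\<integral>\<^sup>+t. 1 * ennreal (t ^ (n - 1)) * indicator (E \<inter> {0..}) t \<partial>lborel) = Z"
          unfolding Z_def using EI by (intro nn_integral_cong) (auto split: split_indicator)
        also have "ennreal (n * vol n) * Z = ennreal (n * vol n * z)"
          using z nv by (simp add: ennreal_mult'')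
        finally have "average n (\<lambda>y. ennreal \<bar>f y\<bar>) ?R = ennreal (n * vol n * z) / ennreal (n * vol n * Y)"
          unfolding average_def em by simp
        also have "\<dots> = ennreal (z / Y)"
          using nv Ypos z n by (subst divide_ennreal) auto
        finally have av: "average n (\<lambda>y. ennreal \<bar>f y\<bar>) ?R = ennreal (z / Y)" .
        have "ennreal l < ennreal (z / Y)" using l by (simp add: ennreal_less_iff)
        also have "\<dots> \<le> ring_maximal n f x"
          unfolding ring_maximal_def
          by (rule SUP_upper2[of "(max a 0, b)"]) (use x ab av in auto)
        finally show "x \<in> {x \<in> Rn n. ring_maximal n f x > ennreal l}" using x by simp
      qed
      have "ennreal (n * vol n) * X = weighted n ?w {y \<in> Rn n. nrm n y \<in> {a<..<b}}"
        unfolding X_def using n by (intro weighted_shell[symmetric]) auto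
      also have "\<dots> \<le> weighted n ?w {x \<in> Rn n. ring_maximal n f x > ennreal l}"
        unfolding weighted_def using sub by (intro nn_integral_mono mult_left_mono) (auto split: split_indicator)
      also have "\<dots> \<le> ennreal (C / l) * (\<integral>\<^sup>+y. ennreal \<bar>f y\<bar> * ?w y \<partial>leb n)"
        by (rule weak[OF f_rad f_L1 l(1)])
      also have "\<dots> \<le> ennreal (C / l) * (ennreal (n * vol n) * (d * Z))"
        using wfin by (rule mult_left_mono) simp
      also have "\<dots> = ennreal (n * vol n) * (d * (ennreal (C / l) * ennreal z))"
        unfolding z(1) by (simp only: mult_ac)
      also have "ennreal (C / l) * ennreal z = ennreal (2 * C * Y)"
        using C l z Ypos by (simp add: ennreal_mult[symmetric] l_def)
      finally have "ennreal (n * vol n) * X \<le> ennreal (n * vol n) * (d * ennreal (2 * C * Y))" .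
      moreover have "ennreal (n * vol n) \<noteq> 0" unfolding ennreal_eq_0_iff using nv by linarith
      ultimately have "X \<le> d * ennreal (2 * C * Y)"
        using ennreal_mult_le_mult_iff[OF _ ennreal_neq_top] by blast
      then show ?thesis
        using k0 by (intro divide_le_posI_ennreal) (auto simp: mult.commute zero_less_iff_neq_zero)
    qed simp
  qed
  then have "X / ennreal (2 * C * Y) * ennreal (2 * C * Y) \<le> c * ennreal (2 * C * Y)"
    by (rule mult_right_mono) simp
  also have "X / ennreal (2 * C * Y) * ennreal (2 * C * Y) = X"
    using k0 by (simp add: ennreal_divide_times)
  also have "c * ennreal (2 * C * Y) = ennreal (2 * C) * c * ennreal Y"
    using C Ypos by (simp add: ennreal_mult mult_ac)
  finally have le: "X \<le> ennreal (2 * C) * c * ennreal Y" .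
  show "\<exists>c. (AE t in lborel. t \<in> ?I \<longrightarrow> c \<le> W t) \<and>
     (radial_integral n W ?I)
       \<le> ennreal (2 * C) * c * (radial_volume n ?I)"
    using c le unfolding X_def Y by blast
qed

section \<open>Almost decreasing profiles satisfy the interval inequality\<close>

lemma AE_lborel_ex_Ioo:
  assumes "AE t in lborel. P t" "a < (b::real)"
  shows "\<exists>t\<in>{a<..<b}. P t"
proof (rule ccontr)
  assume "\<not> (\<exists>t\<in>{a<..<b}. P t)"
  then have "AE t in lborel. t \<notin> {a<..<b}"
    using assms(1) by (auto elim: eventually_mono)
  then have "{a<..<b} \<in> null_sets lborel" by (subst AE_iff_null_sets) auto
  then have "emeasure lborel {a<..<b} = 0" by (rule null_setsD1)
  then show False using assms(2) by (simp add: ennreal_eq_0_iff)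
qed

lemma almost_decreasing_mono:
  assumes "almost_decreasing K W" "K \<le> K'"
  shows "almost_decreasing K' W"
proof -
  have "W s \<le> ennreal K' * W r" if "W s \<le> ennreal K * W r" for r s
    using that assms(2) by (elim order_trans) (intro mult_right_mono ennreal_leI, auto)
  then show ?thesis
    using assms(1) unfolding almost_decreasing_def by (auto elim!: eventually_mono)
qed

text \<open>
  \<open>V r\<close> is the essential supremum of \<open>W\<close> over \<open>[r, \<infinity>)\<close>. The hypothesis says \<open>V (r/2) \<le> K W r\<close> for almost
  every \<open>r\<close>. The comparisons with \<open>W t\<close> use \<open>V (t/2)\<close> instead of \<open>V t\<close> since \<open>W t \<le> V (t/2)\<close> can be
  obtained from countably many values of \<open>V\<close>.
\<close>

lemma decreasing_majorant:
  fixes W :: "real \<Rightarrow> ennreal"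
  assumes [measurable]: "W \<in> borel_measurable borel" and K: "1 \<le> K" and T: "almost_decreasing K W"
  shows "\<exists>V. antimono V \<and> (\<forall>t>0. V t \<le> ennreal (K ^ 2) * V (2 * t)) \<and>
    (AE t in lborel. 0 < t \<longrightarrow> W t \<le> V (t / 2)) \<and> (AE t in lborel. 0 < t \<longrightarrow> V (t / 2) \<le> ennreal K * W t)"
proof -
  define V where "V r = esssup (restrict_space lborel {r..}) W" for r
  have V1: "AE s in lborel. r \<le> s \<longrightarrow> W s \<le> V r" for r
    using esssup_AE[where M="restrict_space lborel {r..}" and f=W] by (simp add: AE_restrict_space_iff V_def)
  have V2: "V r \<le> c" if "AE s in lborel. r \<le> s \<longrightarrow> W s \<le> c" for r c
    unfolding V_def using that
    by (intro esssup_I) (simp_all add: AE_restrict_space_iff measurable_restrict_space1)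
  have mono: "antimono V"
  proof (rule antimonoI)
    fix r r' :: real assume "r \<le> r'"
    show "V r' \<le> V r"
      by (rule V2, use V1[of r] in eventually_elim) (use \<open>r \<le> r'\<close> in auto)
  qed
  have low: "AE t in lborel. 0 < t \<longrightarrow> V (t / 2) \<le> ennreal K * W t"
    using T unfolding almost_decreasing_def by eventually_elim (auto intro!: V2)
  have step: "V t \<le> ennreal K * V (3 / 2 * t)" if "0 < t" for t
  proof -
    have "AE s in lborel. (0 < s \<longrightarrow> V (s / 2) \<le> ennreal K * W s) \<and> (3 / 2 * t \<le> s \<longrightarrow> W s \<le> V (3 / 2 * t))"
      using low V1[of "3 / 2 * t"] by eventually_elim auto
    from AE_lborel_ex_Ioo[OF this, of "3 / 2 * t" "2 * t"] that
    obtain s where s: "s \<in> {3 / 2 * t<..<2 * t}"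
      and ss: "(0 < s \<longrightarrow> V (s / 2) \<le> ennreal K * W s) \<and> (3 / 2 * t \<le> s \<longrightarrow> W s \<le> V (3 / 2 * t))"
      by (elim meta_impE bexE) auto
    have "V t \<le> V (s / 2)" using s by (intro antimonoD[OF mono]) auto
    also have "\<dots> \<le> ennreal K * W s" using ss s that by auto
    also have "\<dots> \<le> ennreal K * V (3 / 2 * t)" using ss s by (intro mult_left_mono) auto
    finally show ?thesis .
  qed
  have dbl: "V t \<le> ennreal (K ^ 2) * V (2 * t)" if "0 < t" for t
  proof -
    have "V t \<le> ennreal K * V (3 / 2 * t)" using that by (rule step)
    also have "\<dots> \<le> ennreal K * (ennreal K * V (3 / 2 * (3 / 2 * t)))"
      using that by (intro mult_left_mono step) auto
    also have "\<dots> \<le> ennreal K * (ennreal K * V (2 * t))"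
      using that by (intro mult_left_mono antimonoD[OF mono]) auto
    also have "\<dots> = ennreal (K ^ 2) * V (2 * t)"
      using K by (simp add: power2_eq_square ennreal_mult mult.assoc)
    finally show ?thesis .
  qed
  have "AE t in lborel. \<forall>q::rat. of_rat q \<le> t \<longrightarrow> W t \<le> V (of_rat q)"
    using V1 by (simp add: AE_all_countable)
  then have up: "AE t in lborel. 0 < t \<longrightarrow> W t \<le> V (t / 2)"
  proof (eventually_elim, intro impI)
    fix t :: real assume q: "\<forall>q::rat. of_rat q \<le> t \<longrightarrow> W t \<le> V (of_rat q)" and "0 < t"
    then obtain q where "t / 2 < of_rat q" "of_rat q < t" using of_rat_dense[of "t / 2" t] by auto
    with q have "W t \<le> V (of_rat q)" by auto
    also have "\<dots> \<le> V (t / 2)" using \<open>t / 2 < of_rat q\<close> by (intro antimonoD[OF mono]) auto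
    finally show "W t \<le> V (t / 2)" .
  qed
  show ?thesis using mono dbl up low by blast
qed

text \<open>
  Iterating the doubling of the decreasing majorant \<open>V\<close> gives \<open>W t \<le> 4\<^sup>p (b/t)\<^sup>p V b\<close> for \<open>t < b\<close>, where
  \<open>4\<^sup>p\<close> accounts for rounding \<open>2 b/t\<close> up to a power of two. On the other side \<open>V b \<le> K W t\<close> almost
  everywhere on the interval. With \<open>m = n - p\<close> it remains to compare \<open>b\<^sup>p (b\<^sup>m - a\<^sup>m) / m\<close> with
  \<open>(b\<^sup>n - a\<^sup>n) / n\<close>.
\<close>

lemma interval_A1_if_almost_decreasing:
  fixes W :: "real \<Rightarrow> ennreal"
  assumes [measurable]: "W \<in> borel_measurable borel" and K: "1 \<le> K" and T: "almost_decreasing K W"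
    and p: "K ^ 2 \<le> 2 ^ p" and n: "2 * p < n"
  shows "interval_A1 (2 * 4 ^ p * K) n W"
  unfolding interval_A1_def
proof (intro allI impI)
  fix a b :: real assume ab: "a < b" "0 < b"
  obtain V where mono: "antimono V" and dbl: "\<And>t. 0 < t \<Longrightarrow> V t \<le> ennreal (K ^ 2) * V (2 * t)"
    and up: "AE t in lborel. 0 < t \<longrightarrow> W t \<le> V (t / 2)"
    and low: "AE t in lborel. 0 < t \<longrightarrow> V (t / 2) \<le> ennreal K * W t"
    using decreasing_majorant[OF assms(1) K T] by blast
  have iter: "V t \<le> ennreal (2 ^ (p * k)) * V (2 ^ k * t)" if "0 < t" for t k
  proof (induction k)
    case (Suc k)
    have "V t \<le> ennreal (2 ^ (p * k)) * V (2 ^ k * t)" by (rule Suc)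
    also have "\<dots> \<le> ennreal (2 ^ (p * k)) * (ennreal (2 ^ p) * V (2 * (2 ^ k * t)))"
    proof (intro mult_left_mono)
      have "V (2 ^ k * t) \<le> ennreal (K ^ 2) * V (2 * (2 ^ k * t))" using that by (intro dbl) auto
      also have "\<dots> \<le> ennreal (2 ^ p) * V (2 * (2 ^ k * t))" using p by (intro mult_right_mono ennreal_leI) auto
      finally show "V (2 ^ k * t) \<le> ennreal (2 ^ p) * V (2 * (2 ^ k * t))" .
    qed simp
    also have "\<dots> = ennreal (2 ^ (p * Suc k)) * V (2 ^ Suc k * t)"
      by (simp add: power_add ennreal_mult mult_ac)
    finally show ?case .
  qed simp
  have decay: "V (t / 2) \<le> ennreal (4 ^ p * (b / t) ^ p) * V b" if t: "0 < t" "t < b" for t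
  proof -
    obtain m :: nat where m: "2 * b / t < 2 ^ m" using real_arch_pow[of 2 "2 * b / t"] by auto
    \<comment> \<open>The least \<open>k\<close> doublings that carry \<open>t/2\<close> beyond \<open>b\<close>; minimality gives \<open>2\<^sup>k \<le> 4 b/t\<close>.\<close>
    define k where "k = (LEAST m. 2 * b / t < 2 ^ m)"
    have k: "2 * b / t < 2 ^ k" unfolding k_def by (rule LeastI) (rule m)
    have "k \<noteq> 0"
    proof
      assume "k = 0"
      then show False using k t by (simp add: field_simps)
    qed
    then have "\<not> 2 * b / t < 2 ^ (k - 1)" unfolding k_def by (intro not_less_Least) auto
    moreover have "(2::real) ^ k = 2 * 2 ^ (k - 1)" using \<open>k \<noteq> 0\<close> by (simp add: power_eq_if)
    ultimately have k2: "2 ^ k \<le> 4 * (b / t)" by simp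
    have "V (t / 2) \<le> ennreal (2 ^ (p * k)) * V (2 ^ k * (t / 2))" using t by (intro iter) auto
    also have "\<dots> \<le> ennreal (4 ^ p * (b / t) ^ p) * V b"
    proof (intro mult_mono ennreal_leI antimonoD[OF mono])
      have "(2 ^ k) ^ p \<le> (4 * (b / t)) ^ p" using k2 by (intro power_mono) auto
      also have "(4 * (b / t)) ^ p = 4 ^ p * (b / t) ^ p" by (rule power_mult_distrib)
      also have "((2::real) ^ k) ^ p = 2 ^ (p * k)" by (simp only: power_mult[symmetric] mult.commute[of k p])
      finally show "2 ^ (p * k) \<le> 4 ^ p * (b / t) ^ p" .
      show "b \<le> 2 ^ k * (t / 2)" using k t by (simp add: field_simps)
    qed auto
    finally show ?thesis .
  qed
  let ?I = "{a<..<b} \<inter> {0..}"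
  define c where "c = ennreal (1 / K) * V b"
  have lower: "AE t in lborel. t \<in> ?I \<longrightarrow> c \<le> W t"
    using low AE_lborel_singleton[of "0::real"]
  proof (eventually_elim, intro impI)
    fix t assume t: "0 < t \<longrightarrow> V (t / 2) \<le> ennreal K * W t" "t \<noteq> 0" "t \<in> ?I"
    have "V b \<le> V (t / 2)" using t by (intro antimonoD[OF mono]) auto
    also have "\<dots> \<le> ennreal K * W t" using t by auto
    finally have "c \<le> ennreal (1 / K) * (ennreal K * W t)" unfolding c_def by (rule mult_left_mono) simp
    also have "\<dots> = W t" using K by (simp add: mult.assoc[symmetric] ennreal_mult[symmetric])
    finally show "c \<le> W t" .
  qed
  define m where "m = n - p"
  have m: "0 < m" "n = m + p" "2 * m \<ge> n" using n by (auto simp: m_def)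
  have "(radial_integral n W ?I)
      \<le> (\<integral>\<^sup>+t. ennreal (4 ^ p * b ^ p) * V b * (ennreal (t ^ (m - 1)) * indicator ?I t) \<partial>lborel)"
  proof (rule nn_integral_mono_AE, use up AE_lborel_singleton[of "0::real"] in eventually_elim)
    fix t assume t: "0 < t \<longrightarrow> W t \<le> V (t / 2)" "t \<noteq> 0"
    show "W t * ennreal (t ^ (n - 1)) * indicator ?I t
        \<le> ennreal (4 ^ p * b ^ p) * V b * (ennreal (t ^ (m - 1)) * indicator ?I t)"
    proof (cases "t \<in> ?I")
      case True
      then have tb: "0 < t" "t < b" using t by auto
      have "W t * ennreal (t ^ (n - 1)) \<le> ennreal (4 ^ p * (b / t) ^ p) * V b * ennreal (t ^ (n - 1))"
        using t tb by (intro mult_right_mono order_trans[OF _ decay]) auto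
      also have "\<dots> = ennreal (4 ^ p * (b / t) ^ p * t ^ (n - 1)) * V b"
        using tb ab by (simp add: ennreal_mult mult_ac)
      also have "4 ^ p * (b / t) ^ p * t ^ (n - 1) = 4 ^ p * b ^ p * t ^ (m - 1)"
      proof -
        have "n - 1 = p + (m - 1)" using m by simp
        then have "t ^ (n - 1) = t ^ p * t ^ (m - 1)" by (simp only: power_add)
        then show ?thesis using tb by (simp add: power_divide)
      qed
      also have "ennreal (4 ^ p * b ^ p * t ^ (m - 1)) * V b = ennreal (4 ^ p * b ^ p) * V b * ennreal (t ^ (m - 1))"
        using tb ab by (simp add: ennreal_mult mult_ac)
      finally show ?thesis using True by simp
    qed simp
  qed
  also have "\<dots> = ennreal (4 ^ p * b ^ p) * V b * (radial_volume m ?I)"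
    by (rule nn_integral_cmult) measurable
  also have "\<dots> = ennreal (4 ^ p * b ^ p) * V b * ennreal ((b ^ m - (max a 0) ^ m) / m)"
    using nn_integral_power_Ioo[OF m(1) ab] by simp
  also have "\<dots> = V b * ennreal (4 ^ p * (b ^ p * ((b ^ m - (max a 0) ^ m) / m)))"
  proof -
    have "0 \<le> (b ^ m - (max a 0) ^ m) / m" using ab by (auto intro!: divide_nonneg_nonneg power_mono)
    then show ?thesis using ab by (simp add: ennreal_mult[symmetric] mult_ac)
  qed
  also have "\<dots> \<le> V b * ennreal (4 ^ p * (2 * ((b ^ n - (max a 0) ^ n) / n)))"
  proof (intro mult_left_mono ennreal_leI)
    have a0: "0 \<le> max a 0" "max a 0 \<le> b" using ab by auto
    have "(max a 0) ^ n = (max a 0) ^ p * (max a 0) ^ m" using m by (simp add: power_add mult.commute)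
    also have "\<dots> \<le> b ^ p * (max a 0) ^ m" using a0 by (intro mult_right_mono power_mono) auto
    finally have "b ^ p * (b ^ m - (max a 0) ^ m) \<le> b ^ n - (max a 0) ^ n"
      using m by (simp add: power_add algebra_simps)
    moreover have "0 \<le> b ^ n - (max a 0) ^ n" using a0 by (simp add: power_mono)
    moreover have "1 / m \<le> 2 / n" using m by (simp add: field_simps)
    ultimately have "b ^ p * (b ^ m - (max a 0) ^ m) * (1 / m) \<le> (b ^ n - (max a 0) ^ n) * (2 / n)"
      by (intro mult_mono) auto
    then show "b ^ p * ((b ^ m - (max a 0) ^ m) / m) \<le> 2 * ((b ^ n - (max a 0) ^ n) / n)"
      by (simp add: mult.commute)
  qed auto
  also have "\<dots> = ennreal (2 * 4 ^ p * K) * c * ennreal ((b ^ n - (max a 0) ^ n) / n)"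
  proof -
    define Y where "Y = (b ^ n - (max a 0) ^ n) / n"
    have Y: "0 \<le> Y" using ab by (auto simp: Y_def intro!: divide_nonneg_nonneg power_mono)
    have "ennreal (2 * 4 ^ p * K) * c * ennreal Y = V b * (ennreal (2 * 4 ^ p * K) * ennreal (1 / K) * ennreal Y)"
      unfolding c_def by (simp only: mult_ac)
    also have "ennreal (2 * 4 ^ p * K) * ennreal (1 / K) * ennreal Y = ennreal (4 ^ p * (2 * Y))"
      using K Y by (simp add: ennreal_mult[symmetric] del: ennreal_1)
    finally show ?thesis unfolding Y_def by simp
  qed
  also have "ennreal ((b ^ n - (max a 0) ^ n) / n) = (radial_volume n ?I)"
    using n by (intro nn_integral_power_Ioo[OF _ ab, symmetric]) auto
  finally show "\<exists>c. (AE t in lborel. t \<in> ?I \<longrightarrow> c \<le> W t) \<and>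
     (radial_integral n W ?I)
       \<le> ennreal (2 * 4 ^ p * K) * c * (radial_volume n ?I)"
    using lower by blast
qed

section \<open>From almost every centre to every ball\<close>

lemma ex_rational_point_near:
  assumes "0 < \<delta>"
  shows "\<exists>q\<in>{..<n} \<rightarrow>\<^sub>E (UNIV :: rat set). nrm n (\<lambda>i. x i - of_rat (q i)) < \<delta>"
proof -
  define d where "d = \<delta> / (n + 1)"
  have d: "0 < d" using assms by (simp add: d_def)
  have "\<exists>q. x i < real_of_rat q \<and> real_of_rat q < x i + d" for i
    using of_rat_dense[of "x i" "x i + d"] d by auto
  then obtain q where q: "\<And>i. x i < of_rat (q i)" "\<And>i. of_rat (q i) < x i + d" by metis
  have "nrm n (\<lambda>i. x i - of_rat (restrict q {..<n} i)) \<le> (\<Sum>i<n. \<bar>x i - of_rat (restrict q {..<n} i)\<bar>)"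
    unfolding nrm_def by (rule L2_set_le_sum_abs)
  also have "\<dots> \<le> (\<Sum>i<n. d)"
  proof (intro sum_mono)
    fix i assume "i \<in> {..<n}"
    then show "\<bar>x i - of_rat (restrict q {..<n} i)\<bar> \<le> d"
      using q(1)[of i] q(2)[of i] by (simp add: abs_le_iff)
  qed
  also have "\<dots> = n * d" by simp
  also have "\<dots> < (n + 1) * d" using d by (intro mult_strict_right_mono) auto
  also have "\<dots> = \<delta>" by (simp add: d_def)
  finally show ?thesis by (intro bexI[of _ "restrict q {..<n}"]) auto
qed

lemma countable_dense_good:
  assumes n: "0 < n" and P: "AE x in prodleb n. P x"
  shows "\<exists>D. countable D \<and> (\<forall>y\<in>D. P y) \<and> (\<forall>x. \<forall>\<delta>>0. \<exists>y\<in>D. nrm n (\<lambda>i. x i - y i) < \<delta>)"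
proof -
  define T where "T = ({..<n} \<rightarrow>\<^sub>E (UNIV :: rat set)) \<times> (UNIV :: nat set)"
  have T: "countable T" unfolding T_def by (rule countable_SIGMA) (auto intro: countable_PiE)
  have "\<exists>y. P y \<and> y \<in> nball n (\<lambda>i. of_rat (q i)) (1 / Suc k)" for q :: "nat \<Rightarrow> rat" and k
  proof (rule ccontr)
    let ?B = "nball n (\<lambda>i. of_rat (q i)) (1 / Suc k)"
    assume "\<not> ?thesis"
    then have "AE x in prodleb n. x \<notin> ?B" using P by (auto elim: eventually_mono)
    then have "?B \<in> null_sets (prodleb n)" by (subst AE_iff_null_sets) auto
    then have "emeasure (prodleb n) ?B = 0" by (rule null_setsD1)
    moreover have "emeasure (prodleb n) ?B = ennreal (vol n * (1 / Suc k) ^ n)"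
      by (rule emeasure_nball[OF n]) simp
    ultimately have "ennreal (vol n * (1 / Suc k) ^ n) = 0" by (simp only:)
    moreover have "0 < vol n * (1 / Suc k) ^ n" by (intro mult_pos_pos) auto
    ultimately show False unfolding ennreal_eq_0_iff by linarith
  qed
  then obtain g where g: "\<And>q k. P (g q k)" "\<And>q k. g q k \<in> nball n (\<lambda>i. of_rat (q i)) (1 / Suc k)"
    by metis
  show ?thesis
  proof (intro exI[of _ "case_prod g ` T"] conjI allI impI)
    show "countable (case_prod g ` T)" using T by (rule countable_image)
    show "\<forall>y\<in>case_prod g ` T. P y" using g(1) by auto
    fix x :: "nat \<Rightarrow> real" and \<delta> :: real assume "0 < \<delta>"
    obtain k where k: "1 / Suc k < \<delta> / 2" using nat_approx_posE[of "\<delta> / 2"] \<open>0 < \<delta>\<close> by auto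
    obtain q where q: "q \<in> {..<n} \<rightarrow>\<^sub>E (UNIV :: rat set)" "nrm n (\<lambda>i. x i - of_rat (q i)) < \<delta> / 2"
      using ex_rational_point_near[of "\<delta> / 2" n x] \<open>0 < \<delta>\<close> by auto
    have "nrm n (\<lambda>i. x i - g q k i) = nrm n (\<lambda>i. (x i - of_rat (q i)) + (of_rat (q i) - g q k i))" by simp
    also have "\<dots> \<le> nrm n (\<lambda>i. x i - of_rat (q i)) + nrm n (\<lambda>i. of_rat (q i) - g q k i)"
      by (rule nrm_triangle)
    also have "nrm n (\<lambda>i. of_rat (q i) - g q k i) < \<delta> / 2"
      using g(2)[of q k] k by (subst nrm_minus_commute) (simp add: nball_def)
    finally have "nrm n (\<lambda>i. x i - g q k i) < \<delta>" using q(2) by linarith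
    then show "\<exists>y\<in>case_prod g ` T. nrm n (\<lambda>i. x i - y i) < \<delta>"
      using q(1) by (intro bexI[of _ "g q k"]) (auto simp: T_def intro!: image_eqI[of _ _ "(q, k)"])
  qed
qed

text \<open>
  For each good centre the exceptional set of points \<open>y\<close> is null, but good centres are uncountably many.
  Restricting them to a countable dense set, and the radii to rationals, leaves a single null set. Every ball
  around a remaining point is contained in slightly larger balls of the countable family.
\<close>

lemma centred_A1_if_ball_A1:
  fixes W :: "real \<Rightarrow> ennreal"
  assumes n: "0 < n" and C: "0 \<le> C"
    and A: "AE x in prodleb n. \<forall>R>0. AE y in prodleb n. y \<in> nball n x R \<longrightarrow>
      weighted n (\<lambda>y. W (nrm n y)) (nball n x R) \<le> ennreal C * W (nrm n y) * ennreal (vol n * R ^ n)"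
  shows "centred_A1 C n W"
proof -
  let ?w = "\<lambda>y. W (nrm n y)"
  from countable_dense_good[OF n A]
  obtain D where D: "countable D"
    and good: "\<forall>z\<in>D. \<forall>R>0. AE y in prodleb n. y \<in> nball n z R \<longrightarrow>
      weighted n ?w (nball n z R) \<le> ennreal C * ?w y * ennreal (vol n * R ^ n)"
    and dense: "\<forall>x. \<forall>\<delta>>0. \<exists>y\<in>D. nrm n (\<lambda>i. x i - y i) < \<delta>"
    by (elim exE conjE) rule
  have "AE y in prodleb n. \<forall>z\<in>D. \<forall>q\<in>{q. 0 < (of_rat q :: real)}. y \<in> nball n z (of_rat q) \<longrightarrow>
      weighted n ?w (nball n z (of_rat q)) \<le> ennreal C * ?w y * ennreal (vol n * of_rat q ^ n)"
  proof (intro AE_ball_countable[THEN iffD2] ballI D)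
    show "countable {q. 0 < (of_rat q :: real)}" by (rule countableI_type)
    fix z q assume "z \<in> D" "q \<in> {q. 0 < (of_rat q :: real)}"
    then show "AE y in prodleb n. y \<in> nball n z (of_rat q) \<longrightarrow>
      weighted n ?w (nball n z (of_rat q)) \<le> ennreal C * ?w y * ennreal (vol n * of_rat q ^ n)"
      using good[rule_format, of z "of_rat q"] by (simp only: mem_Collect_eq)
  qed
  moreover have "AE y in prodleb n. y \<in> space (prodleb n)" by (rule AE_space)
  ultimately show ?thesis
    unfolding centred_A1_def
  proof eventually_elim
    fix x
    assume x: "\<forall>z\<in>D. \<forall>q\<in>{q. 0 < (of_rat q :: real)}. x \<in> nball n z (of_rat q) \<longrightarrow>
      weighted n ?w (nball n z (of_rat q)) \<le> ennreal C * ?w x * ennreal (vol n * of_rat q ^ n)"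
      and sp: "x \<in> space (prodleb n)"
    show "\<forall>R>0. weighted n ?w (nball n x R) \<le> ennreal C * ?w x * ennreal (vol n * R ^ n)"
    proof (intro allI impI)
      fix R :: real assume R: "0 < R"
      have bound: "weighted n ?w (nball n x R) \<le> ennreal C * ?w x * ennreal (vol n * R' ^ n)" if R': "R < R'" for R'
      proof -
        obtain q where q: "R < of_rat q" "of_rat q < R'" using of_rat_dense[OF R'] by blast
        have "0 < min (of_rat q - R) (of_rat q)" using q R by auto
        from dense[rule_format, OF this, of x] obtain z where z: "z \<in> D" "nrm n (\<lambda>i. x i - z i) < min (of_rat q - R) (of_rat q)"
          by blast
        have sub: "nball n x R \<subseteq> nball n z (of_rat q)"
        proof
          fix y assume y: "y \<in> nball n x R"
          have "nrm n (\<lambda>i. y i - z i) = nrm n (\<lambda>i. (y i - x i) + (x i - z i))" by simp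
          also have "\<dots> \<le> nrm n (\<lambda>i. y i - x i) + nrm n (\<lambda>i. x i - z i)" by (rule nrm_triangle)
          also have "\<dots> < of_rat q" using y z by (auto simp: nball_def)
          finally show "y \<in> nball n z (of_rat q)" using y by (simp add: nball_def)
        qed
        have "weighted n ?w (nball n x R) \<le> weighted n ?w (nball n z (of_rat q))"
          unfolding weighted_def using sub by (intro nn_integral_mono mult_left_mono) (auto split: split_indicator)
        also have "\<dots> \<le> ennreal C * ?w x * ennreal (vol n * of_rat q ^ n)"
        proof (intro x[rule_format] z)
          show "q \<in> {q. 0 < (of_rat q :: real)}" using q R by (simp only: mem_Collect_eq)
          show "x \<in> nball n z (of_rat q)" using z sp by (simp add: nball_def space_leb)
        qed
        also have "\<dots> \<le> ennreal C * ?w x * ennreal (vol n * R' ^ n)"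
        proof -
          have "(of_rat q) ^ n \<le> R' ^ n"
            using q R by (intro power_mono) linarith+
          then show ?thesis by (intro mult_left_mono ennreal_leI) auto
        qed
        finally show ?thesis .
      qed
      show "weighted n ?w (nball n x R) \<le> ennreal C * ?w x * ennreal (vol n * R ^ n)"
      proof (cases "ennreal C * ?w x = top")
        case True
        have "0 < vol n * R ^ n" using R by (intro mult_pos_pos) auto
        then have "ennreal (vol n * R ^ n) \<noteq> 0" unfolding ennreal_eq_0_iff by linarith
        with True show ?thesis by simp
      next
        case False
        have "((\<lambda>R'. ennreal (vol n * R' ^ n)) \<longlongrightarrow> ennreal (vol n * R ^ n)) (at_right R)"
          by (intro tendsto_ennrealI) (auto intro!: tendsto_eq_intros)
        then have "((\<lambda>R'. ennreal C * ?w x * ennreal (vol n * R' ^ n)) \<longlongrightarrow> ennreal C * ?w x * ennreal (vol n * R ^ n)) (at_right R)"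
          using False by (intro ennreal_tendsto_cmult) (simp_all add: top.not_eq_extremum)
        then show ?thesis
        proof (rule tendsto_lowerbound)
          show "\<forall>\<^sub>F R' in at_right R. weighted n ?w (nball n x R) \<le> ennreal C * ?w x * ennreal (vol n * R' ^ n)"
            using eventually_at_right_less[of R] by eventually_elim (rule bound)
        qed simp
      qed
    qed
  qed
qed

section \<open>Borel representatives of the profile\<close>

definition represents :: "(real \<Rightarrow> ennreal) \<Rightarrow> (real \<Rightarrow> ennreal) \<Rightarrow> bool" where
  "represents W w0 \<longleftrightarrow> W \<in> borel_measurable borel \<and> (\<forall>t. W t < \<infinity>) \<and>
    (\<forall>a b. 0 < a \<longrightarrow> (\<integral>\<^sup>+t. W t * indicator {a..b} t \<partial>lborel) < \<infinity>) \<and>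
    (AE t in lborel. 0 \<le> t \<longrightarrow> w0 t = W t)"

text \<open>
  Local integrability in one dimension \<open>n\<close> means that \<open>w0 t \<cdot> t\<^bsup>n-1\<^esup>\<close> is integrable over bounded intervals.
  This makes the profile finite almost everywhere and locally integrable away from \<open>0\<close>.
\<close>

lemma radial_weight_representation:
  assumes "radial_weight w0"
  shows "\<exists>W. represents W w0"
proof -
  from assms have m: "w0 \<in> borel_measurable (lebesgue_on {0..})" and
    "\<exists>n0. \<forall>n\<ge>n0. locally_integrable n (\<lambda>x. w0 (nrm n x))" by (auto simp: radial_weight_def)
  then obtain n0 where n0: "\<And>n. n \<ge> n0 \<Longrightarrow> locally_integrable n (\<lambda>x. w0 (nrm n x))" by blast
  define n where "n = Suc n0"
  have n: "0 < n" by (simp add: n_def)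
  have li: "locally_integrable n (\<lambda>x. w0 (nrm n x))" using n0[of n] by (simp add: n_def)
  have "(\<lambda>t. if t \<in> {0..} then w0 t else 0) \<in> borel_measurable lebesgue"
    using m by (subst measurable_restrict_space_iff[symmetric]) auto
  from completion_ex_borel_measurable[OF this] obtain g where g [measurable]: "g \<in> borel_measurable borel"
    and geq: "AE t in lborel. (if t \<in> {0..} then w0 t else 0) = g t" by auto
  have geq': "AE t in lborel. 0 \<le> t \<longrightarrow> w0 t = g t" using geq by eventually_elim auto
  have J: "(radial_integral n g ({..<R} \<inter> {0..})) < \<infinity>" if "0 < R" for R
  proof -
    \<comment> \<open>The origin has to be extensional to be a point of \<open>Rn n\<close>.\<close>
    define z where "z = (\<lambda>i\<in>{..<n}. 0::real)"
    have z: "z \<in> Rn n" by (simp add: z_def Rn_eq)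
    have "nrm n (\<lambda>i. y i - z i) = nrm n y" for y
      unfolding nrm_def by (rule L2_set_cong) (auto simp: z_def)
    then have B: "{y \<in> Rn n. nrm n y \<in> {..<R}} = nball n z R" by (auto simp: nball_def)
    have "ennreal (n * vol n) * (radial_integral n g ({..<R} \<inter> {0..}))
        = weighted n (\<lambda>y. g (nrm n y)) {y \<in> Rn n. nrm n y \<in> {..<R}}"
      using n by (intro weighted_shell[symmetric]) auto
    also have "\<dots> = weighted n (\<lambda>y. w0 (nrm n y)) (nball n z R)"
      unfolding B weighted_eq
      by (rule nn_integral_cong_AE) (use AE_radial_I[OF n geq'] in eventually_elim, simp)
    also have "\<dots> < \<infinity>" using li z that by (auto simp: locally_integrable_def)
    finally have fin: "ennreal (n * vol n) * (radial_integral n g ({..<R} \<inter> {0..})) < \<infinity>" .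
    have "0 < n * vol n" using n by (intro mult_pos_pos) auto
    then have "ennreal (n * vol n) \<noteq> 0" unfolding ennreal_eq_0_iff by linarith
    with fin show ?thesis by (auto simp: ennreal_mult_less_top)
  qed
  have "AE t in lborel. \<forall>k::nat. g t * ennreal (t ^ (n - 1)) * indicator ({..<real (Suc k)} \<inter> {0..}) t \<noteq> \<infinity>"
    unfolding AE_all_countable
  proof
    fix k :: nat
    show "AE t in lborel. g t * ennreal (t ^ (n - 1)) * indicator ({..<real (Suc k)} \<inter> {0..}) t \<noteq> \<infinity>"
      using J[of "real (Suc k)"] by (intro nn_integral_noteq_infinite) auto
  qed
  then have gfin: "AE t in lborel. 0 \<le> t \<longrightarrow> g t < \<infinity>"
    using AE_lborel_singleton[of "0::real"]
  proof (eventually_elim, intro impI)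
    fix t :: real
    assume f: "\<forall>k::nat. g t * ennreal (t ^ (n - 1)) * indicator ({..<real (Suc k)} \<inter> {0..}) t \<noteq> \<infinity>"
      and t: "t \<noteq> 0" "0 \<le> t"
    obtain k :: nat where "t < k" using reals_Archimedean2 by blast
    then have "t \<in> {..<real (Suc k)} \<inter> {0..}" using t by auto
    with f have "g t * ennreal (t ^ (n - 1)) \<noteq> \<infinity>" by (metis indicator_simps(1) mult.right_neutral)
    moreover have "0 < t ^ (n - 1)" using t by (intro zero_less_power) auto
    then have "ennreal (t ^ (n - 1)) \<noteq> 0" unfolding ennreal_eq_0_iff by linarith
    ultimately show "g t < \<infinity>" by (auto simp: ennreal_mult_eq_top_iff less_top)
  qed
  define W where "W t = (if g t < \<infinity> then g t else 0)" for t
  have Wm: "W \<in> borel_measurable borel" unfolding W_def by measurable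
  have Wg: "W t \<le> g t" for t by (simp add: W_def)
  have loc: "(\<integral>\<^sup>+t. W t * indicator {a..b} t \<partial>lborel) < \<infinity>" if "0 < a" for a b
  proof -
    have "0 < a ^ (n - 1)" using that by (intro zero_less_power) auto
    then have a0: "ennreal (a ^ (n - 1)) \<noteq> 0" unfolding ennreal_eq_0_iff by linarith
    have "ennreal (a ^ (n - 1)) * (\<integral>\<^sup>+t. W t * indicator {a..b} t \<partial>lborel)
        = (\<integral>\<^sup>+t. ennreal (a ^ (n - 1)) * (W t * indicator {a..b} t) \<partial>lborel)"
      using Wm by (intro nn_integral_cmult[symmetric]) auto
    also have "\<dots> \<le> (radial_integral n g ({..<\<bar>b\<bar> + 1} \<inter> {0..}))"
    proof (rule nn_integral_mono)
      fix t :: real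
      have "a \<le> t \<Longrightarrow> ennreal (a ^ (n - 1)) * W t \<le> ennreal (t ^ (n - 1)) * g t"
        using that Wg by (intro mult_mono ennreal_leI power_mono) auto
      then show "ennreal (a ^ (n - 1)) * (W t * indicator {a..b} t)
          \<le> g t * ennreal (t ^ (n - 1)) * indicator ({..<\<bar>b\<bar> + 1} \<inter> {0..}) t"
        using that by (auto simp: mult.commute split: split_indicator)
    qed
    also have "\<dots> < \<infinity>" by (rule J) simp
    finally show ?thesis using a0 by (auto simp: ennreal_mult_less_top)
  qed
  have "AE t in lborel. 0 \<le> t \<longrightarrow> w0 t = W t"
    using geq' gfin by eventually_elim (auto simp: W_def)
  then have "represents W w0"
    using Wm loc by (auto simp: represents_def W_def)
  then show ?thesis by blast
qed

lemma AE_represents: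
  assumes "represents W w0" "0 < n"
  shows "AE y in prodleb n. w0 (nrm n y) = W (nrm n y)"
  using assms by (intro AE_radial_I) (auto simp: represents_def)

lemma weighted_represents:
  assumes "represents W w0" "0 < n"
  shows "weighted n (\<lambda>x. w0 (nrm n x)) E = weighted n (\<lambda>x. W (nrm n x)) E"
  unfolding weighted_eq
  by (rule nn_integral_cong_AE, use AE_represents[OF assms] in eventually_elim) simp

section \<open>The three families of constants\<close>

text \<open>
  A finite bound for one of the constants yields an admissible real constant. The
  increase by one leaves room for an infimum that is only approached.
\<close>

lemma INF_ennreal_witness:
  fixes P :: "real \<Rightarrow> bool"
  assumes le: "(INF C\<in>{C::real. 0 \<le> C \<and> P C}. ennreal C) \<le> ennreal K"
    and mono: "\<And>C D. 0 \<le> C \<Longrightarrow> C \<le> D \<Longrightarrow> P C \<Longrightarrow> P D"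
  shows "P (max K 0 + 1)"
proof -
  have "(INF C\<in>{C::real. 0 \<le> C \<and> P C}. ennreal C) \<le> ennreal (max K 0)"
    using le by (rule order_trans) (simp add: ennreal_leI)
  also have "\<dots> < ennreal (max K 0 + 1)" by (intro ennreal_lessI) auto
  finally obtain C where "0 \<le> C" "P C" "ennreal C < ennreal (max K 0 + 1)"
    by (auto simp: INF_less_iff)
  then have "0 \<le> C" "C \<le> max K 0 + 1" "P C"
    by (auto simp: ennreal_less_iff simp del: ennreal_plus)
  then show ?thesis by (rule mono)
qed

lemma weighted_nball_le:
  assumes "0 < n" "0 < R" "average n g (nball n x R) \<le> z"
  shows "weighted n g (nball n x R) \<le> z * ennreal (vol n * R ^ n)"
proof -
  have "0 < vol n * R ^ n" using assms by (intro mult_pos_pos) auto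
  then have e: "ennreal (vol n * R ^ n) \<noteq> 0" unfolding ennreal_eq_0_iff by linarith
  have "weighted n g (nball n x R) = weighted n g (nball n x R) / ennreal (vol n * R ^ n) * ennreal (vol n * R ^ n)"
    using e by (simp add: ennreal_divide_times)
  also have "\<dots> \<le> z * ennreal (vol n * R ^ n)"
    using assms by (intro mult_right_mono) (auto simp: average_def emeasure_leb_nball)
  finally show ?thesis .
qed

lemma centred_A1_if_A1_star_const:
  assumes W: "represents W w0" and n: "0 < n"
    and K: "A1_star_const n (\<lambda>x. w0 (nrm n x)) \<le> ennreal K"
  shows "centred_A1 (max K 0 + 1) n W"
proof -
  define C where "C = max K 0 + 1"
  let ?w = "\<lambda>x. w0 (nrm n x)"
  have "AE x in leb n. maximal n ?w x \<le> ennreal C * ?w x"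
    unfolding C_def
  proof (rule INF_ennreal_witness[OF K[unfolded A1_star_const_def]])
    fix C D :: real
    assume "0 \<le> C" "C \<le> D" and *: "AE x in leb n. maximal n ?w x \<le> ennreal C * ?w x"
    then have "ennreal C * ?w x \<le> ennreal D * ?w x" for x by (intro mult_right_mono ennreal_leI) auto
    from * show "AE x in leb n. maximal n ?w x \<le> ennreal D * ?w x"
      by eventually_elim (erule order_trans, fact)
  qed
  then show ?thesis
    unfolding centred_A1_def AE_leb C_def[symmetric] using AE_represents[OF W n]
  proof eventually_elim
    fix x
    assume x: "maximal n ?w x \<le> ennreal C * ?w x" and eq: "?w x = W (nrm n x)"
    show "\<forall>R>0. weighted n (\<lambda>y. W (nrm n y)) (nball n x R) \<le> ennreal C * W (nrm n x) * ennreal (vol n * R ^ n)"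
    proof (intro allI impI)
      fix R :: real assume R: "0 < R"
      have "average n ?w (nball n x R) \<le> maximal n ?w x"
        unfolding maximal_def using R by (intro SUP_upper) auto
      with x eq have "average n ?w (nball n x R) \<le> ennreal C * W (nrm n x)" by auto
      from weighted_nball_le[OF n R this]
      show "weighted n (\<lambda>y. W (nrm n y)) (nball n x R) \<le> ennreal C * W (nrm n x) * ennreal (vol n * R ^ n)"
        by (simp only: weighted_represents[OF W n])
    qed
  qed
qed

lemma centred_A1_if_A1_const:
  assumes W: "represents W w0" and n: "0 < n"
    and K: "A1_const n (\<lambda>x. w0 (nrm n x)) \<le> ennreal K"
  shows "centred_A1 (max K 0 + 1) n W"
proof -
  define C where "C = max K 0 + 1"
  let ?w = "\<lambda>x. w0 (nrm n x)"
  let ?e = "\<lambda>x R. essinf (restrict_space (leb n) (nball n x R)) ?w"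
  have A: "AE x in leb n. \<forall>R>0. average n ?w (nball n x R) \<le> ennreal C * ?e x R"
    unfolding C_def
  proof (rule INF_ennreal_witness[OF K[unfolded A1_const_def]])
    fix C D :: real
    assume "0 \<le> C" "C \<le> D" and *: "AE x in leb n. \<forall>R>0. average n ?w (nball n x R) \<le> ennreal C * ?e x R"
    then have "ennreal C * ?e x R \<le> ennreal D * ?e x R" for x R by (intro mult_right_mono ennreal_leI) auto
    note mono = this
    from * show "AE x in leb n. \<forall>R>0. average n ?w (nball n x R) \<le> ennreal D * ?e x R"
      by eventually_elim (use order_trans[OF _ mono] in blast)
  qed
  have C: "0 \<le> C" by (simp add: C_def)
  show ?thesis
    unfolding C_def[symmetric]
  proof (rule centred_A1_if_ball_A1[OF n C], use A[unfolded AE_leb] in eventually_elim, intro allI impI)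
    fix x and R :: real
    assume x: "\<forall>R>0. average n ?w (nball n x R) \<le> ennreal C * ?e x R" and R: "0 < R"
    have le: "weighted n ?w (nball n x R) \<le> ennreal C * ?e x R * ennreal (vol n * R ^ n)"
      using x R by (intro weighted_nball_le n) auto
    have "AE y in leb n. y \<in> nball n x R \<longrightarrow> ?e x R \<le> ?w y"
      using AE_essinf[of "restrict_space (leb n) (nball n x R)" ?w]
      by (simp add: AE_restrict_space_iff sets_leb sets.Int)
    then show "AE y in prodleb n. y \<in> nball n x R \<longrightarrow>
      weighted n (\<lambda>y. W (nrm n y)) (nball n x R) \<le> ennreal C * W (nrm n y) * ennreal (vol n * R ^ n)"
      unfolding AE_leb using AE_represents[OF W n]
    proof (eventually_elim, intro impI)
      fix y assume y: "y \<in> nball n x R \<longrightarrow> ?e x R \<le> ?w y" "?w y = W (nrm n y)" "y \<in> nball n x R"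
      have "ennreal C * ?e x R * ennreal (vol n * R ^ n) \<le> ennreal C * W (nrm n y) * ennreal (vol n * R ^ n)"
        using y by (intro mult_left_mono mult_right_mono) auto
      with le show "weighted n (\<lambda>y. W (nrm n y)) (nball n x R) \<le> ennreal C * W (nrm n y) * ennreal (vol n * R ^ n)"
        unfolding weighted_represents[OF W n] by (rule order_trans)
    qed
  qed
qed

lemma interval_A1_if_A1_radial_const:
  assumes W: "represents W w0" and n: "0 < n" and K: "A1_radial_const n w0 \<le> ennreal K"
  shows "interval_A1 (max K 0 + 1) n W"
  unfolding interval_A1_def
proof (intro allI impI)
  fix a b :: real assume ab: "a < b" "0 < b"
  define C where "C = max K 0 + 1"
  let ?J = "{a<..<b} \<inter> {0..}"
  let ?P = "\<lambda>C. \<forall>I. is_interval I \<and> bounded I \<and> I \<subseteq> {0..} \<and> emeasure lebesgue I > 0 \<longrightarrow>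
        (\<integral>\<^sup>+t\<in>I. w0 t * ennreal (t ^ (n - 1)) \<partial>lebesgue) / (\<integral>\<^sup>+t\<in>I. ennreal (t ^ (n - 1)) \<partial>lebesgue)
        \<le> ennreal C * essinf (lebesgue_on I) w0"
  have P: "?P C"
    unfolding C_def
  proof (rule INF_ennreal_witness[OF K[unfolded A1_radial_const_def]])
    fix C D :: real
    assume "0 \<le> C" "C \<le> D" and *: "?P C"
    then have mono: "ennreal C * x \<le> ennreal D * x" for x by (intro mult_right_mono ennreal_leI) auto
    show "?P D"
    proof (intro allI impI)
      fix I :: "real set" assume "is_interval I \<and> bounded I \<and> I \<subseteq> {0..} \<and> emeasure lebesgue I > 0"
      from *[THEN spec, THEN mp, OF this]
      show "(\<integral>\<^sup>+t\<in>I. w0 t * ennreal (t ^ (n - 1)) \<partial>lebesgue) / (\<integral>\<^sup>+t\<in>I. ennreal (t ^ (n - 1)) \<partial>lebesgue)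
        \<le> ennreal D * essinf (lebesgue_on I) w0"
        by (rule order_trans) (rule mono)
    qed
  qed
  have J: "is_interval ?J" "bounded ?J" "?J \<subseteq> {0..}"
    by (auto simp: is_interval_1 intro: bounded_subset[of "{a..b}"])
  have "{max a 0<..<b} \<subseteq> ?J" by auto
  then have "emeasure lborel {max a 0<..<b} \<le> emeasure lborel ?J" by (rule emeasure_mono) simp
  moreover have "emeasure lborel {max a 0<..<b} = ennreal (b - max a 0)" using ab by simp
  moreover have "0 < ennreal (b - max a 0)" using ab by simp
  ultimately have "emeasure lborel ?J > 0" by (simp only: order_less_le_trans)
  then have Jpos: "emeasure lebesgue ?J > 0" by simp
  define c where "c = essinf (lebesgue_on ?J) w0"
  define Y where "Y = (b ^ n - (max a 0) ^ n) / n"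
  have Ypos: "0 < Y"
    using n ab by (auto simp: Y_def intro!: divide_pos_pos power_strict_mono)
  have Y: "(radial_volume n ?J) = ennreal Y"
    unfolding Y_def by (rule nn_integral_power_Ioo[OF n ab])
  have eq: "AE t in lborel. 0 \<le> t \<longrightarrow> w0 t = W t" using W by (simp add: represents_def)
  have X: "(radial_integral n w0 ?J) = (radial_integral n W ?J)"
    by (rule nn_integral_cong_AE, use eq in eventually_elim) (auto split: split_indicator)
  have "AE t in lebesgue. t \<in> ?J \<longrightarrow> c \<le> w0 t"
    using AE_essinf[of "lebesgue_on ?J" w0] by (simp add: AE_restrict_space_iff c_def)
  then have "AE t in lborel. t \<in> ?J \<longrightarrow> c \<le> w0 t" by (simp only: AE_completion_iff)
  then have c: "AE t in lborel. t \<in> ?J \<longrightarrow> c \<le> W t" using eq by eventually_elim auto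
  have "(radial_integral n W ?J) / ennreal Y \<le> ennreal C * c"
    using P[THEN spec, THEN mp, OF conjI[OF J(1) conjI[OF J(2) conjI[OF J(3) Jpos]]]]
    unfolding nn_integral_completion X Y c_def .
  then have "(radial_integral n W ?J) / ennreal Y * ennreal Y \<le> ennreal C * c * ennreal Y"
    by (rule mult_right_mono) simp
  moreover have "x / ennreal Y * ennreal Y = x" for x
    using Ypos by (simp add: ennreal_divide_times)
  ultimately show "\<exists>c. (AE t in lborel. t \<in> ?J \<longrightarrow> c \<le> W t) \<and>
     (radial_integral n W ?J)
       \<le> ennreal (max K 0 + 1) * c * (radial_volume n ?J)"
    using c unfolding Y C_def by (intro exI[of _ c] conjI) (simp_all only:)
qed

lemma interval_up_to_endpoints:
  fixes I :: "real set"
  assumes I: "is_interval I" "bounded I" "emeasure lebesgue I > 0"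
  obtains a b where "a < b" "{a<..<b} \<subseteq> I" "I \<subseteq> {a..b}"
proof -
  have ne: "I \<noteq> {}" using I(3) by auto
  have bd: "bdd_below I" "bdd_above I" using I(2) by (auto intro: bounded_imp_bdd_below bounded_imp_bdd_above)
  have sub: "I \<subseteq> {Inf I..Sup I}" using bd by (auto intro: cInf_lower cSup_upper)
  have "{Inf I<..<Sup I} \<subseteq> I"
  proof
    fix t assume t: "t \<in> {Inf I<..<Sup I}"
    then obtain x y where "x \<in> I" "x < t" "y \<in> I" "t < y"
      using cInf_less_iff[OF ne bd(1)] less_cSup_iff[OF ne bd(2)] by auto
    then show "t \<in> I" using I(1) by (meson is_interval_1 less_imp_le)
  qed
  moreover have "Inf I < Sup I"
  proof (rule ccontr)
    assume "\<not> Inf I < Sup I"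
    with sub have "I \<subseteq> {Inf I}" by auto
    then have "emeasure lebesgue I \<le> emeasure lebesgue {Inf I}" by (intro emeasure_mono) auto
    with I(3) show False by simp
  qed
  ultimately show ?thesis using sub that by blast
qed

lemma A1_radial_const_le:
  assumes W: "represents W w0" and n: "0 < n" and C: "0 \<le> C" and A: "interval_A1 C n W"
  shows "A1_radial_const n w0 \<le> ennreal C"
  unfolding A1_radial_const_def
proof (rule INF_lower, safe)
  show "0 \<le> C" by (rule C)
  fix I :: "real set" assume I: "is_interval I" "bounded I" "I \<subseteq> {0..}" "emeasure lebesgue I > 0"
  obtain a b where ab: "a < b" and sub: "{a<..<b} \<subseteq> I" "I \<subseteq> {a..b}"
    using interval_up_to_endpoints[OF I(1,2,4)] .
  have a0: "0 \<le> a"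
  proof (rule ccontr)
    assume "\<not> 0 \<le> a"
    then have "(a + min b 0) / 2 \<in> {a<..<b}" "(a + min b 0) / 2 < 0" using ab by (auto simp: min_def)
    then show False using sub I(3) by fastforce
  qed
  then have b0: "0 < b" using ab by simp
  let ?J = "{a<..<b} \<inter> {0..}"
  have J: "?J = {a<..<b}" using a0 by auto
  have "AE t in lborel. t \<noteq> a \<and> t \<noteq> b"
    using AE_lborel_singleton[of a] AE_lborel_singleton[of b] by eventually_elim auto
  then have "AE t in lborel. t \<in> I \<longleftrightarrow> t \<in> {a<..<b}"
    by eventually_elim (use sub in fastforce)
  then have IJ: "AE t in lborel. t \<in> I \<longleftrightarrow> t \<in> ?J" unfolding J .
  have eq: "AE t in lborel. 0 \<le> t \<longrightarrow> w0 t = W t" using W by (simp add: represents_def)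
  have Isets: "I \<in> sets lebesgue"
  proof -
    have "I = ?J \<union> (I \<inter> {a, b})" unfolding J using sub by fastforce
    moreover have "finite (I \<inter> {a, b})" by simp
    then have "I \<inter> {a, b} \<in> sets borel" by (rule borel_closed[OF finite_imp_closed])
    then have "?J \<union> (I \<inter> {a, b}) \<in> sets borel" by (intro sets.Un) auto
    ultimately have "I \<in> sets borel" by simp
    then show ?thesis by simp
  qed
  from A[unfolded interval_A1_def, THEN spec, THEN spec, THEN mp, OF ab, THEN mp, OF b0]
  obtain c where c: "AE t in lborel. t \<in> ?J \<longrightarrow> c \<le> W t"
    and le: "(radial_integral n W ?J)
       \<le> ennreal C * c * (radial_volume n ?J)"
    by (elim exE conjE) rule
  have "AE t in lborel. t \<in> I \<longrightarrow> c \<le> w0 t" using c IJ eq by eventually_elim auto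
  then have "AE t in lebesgue. t \<in> I \<longrightarrow> c \<le> w0 t" by (simp only: AE_completion_iff)
  then have "c \<le> essinf (lebesgue_on I) w0"
    using Isets by (intro essinf_greatest) (simp add: AE_restrict_space_iff)
  then have cc: "ennreal C * c \<le> ennreal C * essinf (lebesgue_on I) w0" by (rule mult_left_mono) simp
  have X: "(radial_integral n w0 I) = (radial_integral n W ?J)"
    by (rule nn_integral_cong_AE, use eq IJ in eventually_elim) (auto split: split_indicator)
  have Y: "(radial_volume n I) = (radial_volume n ?J)"
    by (rule nn_integral_cong_AE, use IJ in eventually_elim) (auto split: split_indicator)
  have "0 < (b ^ n - (max a 0) ^ n) / n"
    using n ab b0 a0 by (auto intro!: divide_pos_pos power_strict_mono)
  then have Ypos: "0 < (radial_volume n ?J)"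
    by (simp only: nn_integral_power_Ioo[OF n ab b0] ennreal_less_zero_iff)
  show "(\<integral>\<^sup>+t\<in>I. w0 t * ennreal (t ^ (n - 1)) \<partial>lebesgue) / (\<integral>\<^sup>+t\<in>I. ennreal (t ^ (n - 1)) \<partial>lebesgue)
        \<le> ennreal C * essinf (lebesgue_on I) w0"
    unfolding nn_integral_completion X Y
    using Ypos
  proof (rule divide_le_posI_ennreal)
    show "(radial_integral n W ?J)
      \<le> (radial_volume n ?J) * (ennreal C * essinf (lebesgue_on I) w0)"
      using order_trans[OF le mult_right_mono[OF cc]] by (simp add: mult.commute)
  qed
qed

section \<open>The pointwise condition on the profile\<close>

lemma AE_lborel_fst_snd:
  fixes Q :: "real \<Rightarrow> bool"
  assumes "AE x in lborel. Q x"
  shows "AE p in lborel \<Otimes>\<^sub>M lborel. Q (fst p) \<and> Q (snd p)"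
proof -
  obtain N where N: "N \<in> null_sets lborel" "{t \<in> space lborel. \<not> Q t} \<subseteq> N"
    using assms unfolding eventually_ae_filter by auto
  have [measurable]: "N \<in> sets borel" using N by auto
  have n: "AE t in lborel. t \<notin> N" by (rule AE_not_in[OF N(1)])
  have "AE p in lborel \<Otimes>\<^sub>M lborel. fst p \<notin> N \<and> snd p \<notin> N"
  proof (rule lborel_pair.AE_pair_measure)
    show "{p \<in> space (lborel \<Otimes>\<^sub>M lborel). fst p \<notin> N \<and> snd p \<notin> N} \<in> sets (lborel \<Otimes>\<^sub>M lborel)" by measurable
    show "AE x in lborel. AE y in lborel. fst (x, y) \<notin> N \<and> snd (x, y) \<notin> N"
      using n by (auto elim!: eventually_mono)
  qed
  then show ?thesis
  proof eventually_elim
    fix p :: "real \<times> real" assume "fst p \<notin> N \<and> snd p \<notin> N"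
    then show "Q (fst p) \<and> Q (snd p)" using subsetD[OF N(2), of "fst p"] subsetD[OF N(2), of "snd p"] by auto
  qed
qed

text \<open>
  For \<open>r/2 < s < r\<close> there is a rational \<open>q\<close> with \<open>r/2 < q < s\<close>, and then both \<open>r\<close> and \<open>s\<close> lie in \<open>[q, 2q]\<close>.
  Thus countably many dyadic intervals suffice, and one null set serves all of them.
\<close>

lemma almost_decreasing_if_profile_condition:
  assumes W: "represents W w0"
    and dyadic: "\<forall>R>0. esssup (lebesgue_on {R..2*R}) w0 \<le> ennreal \<beta> * essinf (lebesgue_on {R..2*R}) w0"
    and decr: "AE (s, t) in (lebesgue :: (real \<times> real) measure). s \<ge> t \<and> t \<ge> 0 \<longrightarrow> w0 s \<le> ennreal \<eta> * w0 t"
  shows "almost_decreasing (max \<beta> \<eta>) W"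
proof -
  have Wm [measurable]: "W \<in> borel_measurable borel" using W by (simp add: represents_def)
  have eq: "AE t in lborel. 0 \<le> t \<longrightarrow> w0 t = W t" using W by (simp add: represents_def)
  have beta: "ennreal \<beta> * x \<le> ennreal (max \<beta> \<eta>) * x" "ennreal \<eta> * x \<le> ennreal (max \<beta> \<eta>) * x" for x
    by (intro mult_right_mono ennreal_leI; simp)+
  define S where "S R = esssup (lebesgue_on {R..2*R}) w0" for R
  define J where "J R = essinf (lebesgue_on {R..2*R}) w0" for R
  have SJ: "AE t in lborel. t \<in> {R..2*R} \<longrightarrow> J R \<le> w0 t \<and> w0 t \<le> S R" for R
  proof -
    have "AE t in lebesgue. t \<in> {R..2*R} \<longrightarrow> J R \<le> w0 t"
      using AE_essinf[of "lebesgue_on {R..2*R}" w0] unfolding J_def by (subst (asm) AE_restrict_space_iff) auto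
    moreover have "AE t in lebesgue. t \<in> {R..2*R} \<longrightarrow> w0 t \<le> S R"
      using esssup_AE[where M="lebesgue_on {R..2*R}" and f=w0] unfolding S_def by (subst (asm) AE_restrict_space_iff) auto
    ultimately have "AE t in lebesgue. t \<in> {R..2*R} \<longrightarrow> J R \<le> w0 t \<and> w0 t \<le> S R"
      by eventually_elim auto
    then show ?thesis by (simp only: AE_completion_iff)
  qed
  have "AE t in lborel. \<forall>q::rat. t \<in> {of_rat q..2 * of_rat q} \<longrightarrow> J (of_rat q) \<le> w0 t \<and> w0 t \<le> S (of_rat q)"
    unfolding AE_all_countable using SJ by blast
  then have good: "AE t in lborel. 0 < t \<longrightarrow> (\<forall>q::rat. t \<in> {of_rat q..2 * of_rat q} \<longrightarrow> J (of_rat q) \<le> W t \<and> W t \<le> S (of_rat q))"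
    using eq by eventually_elim auto
  have "AE p in lborel \<Otimes>\<^sub>M lborel. case p of (s, t) \<Rightarrow> s \<ge> t \<and> t \<ge> 0 \<longrightarrow> w0 s \<le> ennreal \<eta> * w0 t"
    using decr by (simp only: AE_completion_iff lborel_prod)
  then have "AE p in lborel \<Otimes>\<^sub>M lborel. 0 < snd p \<and> 1 * snd p \<le> fst p \<longrightarrow> W (fst p) \<le> ennreal \<eta> * W (snd p)"
    using AE_lborel_fst_snd[OF eq] by eventually_elim auto
  from lborel_pair.AE_pair[OF this]
  have sr: "AE s in lborel. AE t in lborel. 0 < t \<and> 1 * t \<le> s \<longrightarrow> W s \<le> ennreal \<eta> * W t"
    unfolding fst_conv snd_conv .
  have decr': "AE t in lborel. AE s in lborel. 0 < t \<and> 1 * t \<le> s \<longrightarrow> W s \<le> ennreal \<eta> * W t"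
    by (rule iffD2[OF almost_decreasing_commute[OF Wm] sr])
  show ?thesis
    unfolding almost_decreasing_def using decr' good
  proof eventually_elim
    fix r
    assume d: "AE s in lborel. 0 < r \<and> 1 * r \<le> s \<longrightarrow> W s \<le> ennreal \<eta> * W r"
      and r: "0 < r \<longrightarrow> (\<forall>q::rat. r \<in> {of_rat q..2 * of_rat q} \<longrightarrow> J (of_rat q) \<le> W r \<and> W r \<le> S (of_rat q))"
    from d good AE_lborel_singleton[of "r / 2"]
    show "AE s in lborel. 0 < r \<and> r / 2 \<le> s \<longrightarrow> W s \<le> ennreal (max \<beta> \<eta>) * W r"
    proof (eventually_elim, intro impI)
      fix s
      assume d: "0 < r \<and> 1 * r \<le> s \<longrightarrow> W s \<le> ennreal \<eta> * W r"
        and s: "0 < s \<longrightarrow> (\<forall>q::rat. s \<in> {of_rat q..2 * of_rat q} \<longrightarrow> J (of_rat q) \<le> W s \<and> W s \<le> S (of_rat q))"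
        and ne: "s \<noteq> r / 2" and rs: "0 < r \<and> r / 2 \<le> s"
      show "W s \<le> ennreal (max \<beta> \<eta>) * W r"
      proof (cases "r \<le> s")
        case True
        then show ?thesis using d rs by (intro order_trans[OF _ beta(2)]) auto
      next
        case False
        from rs ne have "r / 2 < s" by auto
        from of_rat_dense[OF this] obtain q where q: "r / 2 < of_rat q" "of_rat q < s" by blast
        have q0: "0 < (of_rat q :: real)" using q rs by linarith
        have sI: "s \<in> {of_rat q..2 * of_rat q}" and rI: "r \<in> {of_rat q..2 * of_rat q}"
          using q False by (simp_all only: atLeastAtMost_iff) linarith+
        have "W s \<le> S (of_rat q)" using s sI rs by auto
        also have "\<dots> \<le> ennreal \<beta> * J (of_rat q)" using dyadic q0 by (simp only: S_def J_def)
        also have "\<dots> \<le> ennreal \<beta> * W r" using r rI rs by (intro mult_left_mono) auto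
        also have "\<dots> \<le> ennreal (max \<beta> \<eta>) * W r" by (rule beta)
        finally show ?thesis .
      qed
    qed
  qed
qed

lemma sets_almost_decreasing:
  fixes W :: "real \<Rightarrow> ennreal"
  assumes W: "W \<in> borel_measurable borel"
  shows "{p \<in> space (lborel \<Otimes>\<^sub>M lborel). 0 < snd p \<and> c * snd p \<le> fst p \<longrightarrow> W (fst p) \<le> K * W (snd p)}
    \<in> sets (lborel \<Otimes>\<^sub>M lborel)"
proof -
  have f: "fst \<in> borel_measurable (lborel \<Otimes>\<^sub>M lborel :: (real \<times> real) measure)"
    using measurable_fst[of lborel lborel] by (simp only: measurable_lborel1)
  have s: "snd \<in> borel_measurable (lborel \<Otimes>\<^sub>M lborel :: (real \<times> real) measure)"
    using measurable_snd[of lborel lborel] by (simp only: measurable_lborel1)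
  show ?thesis
    using f s measurable_compose[OF f W] measurable_compose[OF s W]
    by (intro sets.sets_Collect_imp sets.sets_Collect_conj borel_measurable_le borel_measurable_less
      borel_measurable_times borel_measurable_const borel_measurable_times_ennreal) assumption+
qed

lemma profile_condition_if_almost_decreasing:
  assumes W: "represents W w0" and w0: "w0 \<in> borel_measurable (lebesgue_on {0..})"
    and K: "1 \<le> K" and T: "almost_decreasing K W"
  shows "\<forall>R>0. esssup (lebesgue_on {R..2*R}) w0 \<le> ennreal K * essinf (lebesgue_on {R..2*R}) w0"
    and "AE (s, t) in (lebesgue :: (real \<times> real) measure). s \<ge> t \<and> t \<ge> 0 \<longrightarrow> w0 s \<le> ennreal K * w0 t"
proof -
  have Wm [measurable]: "W \<in> borel_measurable borel" using W by (simp add: represents_def)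
  have eq: "AE t in lborel. 0 \<le> t \<longrightarrow> w0 t = W t" using W by (simp add: represents_def)
  show "\<forall>R>0. esssup (lebesgue_on {R..2*R}) w0 \<le> ennreal K * essinf (lebesgue_on {R..2*R}) w0"
  proof (intro allI impI)
    fix R :: real assume R: "0 < R"
    let ?M = "lebesgue_on {R..2*R}"
    have AE_M: "(AE t in ?M. P t) \<longleftrightarrow> (AE t in lborel. t \<in> {R..2*R} \<longrightarrow> P t)" for P
      by (subst AE_restrict_space_iff) (auto simp: AE_completion_iff)
    have "restrict_space (lebesgue_on {0..}) {R..2*R} = ?M"
      using R by (subst restrict_restrict_space) (auto simp: Int_absorb1)
    then have wm: "w0 \<in> borel_measurable ?M" using measurable_restrict_space1[OF w0, of "{R..2*R}"] by simp
    define S where "S = esssup ?M w0"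
    have "AE r in lborel. r \<in> {R..2*R} \<longrightarrow> S \<le> ennreal K * w0 r"
      using T[unfolded almost_decreasing_def] eq
    proof (eventually_elim, intro impI)
      fix r assume r: "AE s in lborel. 0 < r \<and> r / 2 \<le> s \<longrightarrow> W s \<le> ennreal K * W r"
        and e: "0 \<le> r \<longrightarrow> w0 r = W r" and rI: "r \<in> {R..2*R}"
      have "AE s in lborel. s \<in> {R..2*R} \<longrightarrow> w0 s \<le> ennreal K * w0 r"
        using r eq by eventually_elim (use e rI R in auto)
      then show "S \<le> ennreal K * w0 r" unfolding S_def by (intro esssup_I[OF wm] AE_M[THEN iffD2])
    qed
    then have "AE r in lborel. r \<in> {R..2*R} \<longrightarrow> ennreal (1 / K) * S \<le> w0 r"
    proof (eventually_elim, intro impI)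
      fix r assume "r \<in> {R..2*R} \<longrightarrow> S \<le> ennreal K * w0 r" "r \<in> {R..2*R}"
      then have "ennreal (1 / K) * S \<le> ennreal (1 / K) * (ennreal K * w0 r)" by (intro mult_left_mono) auto
      also have "\<dots> = w0 r" using K by (simp add: mult.assoc[symmetric] ennreal_mult[symmetric])
      finally show "ennreal (1 / K) * S \<le> w0 r" .
    qed
    then have "ennreal (1 / K) * S \<le> essinf ?M w0"
      by (intro essinf_greatest AE_M[THEN iffD2])
    then have "ennreal K * (ennreal (1 / K) * S) \<le> ennreal K * essinf ?M w0" by (rule mult_left_mono) simp
    moreover have "ennreal K * (ennreal (1 / K) * S) = S"
      using K by (simp add: mult.assoc[symmetric] ennreal_mult[symmetric])
    ultimately show "esssup ?M w0 \<le> ennreal K * essinf ?M w0" by (simp add: S_def)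
  qed
  have half: "1 / 2 * r = r / 2" for r :: real by simp
  have T': "AE r in lborel. AE s in lborel. 0 < r \<and> 1 / 2 * r \<le> s \<longrightarrow> W s \<le> ennreal K * W r"
    unfolding half by (rule T[unfolded almost_decreasing_def])
  have sr: "AE s in lborel. AE r in lborel. 0 < r \<and> 1 / 2 * r \<le> s \<longrightarrow> W s \<le> ennreal K * W r"
    using almost_decreasing_commute[OF Wm, of "1 / 2" "ennreal K"] T' by (rule iffD1)
  have "AE p in lborel \<Otimes>\<^sub>M lborel. 0 < snd p \<and> 1 / 2 * snd p \<le> fst p \<longrightarrow> W (fst p) \<le> ennreal K * W (snd p)"
  proof (rule lborel_pair.AE_pair_measure)
    show "{p \<in> space (lborel \<Otimes>\<^sub>M lborel). 0 < snd p \<and> 1 / 2 * snd p \<le> fst p \<longrightarrow> W (fst p) \<le> ennreal K * W (snd p)}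
        \<in> sets (lborel \<Otimes>\<^sub>M lborel)" by (rule sets_almost_decreasing[OF Wm])
    show "AE x in lborel. AE y in lborel. 0 < snd (x, y) \<and> 1 / 2 * snd (x, y) \<le> fst (x, y) \<longrightarrow> W (fst (x, y)) \<le> ennreal K * W (snd (x, y))"
      unfolding fst_conv snd_conv by (rule sr)
  qed
  then have "AE p in lborel \<Otimes>\<^sub>M lborel. case p of (s, t) \<Rightarrow> s \<ge> t \<and> t \<ge> 0 \<longrightarrow> w0 s \<le> ennreal K * w0 t"
    using AE_lborel_fst_snd[OF eq] AE_lborel_fst_snd[OF AE_lborel_singleton[of "0::real"]]
  proof eventually_elim
    fix p :: "real \<times> real"
    assume p: "0 < snd p \<and> 1 / 2 * snd p \<le> fst p \<longrightarrow> W (fst p) \<le> ennreal K * W (snd p)"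
      "(0 \<le> fst p \<longrightarrow> w0 (fst p) = W (fst p)) \<and> (0 \<le> snd p \<longrightarrow> w0 (snd p) = W (snd p))"
      "fst p \<noteq> 0 \<and> snd p \<noteq> 0"
    show "case p of (s, t) \<Rightarrow> s \<ge> t \<and> t \<ge> 0 \<longrightarrow> w0 s \<le> ennreal K * w0 t"
    proof (cases p)
      case (Pair s t)
      have "w0 s \<le> ennreal K * w0 t" if "t \<le> s" "0 \<le> t"
      proof -
        have "0 < t" "1 / 2 * t \<le> s" "0 \<le> s" using that p(3) Pair by auto
        then show ?thesis using p(1,2) that Pair by (simp only: fst_conv snd_conv)
      qed
      then show ?thesis using Pair by simp
    qed
  qed
  then show "AE (s, t) in (lebesgue :: (real \<times> real) measure). s \<ge> t \<and> t \<ge> 0 \<longrightarrow> w0 s \<le> ennreal K * w0 t"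
    by (simp only: AE_completion_iff lborel_prod)
qed

section \<open>The equivalence\<close>

theorem proposition2p3:
  fixes w0 :: "real \<Rightarrow> ennreal"
  defines "w \<equiv> \<lambda>n x. w0 (nrm n x)"
  assumes "radial_weight w0"
  defines "stmt_a \<equiv> (\<exists>N::nat. N > 0 \<and>
      (bounded_beyond N (\<lambda>n. A1_const n (w n)) \<or>
       bounded_beyond N (\<lambda>n. A1_star_const n (w n)) \<or>
       bounded_beyond N (\<lambda>n. A1_radial_const n w0)))"
    and "stmt_b \<equiv> (\<exists>N::nat. \<exists>C::real. N > 0 \<and> C > 0 \<and>
      (\<forall>n>N. \<forall>f. radial_fun n f \<and> in_L1 n (w n) f \<longrightarrow>
        (\<forall>l::real. l > 0 \<longrightarrow>
          weighted n (w n) {x \<in> Rn n. ring_maximal n f x > ennreal l}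
            \<le> ennreal (C / l) * (\<integral>\<^sup>+x. ennreal \<bar>f x\<bar> * w n x \<partial>leb n))))"
    and "stmt_c \<equiv> (\<exists>\<beta>::real. \<exists>\<eta>::real. \<beta> > 0 \<and> \<eta> > 0 \<and>
      (\<forall>R>0. esssup (lebesgue_on {R..2*R}) w0 \<le> ennreal \<beta> * essinf (lebesgue_on {R..2*R}) w0) \<and>
      (AE (s, t) in (lebesgue :: (real \<times> real) measure).
         s \<ge> t \<and> t \<ge> 0 \<longrightarrow> w0 s \<le> ennreal \<eta> * w0 t))"
  shows "(stmt_a \<longleftrightarrow> stmt_b) \<and> (stmt_b \<longleftrightarrow> stmt_c)"
proof -
  obtain W where W: "represents W w0" using radial_weight_representation[OF assms(2)] by blast
  have Wm: "W \<in> borel_measurable borel" and fin: "\<And>t. W t < \<infinity>"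
    and loc: "\<And>a b. 0 < a \<Longrightarrow> (\<integral>\<^sup>+t. W t * indicator {a..b} t \<partial>lborel) < \<infinity>"
    using W by (auto simp: represents_def)
  have wm: "w0 \<in> borel_measurable (lebesgue_on {0..})" using assms(2) by (simp add: radial_weight_def)
  have weq: "weighted n (w n) E = weighted n (\<lambda>y. W (nrm n y)) E" if "0 < n" for n E
    unfolding w_def by (rule weighted_represents[OF W that])
  have int_eq: "(\<integral>\<^sup>+x. ennreal \<bar>f x\<bar> * w n x \<partial>leb n) = (\<integral>\<^sup>+x. ennreal \<bar>f x\<bar> * W (nrm n x) \<partial>leb n)" if "0 < n" for n f
    unfolding nn_integral_leb w_def
    by (rule nn_integral_cong_AE, use AE_represents[OF W that] in eventually_elim) simp
  have a: "\<exists>K. almost_decreasing K W" if a: stmt_a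
  proof -
    from a obtain N :: nat where "bounded_beyond N (\<lambda>n. A1_const n (w n)) \<or>
       bounded_beyond N (\<lambda>n. A1_star_const n (w n)) \<or> bounded_beyond N (\<lambda>n. A1_radial_const n w0)"
      by (auto simp: stmt_a_def)
    then consider (A) K where "\<And>n. n > N \<Longrightarrow> A1_const n (w n) \<le> ennreal K"
      | (S) K where "\<And>n. n > N \<Longrightarrow> A1_star_const n (w n) \<le> ennreal K"
      | (R) K where "\<And>n. n > N \<Longrightarrow> A1_radial_const n w0 \<le> ennreal K"
      unfolding bounded_beyond_def by blast
    then show ?thesis
    proof cases
      case A
      then have "centred_A1 (max K 0 + 1) n W" if "n > N" for n
        using that by (intro centred_A1_if_A1_const[OF W]) (auto simp: w_def)
      then show ?thesis by (intro almost_decreasing_if_centred_A1[OF Wm fin loc, of "max K 0 + 1" N]) auto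
    next
      case S
      then have "centred_A1 (max K 0 + 1) n W" if "n > N" for n
        using that by (intro centred_A1_if_A1_star_const[OF W]) (auto simp: w_def)
      then show ?thesis by (intro almost_decreasing_if_centred_A1[OF Wm fin loc, of "max K 0 + 1" N]) auto
    next
      case R
      then have "interval_A1 (max K 0 + 1) n W" if "n > N" for n
        using that by (intro interval_A1_if_A1_radial_const[OF W]) auto
      then show ?thesis by (intro almost_decreasing_if_interval_A1[OF Wm fin loc, of "max K 0 + 1" N]) auto
    qed
  qed
  have b: "\<exists>K. almost_decreasing K W" if b: stmt_b
  proof -
    from b obtain N :: nat and C :: real where C: "C > 0" and weak: "\<And>n f l. n > N \<Longrightarrow> radial_fun n f \<Longrightarrow> in_L1 n (w n) f \<Longrightarrow> l > 0 \<Longrightarrow>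
          weighted n (w n) {x \<in> Rn n. ring_maximal n f x > ennreal l}
            \<le> ennreal (C / l) * (\<integral>\<^sup>+x. ennreal \<bar>f x\<bar> * w n x \<partial>leb n)"
      unfolding stmt_b_def by blast
    have "interval_A1 (2 * C) n W" if n: "n > N" for n
    proof (rule interval_A1_if_weak_type[OF Wm _ C])
      show n0: "0 < n" using n by simp
      fix f and l :: real
      assume "radial_fun n f" "in_L1 n (\<lambda>y. W (nrm n y)) f" "0 < l"
      then show "weighted n (\<lambda>y. W (nrm n y)) {x \<in> Rn n. ring_maximal n f x > ennreal l}
          \<le> ennreal (C / l) * (\<integral>\<^sup>+x. ennreal \<bar>f x\<bar> * W (nrm n x) \<partial>leb n)"
        using weak[OF n, of f l] by (simp add: weq[OF n0] int_eq[OF n0] in_L1_def)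
    qed
    then show ?thesis using C by (intro almost_decreasing_if_interval_A1[OF Wm fin loc, of "2 * C" N]) auto
  qed
  have c: "\<exists>K. almost_decreasing K W" if c: stmt_c
    using c almost_decreasing_if_profile_condition[OF W] unfolding stmt_c_def by blast
  have converse: "stmt_a \<and> stmt_b \<and> stmt_c" if T: "\<exists>K. almost_decreasing K W"
  proof -
    from T obtain K where K: "1 \<le> K" "almost_decreasing K W" by (meson max.cobounded1 max.cobounded2 almost_decreasing_mono)
    obtain p :: nat where p: "K ^ 2 \<le> 2 ^ p" using real_arch_pow[of 2 "K ^ 2"] by (auto intro: less_imp_le)
    define C where "C = 2 * 4 ^ p * K"
    have C: "0 < C" using K by (simp add: C_def)
    have A: "interval_A1 C n W" if "n > 2 * p + 1" for n
      unfolding C_def using that by (intro interval_A1_if_almost_decreasing[OF Wm K p]) auto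
    have stmt_a
    proof -
      have "bounded_beyond (2 * p + 1) (\<lambda>n. A1_radial_const n w0)"
        unfolding bounded_beyond_def using A C
        by (intro exI[of _ C] allI impI A1_radial_const_le[OF W]) auto
      then show ?thesis unfolding stmt_a_def by (intro exI[of _ "2 * p + 1"]) simp
    qed
    moreover have stmt_b
      unfolding stmt_b_def
    proof (intro exI[of _ "2 * p + 1"] exI[of _ "2 * C"] conjI allI impI; (elim conjE)?)
      fix n f and l :: real
      assume n: "2 * p + 1 < n" and f: "in_L1 n (w n) f" and l: "0 < l"
      have n0: "0 < n" using n by simp
      have "f \<in> borel_measurable (leb n)" using f by (simp add: in_L1_def)
      from weak_type_if_interval_A1[OF Wm n0 _ A[OF n] this l] C
      show "weighted n (w n) {x \<in> Rn n. ring_maximal n f x > ennreal l}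
            \<le> ennreal (2 * C / l) * (\<integral>\<^sup>+x. ennreal \<bar>f x\<bar> * w n x \<partial>leb n)"
        by (simp add: weq[OF n0] int_eq[OF n0])
    qed (use C in auto)
    moreover have stmt_c
      unfolding stmt_c_def using profile_condition_if_almost_decreasing[OF W wm K] K(1)
      by (intro exI[of _ K]) auto
    ultimately show ?thesis by blast
  qed
  show ?thesis using a b c converse by blast
qed

end
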